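(* Let $(M,g)$ be a Riemannian spin manifold with an integrable generalised $G$-structure, i.e. let $H\in\Omega^3(M)$ be closed, $\phi\in C^\infty(M)$, and let $\Psi_L,\Psi_R$ be unit spinor fields (sections of the complex spinor bundle) such that for all vector fields $X$ $$\nabla_X\Psi_L+\tfrac14(X\llcorner H)\cdot\Psi_L=0,\quad (d\phi+\tfrac12H)\cdot\Psi_L=0,$$ $$\nabla_X\Psi_R-\tfrac14(X\llcorner H)\cdot\Psi_R=0,\quad (d\phi-\tfrac12H)\cdot\Psi_R=0.$$ Then the Ricci tensor and the scalar curvature of $g$ are $$\mathrm{Ric}(X,Y)=-2\mathcal{H}^{\phi}(X,Y)+\tfrac12 g(X\llcorner H,Y\llcorner H),\qquad S=2\Delta\phi+\tfrac32\|H\|^2 .$$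
   Context: $\nabla$ is the Levi-Civita connection (on tensors and spinors). $X\llcorner H=H(X,\cdot,\cdot)$. Clifford multiplication satisfies $X\cdot Y+Y\cdot X=-2g(X,Y)$, and forms act on spinors via $e_{i_1}\wedge\dots\wedge e_{i_p}\mapsto e_{i_1}\cdot\ldots\cdot e_{i_p}$ for orthonormal $e_i$. $\mathcal{H}^\phi=\nabla d\phi$ is the Hessian of $\phi$ and $\Delta\phi=-\mathrm{Tr}_g\mathcal{H}^\phi$ is the Laplacian with nonnegative spectrum. The inner product and norm on $p$-forms are those for which $e^{i_1}\wedge\dots\wedge e^{i_p}$, $i_1<\dots<i_p$, is orthonormal; e.g. $\|H\|^2=\sum_{i<j<k}H(e_i,e_j,e_k)^2$. *)

theory Defs
  imports "HOL-Analysis.Analysis"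
begin

section \<open>Smooth manifolds and tangent vectors\<close>

text \<open>
  The manifold is the whole type \<open>'m\<close>; its dimension is \<open>CARD('n)\<close>.  The order on the index type
  \<open>'n\<close> only serves to write sums over \<open>a < b\<close> and \<open>a < b < c\<close>.
\<close>

primrec Ck_on :: "nat \<Rightarrow> 'a::euclidean_space set \<Rightarrow> ('a \<Rightarrow> 'b::real_normed_vector) \<Rightarrow> bool" where
  "Ck_on 0 S f \<longleftrightarrow> continuous_on S f"
| "Ck_on (Suc k) S f \<longleftrightarrow>
     (\<forall>x\<in>S. f differentiable (at x)) \<and> (\<forall>v. Ck_on k S (\<lambda>x. frechet_derivative f (at x) v))"

text \<open>Only used for open \<open>S\<close>.\<close>
definition smooth_on :: "'a::euclidean_space set \<Rightarrow> ('a \<Rightarrow> 'b::real_normed_vector) \<Rightarrow> bool" where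
  "smooth_on S f \<longleftrightarrow> (\<forall>k. Ck_on k S f)"

type_synonym ('m, 'n) chart = "'m set \<times> ('m \<Rightarrow> real^'n)"

definition smooth_fun :: "('m::topological_space, 'n::finite) chart set \<Rightarrow> 'm set \<Rightarrow>
    ('m \<Rightarrow> 'b::real_normed_vector) \<Rightarrow> bool" where
  "smooth_fun A U f \<longleftrightarrow> (\<forall>(V, x)\<in>A. smooth_on (x ` (U \<inter> V)) (f \<circ> inv_into V x))"

definition smooth_near :: "('m::topological_space, 'n::finite) chart set \<Rightarrow> 'm \<Rightarrow>
    ('m \<Rightarrow> real) \<Rightarrow> bool" where
  "smooth_near A p f \<longleftrightarrow> (\<exists>U. open U \<and> p \<in> U \<and> smooth_fun A U f)"

locale smooth_manifold =
  fixes A :: "('m::{second_countable_topology,t2_space}, 'n::finite) chart set"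
  assumes chart: "\<And>U x. (U, x) \<in> A \<Longrightarrow>
      open U \<and> open (x ` U) \<and> homeomorphism U (x ` U) x (inv_into U x)"
    and charts_cover: "(\<Union>(U, x)\<in>A. U) = UNIV"
    and transition_smooth: "\<And>U x V y. (U, x) \<in> A \<Longrightarrow> (V, y) \<in> A \<Longrightarrow>
      smooth_on (x ` (U \<inter> V)) (y \<circ> inv_into U x)"

text \<open>
  A tangent vector at \<open>p\<close> is a directional derivative operator on the real functions that are
  smooth near \<open>p\<close>.  It is set to \<open>0\<close> on all other functions, so that equality of tangent vectors
  is equality of operators.
\<close>

type_synonym 'm tangent = "('m \<Rightarrow> real) \<Rightarrow> real"
type_synonym 'm vfield = "'m \<Rightarrow> 'm tangent"

definition tangent_space :: "('m::topological_space, 'n::finite) chart set \<Rightarrow> 'm \<Rightarrow>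
    'm tangent set" where
  "tangent_space A p = {v. \<exists>(U, x)\<in>A. p \<in> U \<and> (\<exists>w. v =
     (\<lambda>f. if smooth_near A p f then frechet_derivative (f \<circ> inv_into U x) (at (x p)) w else 0))}"

text \<open>
  Smooth vector fields on an open set \<open>U\<close>.  The values of the total function \<open>X\<close> outside \<open>U\<close>
  are irrelevant.
\<close>

definition vector_fields :: "('m::topological_space, 'n::finite) chart set \<Rightarrow> 'm set \<Rightarrow>
    'm vfield set" where
  "vector_fields A U = {X. (\<forall>p\<in>U. X p \<in> tangent_space A p) \<and>
     (\<forall>V f. open V \<longrightarrow> V \<subseteq> U \<longrightarrow> smooth_fun A V f \<longrightarrow> smooth_fun A V (\<lambda>p. X p f))}"

definition lie_bracket :: "('m::topological_space, 'n::finite) chart set \<Rightarrow> 'm vfield \<Rightarrow>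
    'm vfield \<Rightarrow> 'm vfield" where
  "lie_bracket A X Y = (\<lambda>p f. if smooth_near A p f
     then X p (\<lambda>q. Y q f) - Y p (\<lambda>q. X q f) else 0)"

section \<open>Riemannian metrics, the Levi-Civita connection and curvature\<close>

locale riemannian_manifold = smooth_manifold A
  for A :: "('m::{second_countable_topology,t2_space}, 'n::finite) chart set" +
  fixes g :: "'m \<Rightarrow> 'm tangent \<Rightarrow> 'm tangent \<Rightarrow> real"
  assumes metric_linear: "\<And>p u v w r. u \<in> tangent_space A p \<Longrightarrow> v \<in> tangent_space A p \<Longrightarrow>
      w \<in> tangent_space A p \<Longrightarrow> g p (\<lambda>f. r * u f + v f) w = r * g p u w + g p v w"
    and metric_sym: "\<And>p u v. u \<in> tangent_space A p \<Longrightarrow> v \<in> tangent_space A p \<Longrightarrow>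
      g p u v = g p v u"
    and metric_pos: "\<And>p v. v \<in> tangent_space A p \<Longrightarrow> v \<noteq> (\<lambda>_. 0) \<Longrightarrow> g p v v > 0"
    and metric_smooth: "\<And>U X Y. open U \<Longrightarrow> X \<in> vector_fields A U \<Longrightarrow> Y \<in> vector_fields A U \<Longrightarrow>
      smooth_fun A U (\<lambda>p. g p (X p) (Y p))"

text \<open>
  \<open>nabla X Y\<close> is the covariant derivative of \<open>Y\<close> along \<open>X\<close>.  The axioms are imposed on the local
  vector fields over every open \<open>U\<close> and determine \<open>nabla X Y p\<close> for \<open>p \<in> U\<close>.
\<close>

locale levi_civita_connection = riemannian_manifold A g
  for A :: "('m::{second_countable_topology,t2_space}, 'n::finite) chart set" and g +
  fixes nabla :: "'m vfield \<Rightarrow> 'm vfield \<Rightarrow> 'm vfield"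
  assumes nabla_field: "\<And>U X Y. open U \<Longrightarrow> X \<in> vector_fields A U \<Longrightarrow> Y \<in> vector_fields A U \<Longrightarrow>
      nabla X Y \<in> vector_fields A U"
    and nabla_tensorial: "\<And>U X X' Y h p. open U \<Longrightarrow> X \<in> vector_fields A U \<Longrightarrow>
      X' \<in> vector_fields A U \<Longrightarrow> Y \<in> vector_fields A U \<Longrightarrow> smooth_fun A U h \<Longrightarrow> p \<in> U \<Longrightarrow>
      nabla (\<lambda>q f. h q * X q f + X' q f) Y p = (\<lambda>f. h p * nabla X Y p f + nabla X' Y p f)"
    and nabla_leibniz: "\<And>U X Y Y' h p. open U \<Longrightarrow> X \<in> vector_fields A U \<Longrightarrow>
      Y \<in> vector_fields A U \<Longrightarrow> Y' \<in> vector_fields A U \<Longrightarrow> smooth_fun A U h \<Longrightarrow> p \<in> U \<Longrightarrow>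
      nabla X (\<lambda>q f. h q * Y q f + Y' q f) p =
        (\<lambda>f. X p h * Y p f + h p * nabla X Y p f + nabla X Y' p f)"
    and nabla_torsion_free: "\<And>U X Y p. open U \<Longrightarrow> X \<in> vector_fields A U \<Longrightarrow>
      Y \<in> vector_fields A U \<Longrightarrow> p \<in> U \<Longrightarrow>
      (\<lambda>f. nabla X Y p f - nabla Y X p f) = lie_bracket A X Y p"
    and nabla_metric: "\<And>U X Y Z p. open U \<Longrightarrow> X \<in> vector_fields A U \<Longrightarrow>
      Y \<in> vector_fields A U \<Longrightarrow> Z \<in> vector_fields A U \<Longrightarrow> p \<in> U \<Longrightarrow>
      X p (\<lambda>q. g q (Y q) (Z q)) = g p (nabla X Y p) (Z p) + g p (Y p) (nabla X Z p)"

text \<open>There are \<open>CARD('n)\<close> fields \<open>E a\<close>, so orthonormality makes them a frame.\<close>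
definition orthonormal_frame :: "('m::topological_space, 'n::finite) chart set \<Rightarrow>
    ('m \<Rightarrow> 'm tangent \<Rightarrow> 'm tangent \<Rightarrow> real) \<Rightarrow> 'm set \<Rightarrow> ('n \<Rightarrow> 'm vfield) \<Rightarrow> bool" where
  "orthonormal_frame A g U E \<longleftrightarrow> (\<forall>a. E a \<in> vector_fields A U) \<and>
     (\<forall>p\<in>U. \<forall>a b. g p (E a p) (E b p) = (if a = b then 1 else 0))"

definition curvature :: "('m::topological_space, 'n::finite) chart set \<Rightarrow>
    ('m vfield \<Rightarrow> 'm vfield \<Rightarrow> 'm vfield) \<Rightarrow> 'm vfield \<Rightarrow> 'm vfield \<Rightarrow> 'm vfield \<Rightarrow> 'm vfield" where
  "curvature A nabla X Y Z = (\<lambda>p f. nabla X (nabla Y Z) p f - nabla Y (nabla X Z) p f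
     - nabla (lie_bracket A X Y) Z p f)"

text \<open>
  Metric traces are taken in a local orthonormal frame \<open>E\<close>; they do not depend on its choice.
  \<open>ricci\<close> is the trace of \<open>Z \<mapsto> R(Z,X)Y\<close>, positive on round spheres.
\<close>

definition ricci :: "('m::topological_space, 'n::finite) chart set \<Rightarrow>
    ('m \<Rightarrow> 'm tangent \<Rightarrow> 'm tangent \<Rightarrow> real) \<Rightarrow> ('m vfield \<Rightarrow> 'm vfield \<Rightarrow> 'm vfield) \<Rightarrow>
    ('n \<Rightarrow> 'm vfield) \<Rightarrow> 'm vfield \<Rightarrow> 'm vfield \<Rightarrow> 'm \<Rightarrow> real" where
  "ricci A g nabla E X Y p = (\<Sum>a\<in>UNIV. g p (curvature A nabla (E a) X Y p) (E a p))"

definition scalar_curvature :: "('m::topological_space, 'n::finite) chart set \<Rightarrow>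
    ('m \<Rightarrow> 'm tangent \<Rightarrow> 'm tangent \<Rightarrow> real) \<Rightarrow> ('m vfield \<Rightarrow> 'm vfield \<Rightarrow> 'm vfield) \<Rightarrow>
    ('n \<Rightarrow> 'm vfield) \<Rightarrow> 'm \<Rightarrow> real" where
  "scalar_curvature A g nabla E p = (\<Sum>a\<in>UNIV. ricci A g nabla E (E a) (E a) p)"

text \<open>The Hessian \<open>(\<nabla>\<^sub>X d\<phi>)(Y) = X(Y \<phi>) - (\<nabla>\<^sub>X Y) \<phi>\<close>.\<close>
definition hessian :: "('m vfield \<Rightarrow> 'm vfield \<Rightarrow> 'm vfield) \<Rightarrow> ('m \<Rightarrow> real) \<Rightarrow>
    'm vfield \<Rightarrow> 'm vfield \<Rightarrow> 'm \<Rightarrow> real" where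
  "hessian nabla \<phi> X Y p = X p (\<lambda>q. Y q \<phi>) - nabla X Y p \<phi>"

definition laplacian :: "('m vfield \<Rightarrow> 'm vfield \<Rightarrow> 'm vfield) \<Rightarrow> ('n::finite \<Rightarrow> 'm vfield) \<Rightarrow>
    ('m \<Rightarrow> real) \<Rightarrow> 'm \<Rightarrow> real" where
  "laplacian nabla E \<phi> p = - (\<Sum>a\<in>UNIV. hessian nabla \<phi> (E a) (E a) p)"

section \<open>Differential forms\<close>

definition differential :: "('m \<Rightarrow> real) \<Rightarrow> 'm tangent \<Rightarrow> real" where
  "differential \<phi> v = v \<phi>"

definition three_form :: "('m::topological_space, 'n::finite) chart set \<Rightarrow>
    ('m \<Rightarrow> 'm tangent \<Rightarrow> 'm tangent \<Rightarrow> 'm tangent \<Rightarrow> real) \<Rightarrow> bool" where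
  "three_form A H \<longleftrightarrow>
     (\<forall>p. \<forall>u\<in>tangent_space A p. \<forall>v\<in>tangent_space A p. \<forall>w\<in>tangent_space A p.
        \<forall>u'\<in>tangent_space A p. \<forall>r.
          H p (\<lambda>f. r * u f + u' f) v w = r * H p u v w + H p u' v w) \<and>
     (\<forall>p. \<forall>u\<in>tangent_space A p. \<forall>v\<in>tangent_space A p. \<forall>w\<in>tangent_space A p.
        H p v u w = - H p u v w \<and> H p u w v = - H p u v w) \<and>
     (\<forall>U X Y Z. open U \<longrightarrow> X \<in> vector_fields A U \<longrightarrow> Y \<in> vector_fields A U \<longrightarrow>
        Z \<in> vector_fields A U \<longrightarrow> smooth_fun A U (\<lambda>p. H p (X p) (Y p) (Z p)))"

definition ext_deriv3 :: "('m::topological_space, 'n::finite) chart set \<Rightarrow>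
    ('m \<Rightarrow> 'm tangent \<Rightarrow> 'm tangent \<Rightarrow> 'm tangent \<Rightarrow> real) \<Rightarrow>
    'm vfield \<Rightarrow> 'm vfield \<Rightarrow> 'm vfield \<Rightarrow> 'm vfield \<Rightarrow> 'm \<Rightarrow> real" where
  "ext_deriv3 A H X Y Z W p =
     X p (\<lambda>q. H q (Y q) (Z q) (W q)) - Y p (\<lambda>q. H q (X q) (Z q) (W q))
     + Z p (\<lambda>q. H q (X q) (Y q) (W q)) - W p (\<lambda>q. H q (X q) (Y q) (Z q))
     - H p (lie_bracket A X Y p) (Z p) (W p) + H p (lie_bracket A X Z p) (Y p) (W p)
     - H p (lie_bracket A X W p) (Y p) (Z p) - H p (lie_bracket A Y Z p) (X p) (W p)
     + H p (lie_bracket A Y W p) (X p) (Z p) - H p (lie_bracket A Z W p) (X p) (Y p)"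

definition closed_three_form :: "('m::topological_space, 'n::finite) chart set \<Rightarrow>
    ('m \<Rightarrow> 'm tangent \<Rightarrow> 'm tangent \<Rightarrow> 'm tangent \<Rightarrow> real) \<Rightarrow> bool" where
  "closed_three_form A H \<longleftrightarrow> three_form A H \<and>
     (\<forall>U X Y Z W. open U \<longrightarrow> X \<in> vector_fields A U \<longrightarrow> Y \<in> vector_fields A U \<longrightarrow>
        Z \<in> vector_fields A U \<longrightarrow> W \<in> vector_fields A U \<longrightarrow>
        (\<forall>p\<in>U. ext_deriv3 A H X Y Z W p = 0))"

text \<open>
  In what follows \<open>e\<close> is an orthonormal basis of one tangent space.  If \<open>H\<close> is a 3-form then
  \<open>H p (X p)\<close> is the value at \<open>p\<close> of the contracted 2-form \<open>X \<llcorner> H\<close>.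
\<close>

definition inner_form2 :: "('n::{finite,linorder} \<Rightarrow> 'm tangent) \<Rightarrow>
    ('m tangent \<Rightarrow> 'm tangent \<Rightarrow> real) \<Rightarrow> ('m tangent \<Rightarrow> 'm tangent \<Rightarrow> real) \<Rightarrow> real" where
  "inner_form2 e \<omega> \<tau> = (\<Sum>(a, b)\<in>{(a, b). a < b}. \<omega> (e a) (e b) * \<tau> (e a) (e b))"

definition sqnorm_form3 :: "('n::{finite,linorder} \<Rightarrow> 'm tangent) \<Rightarrow>
    ('m tangent \<Rightarrow> 'm tangent \<Rightarrow> 'm tangent \<Rightarrow> real) \<Rightarrow> real" where
  "sqnorm_form3 e \<omega> = (\<Sum>(a, b, c)\<in>{(a, b, c). a < b \<and> b < c}. (\<omega> (e a) (e b) (e c))\<^sup>2)"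

section \<open>Clifford modules and the spin group\<close>

text \<open>
  \<open>cl a\<close> is the matrix of Clifford multiplication by the \<open>a\<close>-th standard basis vector of \<open>\<real>\<^sup>n\<close>
  on the complex spinor module \<open>complex^'k\<close>, an irreducible complex representation of the Clifford
  algebra carrying a Hermitian product for which unit vectors act isometrically.
\<close>

definition cl_vec :: "('n::finite \<Rightarrow> complex^'k^'k) \<Rightarrow> real^'n \<Rightarrow> complex^'k::finite^'k" where
  "cl_vec cl v = (\<Sum>a\<in>UNIV. (v $ a) *\<^sub>R cl a)"

definition spinor_module :: "('n::finite \<Rightarrow> complex^'k^'k::finite) \<Rightarrow> bool" where
  "spinor_module cl \<longleftrightarrow>
     (\<forall>v w. cl_vec cl v ** cl_vec cl w + cl_vec cl w ** cl_vec cl v = (- 2 * (v \<bullet> w)) *\<^sub>R mat 1) \<and>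
     (\<forall>v s. norm (cl_vec cl v *v s) = norm v * norm s) \<and>
     (\<forall>W. vec.subspace W \<longrightarrow> (\<forall>a. \<forall>s\<in>W. cl a *v s \<in> W) \<longrightarrow> W = {0} \<or> W = UNIV)"

text \<open>
  \<open>Spin(n)\<close> consists of the products of an even number of unit vectors.  It lies in the even part of
  the Clifford algebra, on which the spinor module is faithful, so it may be identified with
  its image in the matrices.
\<close>

inductive_set spin_group :: "('n::finite \<Rightarrow> complex^'k^'k::finite) \<Rightarrow> (complex^'k^'k) set"
  for cl where
  spin_one: "mat 1 \<in> spin_group cl"
| spin_mult: "u \<in> spin_group cl \<Longrightarrow> norm v = 1 \<Longrightarrow> norm w = 1 \<Longrightarrow>
    u ** cl_vec cl v ** cl_vec cl w \<in> spin_group cl"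

text \<open>The double covering \<open>Spin(n) \<rightarrow> SO(n)\<close>, characterised by \<open>u \<cdot> v \<cdot> u\<^sup>-\<^sup>1 = \<lambda>(u) v\<close>.\<close>
definition spin_cover :: "('n::finite \<Rightarrow> complex^'k^'k::finite) \<Rightarrow> complex^'k^'k \<Rightarrow> real^'n^'n" where
  "spin_cover cl u = (THE L. \<forall>v. u ** cl_vec cl v = cl_vec cl (L *v v) ** u)"

text \<open>Clifford action of 1-, 2- and 3-forms, expressed in an orthonormal basis \<open>e\<close>.\<close>

definition clifford1 :: "('n::finite \<Rightarrow> complex^'k^'k::finite) \<Rightarrow> ('n \<Rightarrow> 'm tangent) \<Rightarrow>
    ('m tangent \<Rightarrow> real) \<Rightarrow> complex^'k \<Rightarrow> complex^'k" where
  "clifford1 cl e \<omega> s = (\<Sum>a\<in>UNIV. \<omega> (e a) *\<^sub>R (cl a *v s))"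

definition clifford2 :: "('n::{finite,linorder} \<Rightarrow> complex^'k^'k::finite) \<Rightarrow>
    ('n \<Rightarrow> 'm tangent) \<Rightarrow> ('m tangent \<Rightarrow> 'm tangent \<Rightarrow> real) \<Rightarrow> complex^'k \<Rightarrow> complex^'k" where
  "clifford2 cl e \<omega> s =
     (\<Sum>(a, b)\<in>{(a, b). a < b}. \<omega> (e a) (e b) *\<^sub>R (cl a *v (cl b *v s)))"

definition clifford3 :: "('n::{finite,linorder} \<Rightarrow> complex^'k^'k::finite) \<Rightarrow>
    ('n \<Rightarrow> 'm tangent) \<Rightarrow> ('m tangent \<Rightarrow> 'm tangent \<Rightarrow> 'm tangent \<Rightarrow> real) \<Rightarrow>
    complex^'k \<Rightarrow> complex^'k" where
  "clifford3 cl e \<omega> s = (\<Sum>(a, b, c)\<in>{(a, b, c). a < b \<and> b < c}.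
     \<omega> (e a) (e b) (e c) *\<^sub>R (cl a *v (cl b *v (cl c *v s))))"

section \<open>Spin structures and spinor fields\<close>

text \<open>
  A spin structure is a principal \<open>Spin(n)\<close>-bundle \<open>proj : P \<rightarrow> M\<close> with right action \<open>act\<close>, together
  with a map \<open>fr\<close> to orthonormal frames that is equivariant along \<open>Spin(n) \<rightarrow> SO(n)\<close>.  Its smooth
  structure is given by an atlas \<open>S\<close> of local sections \<open>(U, s)\<close>, any two of which differ by a smooth
  \<open>Spin(n)\<close>-valued function.  The image of \<open>fr\<close> is the bundle of oriented frames; in particular it
  fixes the orientation of \<open>M\<close>.
\<close>

locale riemannian_spin_manifold = riemannian_manifold A g
  for A :: "('m::{second_countable_topology,t2_space}, 'n::finite) chart set" and g +
  fixes cl :: "'n \<Rightarrow> complex^'k^'k::finite"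
    and P :: "'p set" and proj :: "'p \<Rightarrow> 'm" and act :: "'p \<Rightarrow> complex^'k^'k \<Rightarrow> 'p"
    and fr :: "'p \<Rightarrow> 'n \<Rightarrow> 'm tangent" and S :: "('m set \<times> ('m \<Rightarrow> 'p)) set"
  assumes module: "spinor_module cl"
    and act_closed: "\<And>b u. b \<in> P \<Longrightarrow> u \<in> spin_group cl \<Longrightarrow> act b u \<in> P \<and> proj (act b u) = proj b"
    and act_one: "\<And>b. b \<in> P \<Longrightarrow> act b (mat 1) = b"
    and act_mult: "\<And>b u v. b \<in> P \<Longrightarrow> u \<in> spin_group cl \<Longrightarrow> v \<in> spin_group cl \<Longrightarrow>
      act (act b u) v = act b (u ** v)"
    and act_simply_transitive: "\<And>b b'. b \<in> P \<Longrightarrow> b' \<in> P \<Longrightarrow> proj b = proj b' \<Longrightarrow>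
      \<exists>!u. u \<in> spin_group cl \<and> b' = act b u"
    and fr_tangent: "\<And>b a. b \<in> P \<Longrightarrow> fr b a \<in> tangent_space A (proj b)"
    and fr_orthonormal: "\<And>b a c. b \<in> P \<Longrightarrow>
      g (proj b) (fr b a) (fr b c) = (if a = c then 1 else 0)"
    and fr_equivariant: "\<And>b u a. b \<in> P \<Longrightarrow> u \<in> spin_group cl \<Longrightarrow>
      fr (act b u) a = (\<lambda>f. \<Sum>c\<in>UNIV. spin_cover cl u $ c $ a * fr b c f)"
    and section_open: "\<And>U s. (U, s) \<in> S \<Longrightarrow> open U"
    and section_in_fibre: "\<And>U s q. (U, s) \<in> S \<Longrightarrow> q \<in> U \<Longrightarrow> s q \<in> P \<and> proj (s q) = q"
    and sections_cover: "(\<Union>(U, s)\<in>S. U) = UNIV"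
    and section_frame: "\<And>U s a. (U, s) \<in> S \<Longrightarrow> (\<lambda>q. fr (s q) a) \<in> vector_fields A U"
    and section_transition: "\<And>U s V t. (U, s) \<in> S \<Longrightarrow> (V, t) \<in> S \<Longrightarrow>
      \<exists>h. smooth_fun A (U \<inter> V) h \<and> (\<forall>q\<in>U \<inter> V. h q \<in> spin_group cl \<and> t q = act (s q) (h q))"

text \<open>
  Sections of the associated bundle \<open>P \<times>\<^bsub>Spin(n)\<^esub> \<complex>\<^sup>k\<close> as equivariant functions on \<open>P\<close>:
  \<open>\<Psi>(b u) = u\<^sup>-\<^sup>1 \<Psi>(b)\<close>.
\<close>

definition spinor_field :: "('m::topological_space, 'n::finite) chart set \<Rightarrow>
    ('n \<Rightarrow> complex^'k^'k::finite) \<Rightarrow> 'p set \<Rightarrow> ('p \<Rightarrow> complex^'k^'k \<Rightarrow> 'p) \<Rightarrow>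
    ('m set \<times> ('m \<Rightarrow> 'p)) set \<Rightarrow> ('p \<Rightarrow> complex^'k) \<Rightarrow> bool" where
  "spinor_field A cl P act S \<Psi> \<longleftrightarrow>
     (\<forall>b\<in>P. \<forall>u\<in>spin_group cl. u *v \<Psi> (act b u) = \<Psi> b) \<and>
     (\<forall>(U, s)\<in>S. smooth_fun A U (\<Psi> \<circ> s))"

definition spinor_deriv :: "'m tangent \<Rightarrow> ('m \<Rightarrow> complex^'k::finite) \<Rightarrow> complex^'k" where
  "spinor_deriv v \<psi> = (\<chi> j. Complex (v (\<lambda>q. Re (\<psi> q $ j))) (v (\<lambda>q. Im (\<psi> q $ j))))"

text \<open>
  The spinorial Levi-Civita connection in the gauge of a local spin frame with underlying
  orthonormal frame \<open>e\<close>: \<open>X(\<psi>) + 1/2 \<Sum>\<^bsub>a<b\<^esub> g(\<nabla>\<^sub>X e\<^sub>a, e\<^sub>b) e\<^sub>a \<cdot> e\<^sub>b \<cdot> \<psi>\<close>.  With \<open>e\<^sub>a \<cdot> e\<^sub>a = -1\<close> this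
  is the sign for which Clifford multiplication is parallel.
\<close>

definition spin_nabla :: "('m \<Rightarrow> 'm tangent \<Rightarrow> 'm tangent \<Rightarrow> real) \<Rightarrow>
    ('m vfield \<Rightarrow> 'm vfield \<Rightarrow> 'm vfield) \<Rightarrow> ('n::{finite,linorder} \<Rightarrow> complex^'k^'k::finite) \<Rightarrow>
    ('n \<Rightarrow> 'm vfield) \<Rightarrow> 'm vfield \<Rightarrow> ('m \<Rightarrow> complex^'k) \<Rightarrow> 'm \<Rightarrow> complex^'k" where
  "spin_nabla g nabla cl e X \<psi> p = spinor_deriv (X p) \<psi> +
     (1/2) *\<^sub>R (\<Sum>(a, b)\<in>{(a, b). a < b}.
        g p (nabla X (e a) p) (e b p) *\<^sub>R (cl a *v (cl b *v \<psi> p)))"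

end

theory Submission
  imports Defs
begin

text \<open>
  The equations for \<open>\<Psi>\<^sub>L\<close> alone suffice.  They say that \<open>\<Psi> = \<Psi>\<^sub>L\<close> is parallel for the metric
  connection \<open>\<nabla>\<^sup>+ = \<nabla> + 1/2 H\<close>, so the curvature \<open>K\<close> of \<open>\<nabla>\<^sup>+\<close> satisfies
  \<open>K\<^bsub>dcab\<^esub> e\<^sub>a e\<^sub>b \<Psi> = 0\<close> (repeated indices are summed).  Multiply by \<open>e\<^sub>c\<close>: the part of \<open>K\<close> that is
  alternating in \<open>c, a, b\<close> is \<open>1/3 \<nabla>\<^sup>+\<^sub>d H\<^bsub>cab\<^esub>\<close>, by the Bianchi identity and \<open>dH = 0\<close>, and the
  rest is the trace \<open>- 2 K\<^bsub>dccb\<^esub> e\<^sub>b\<close>.  Differentiating \<open>(d\<phi> + 1/2 H) \<Psi> = 0\<close> with \<open>\<nabla>\<^sup>+\<close> gives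
  \<open>(\<nabla>\<^sup>+\<^sub>d d\<phi> + 1/2 \<nabla>\<^sup>+\<^sub>d H) \<Psi> = 0\<close>, which cancels the 3-form part and leaves
  \<open>(2 (\<nabla>\<^sup>+\<^sub>d d\<phi>)\<^sub>b + K\<^bsub>dccb\<^esub>) e\<^sub>b \<Psi> = 0\<close>.  A real vector that annihilates a nonzero spinor vanishes,
  and the part symmetric in \<open>d, b\<close> is the formula for the Ricci tensor.
\<close>

section \<open>Smooth functions and tangent vectors\<close>

text \<open>A local section of the spin structure turns the spinor into a function with values in
  \<open>complex^'k\<close>, but it also dictates the frame, which need not be normal at the point.
  All connection symbols are therefore kept, and the covariant quantities are assembled from
  derivatives of component functions. The torsion H costs K its pair symmetry, so the final vector
  equation is not symmetric in \<open>d\<close> and \<open>b\<close>: its antisymmetric part says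
  that exp(-2 \<phi>) H is coclosed, and symmetrising removes every derivative of H. The formula in
  the spin frame then passes to arbitrary fields and orthonormal frames, possibly of the other
  orientation, by linearity over smooth functions. The encoding is a second obstacle. Vector fields
  are total functions with arbitrary values outside their domain, and tangent vectors act on real
  functions only; so locality of the operators and the Leibniz rules for spinors need proofs. The
  constants come from summing over all indices instead of increasing ones: 1/12 is 1/2 times 1/6,
  and the 1/4 of the spin connection is 1/2 times 1/2.\<close>

lemma Ck_on_cong:
  assumes "open S" "\<And>x. x \<in> S \<Longrightarrow> f x = g x"
  shows "Ck_on k S f \<longleftrightarrow> Ck_on k S g"
  using assms(2)
proof (induction k arbitrary: f g)
  case 0
  then show ?case by (auto intro!: continuous_on_cong)
next
  case (Suc k)
  have hd: "(f has_derivative L) (at x) \<longleftrightarrow> (g has_derivative L) (at x)" if "x \<in> S" for x L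
    using has_derivative_transform_within_open[OF _ assms(1) that] Suc.prems by metis
  have diff: "f differentiable (at x) \<longleftrightarrow> g differentiable (at x)" if "x \<in> S" for x
    unfolding differentiable_def using hd[OF that] by simp
  \<comment> \<open>\<open>frechet_derivative\<close> is a choice that depends only on the predicate
    \<open>has_derivative\<close>, so the two agree even where neither function is
    differentiable.\<close>
  have fr: "frechet_derivative f (at x) = frechet_derivative g (at x)" if "x \<in> S" for x
    unfolding frechet_derivative_def using hd[OF that] by simp
  have "Ck_on k S (\<lambda>x. frechet_derivative f (at x) v) \<longleftrightarrow> Ck_on k S (\<lambda>x. frechet_derivative g (at x) v)" for v
    by (rule Suc.IH) (simp add: fr)
  then show ?case using diff by simp
qed

lemma Ck_on_subset: "Ck_on k S f \<Longrightarrow> T \<subseteq> S \<Longrightarrow> Ck_on k T f"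
  by (induction k arbitrary: f) (auto intro: continuous_on_subset)

lemma Ck_on_SucD: "Ck_on (Suc k) S f \<Longrightarrow> Ck_on k S f"
proof (induction k arbitrary: f)
  case 0
  then show ?case
    by (auto intro!: continuous_at_imp_continuous_on differentiable_imp_continuous_within)
next
  case (Suc k)
  then show ?case by (metis Ck_on.simps(2))
qed

lemma Ck_on_const: "Ck_on k S (\<lambda>x. c)"
  by (induction k arbitrary: c) (auto simp: frechet_derivative_const)

lemma Ck_on_linear:
  assumes L: "bounded_linear L" and S: "open S"
  shows "Ck_on k S f \<Longrightarrow> Ck_on k S (\<lambda>x. L (f x))"
proof (induction k arbitrary: f)
  case 0
  then show ?case using bounded_linear.continuous_on[OF L] by auto
next
  case (Suc k)
  have d: "((\<lambda>x. L (f x)) has_derivative (\<lambda>v. L (frechet_derivative f (at x) v))) (at x)" if "x \<in> S" for x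
    using Suc.prems that bounded_linear.has_derivative[OF L] frechet_derivative_works by (metis Ck_on.simps(2))
  then have "(\<lambda>x. L (f x)) differentiable (at x)" if "x \<in> S" for x
    using that differentiableI by blast
  moreover have "Ck_on k S (\<lambda>x. frechet_derivative (\<lambda>x. L (f x)) (at x) v)" for v
  proof -
    have "Ck_on k S (\<lambda>x. L (frechet_derivative f (at x) v))"
      using Suc by simp
    moreover have "frechet_derivative (\<lambda>x. L (f x)) (at x) v = L (frechet_derivative f (at x) v)" if "x \<in> S" for x
      using frechet_derivative_at[OF d[OF that]] by metis
    ultimately show ?thesis using Ck_on_cong[OF S] by (metis (no_types, lifting))
  qed
  ultimately show ?case by simp
qed

lemma Ck_on_add:
  assumes S: "open S"
  shows "Ck_on k S f \<Longrightarrow> Ck_on k S g \<Longrightarrow> Ck_on k S (\<lambda>x. f x + g x)"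
proof (induction k arbitrary: f g)
  case 0
  then show ?case by (auto intro: continuous_on_add)
next
  case (Suc k)
  have d: "((\<lambda>x. f x + g x) has_derivative
      (\<lambda>v. frechet_derivative f (at x) v + frechet_derivative g (at x) v)) (at x)" if "x \<in> S" for x
    using Suc.prems that has_derivative_add frechet_derivative_works by (metis Ck_on.simps(2))
  then have "(\<lambda>x. f x + g x) differentiable (at x)" if "x \<in> S" for x
    using that differentiableI by blast
  moreover have "Ck_on k S (\<lambda>x. frechet_derivative (\<lambda>x. f x + g x) (at x) v)" for v
  proof -
    have "Ck_on k S (\<lambda>x. frechet_derivative f (at x) v + frechet_derivative g (at x) v)"
      using Suc by simp
    moreover have "frechet_derivative (\<lambda>x. f x + g x) (at x) v
      = frechet_derivative f (at x) v + frechet_derivative g (at x) v" if "x \<in> S" for x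
      using frechet_derivative_at[OF d[OF that]] by metis
    ultimately show ?thesis using Ck_on_cong[OF S] by (metis (no_types, lifting))
  qed
  ultimately show ?case by simp
qed

lemma Ck_on_mult:
  fixes f g :: "_ \<Rightarrow> real"
  assumes S: "open S"
  shows "Ck_on k S f \<Longrightarrow> Ck_on k S g \<Longrightarrow> Ck_on k S (\<lambda>x. f x * g x)"
proof (induction k arbitrary: f g)
  case 0
  then show ?case by (auto intro: continuous_on_mult)
next
  case (Suc k)
  have d: "((\<lambda>x. f x * g x) has_derivative
      (\<lambda>v. f x * frechet_derivative g (at x) v + frechet_derivative f (at x) v * g x)) (at x)" if "x \<in> S" for x
    using Suc.prems that frechet_derivative_works
    by (intro has_derivative_mult) auto
  then have "(\<lambda>x. f x * g x) differentiable (at x)" if "x \<in> S" for x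
    using that differentiableI by blast
  moreover have "Ck_on k S (\<lambda>x. frechet_derivative (\<lambda>x. f x * g x) (at x) v)" for v
  proof -
    have "Ck_on k S f" "Ck_on k S g" using Suc.prems Ck_on_SucD by blast+
    then have "Ck_on k S (\<lambda>x. f x * frechet_derivative g (at x) v + frechet_derivative f (at x) v * g x)"
      using Suc by (intro Ck_on_add[OF S] Suc.IH) auto
    moreover have "frechet_derivative (\<lambda>x. f x * g x) (at x) v
      = f x * frechet_derivative g (at x) v + frechet_derivative f (at x) v * g x" if "x \<in> S" for x
      using frechet_derivative_at[OF d[OF that]] by metis
    ultimately show ?thesis using Ck_on_cong[OF S] by (metis (no_types, lifting))
  qed
  ultimately show ?case by simp
qed

section \<open>Smooth functions on the manifold\<close>

context smooth_manifold
begin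

lemma chart_image_open:
  assumes "(V, x) \<in> A" "open U"
  shows "open (x ` (U \<inter> V))"
proof -
  have V: "open V" "open (x ` V)" and h: "homeomorphism V (x ` V) x (inv_into V x)" using chart[OF assms(1)] by auto
  have "openin (top_of_set (x ` V)) (x ` (U \<inter> V))"
    by (rule homeomorphism_imp_open_map[OF h]) (use V assms in \<open>auto simp: openin_open_eq\<close>)
  then show ?thesis using V openin_open_eq by blast
qed

lemma chart_inj:
  assumes "(V, x) \<in> A"
  shows "inj_on x V"
proof -
  have "homeomorphism V (x ` V) x (inv_into V x)" using chart[OF assms] by blast
  then show ?thesis unfolding homeomorphism_def by (metis inj_on_inverseI)
qed

lemma ex_chart: "\<exists>V x. (V, x) \<in> A \<and> p \<in> V"
proof -
  have "p \<in> (\<Union>(U, x)\<in>A. U)" using charts_cover by simp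
  then show ?thesis by blast
qed

lemma smooth_fun_cong:
  assumes "open U" "\<And>q. q \<in> U \<Longrightarrow> f q = g q"
  shows "smooth_fun A U f \<longleftrightarrow> smooth_fun A U g"
proof -
  have "Ck_on k (x ` (U \<inter> V)) (f \<circ> inv_into V x) \<longleftrightarrow> Ck_on k (x ` (U \<inter> V)) (g \<circ> inv_into V x)"
    if "(V, x) \<in> A" for V x k
    by (rule Ck_on_cong[OF chart_image_open[OF that assms(1)]])
      (use chart_inj[OF that] assms(2) in auto)
  then show ?thesis unfolding smooth_fun_def smooth_on_def by (auto split: prod.splits)
qed

lemma smooth_fun_subset: "smooth_fun A U f \<Longrightarrow> W \<subseteq> U \<Longrightarrow> smooth_fun A W f"
  unfolding smooth_fun_def smooth_on_def
  using Ck_on_subset[OF _ image_mono[OF Int_mono[OF _ order_refl]]] by blast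

lemma smooth_fun_iff:
  "smooth_fun A U f \<longleftrightarrow> (\<forall>V x. (V, x) \<in> A \<longrightarrow> (\<forall>k. Ck_on k (x ` (U \<inter> V)) (\<lambda>z. f (inv_into V x z))))"
  unfolding smooth_fun_def smooth_on_def o_def by blast

lemma smooth_fun_const: "smooth_fun A U (\<lambda>q. c)"
  unfolding smooth_fun_iff using Ck_on_const by blast

lemma smooth_fun_linear: "bounded_linear L \<Longrightarrow> open U \<Longrightarrow> smooth_fun A U f \<Longrightarrow> smooth_fun A U (\<lambda>q. L (f q))"
  unfolding smooth_fun_iff using Ck_on_linear chart_image_open by blast

lemma smooth_fun_add: "open U \<Longrightarrow> smooth_fun A U f \<Longrightarrow> smooth_fun A U g \<Longrightarrow> smooth_fun A U (\<lambda>q. f q + g q)"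
  unfolding smooth_fun_iff using Ck_on_add chart_image_open by blast

lemma smooth_fun_mult:
  fixes f g :: "_ \<Rightarrow> real"
  shows "open U \<Longrightarrow> smooth_fun A U f \<Longrightarrow> smooth_fun A U g \<Longrightarrow> smooth_fun A U (\<lambda>q. f q * g q)"
  unfolding smooth_fun_iff using Ck_on_mult chart_image_open by blast

lemma smooth_near_cong:
  assumes "open U" "p \<in> U" "\<And>q. q \<in> U \<Longrightarrow> f q = g q"
  shows "smooth_near A p f \<longleftrightarrow> smooth_near A p g"
proof -
  have "smooth_near A p g" if "smooth_near A p f" "\<And>q. q \<in> U \<Longrightarrow> f q = g q" for f g
  proof -
    from that(1) obtain V where V: "open V" "p \<in> V" "smooth_fun A V f" unfolding smooth_near_def by auto
    then have "smooth_fun A (U \<inter> V) f" using smooth_fun_subset by blast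
    then have "smooth_fun A (U \<inter> V) g" using smooth_fun_cong[of "U \<inter> V" f g] that(2) V assms by auto
    then show ?thesis unfolding smooth_near_def using V assms by blast
  qed
  then show ?thesis using assms(3) by metis
qed

lemma smooth_fun_near: "smooth_fun A U f \<Longrightarrow> open U \<Longrightarrow> p \<in> U \<Longrightarrow> smooth_near A p f"
  unfolding smooth_near_def by blast

lemma smooth_near_common:
  assumes "smooth_near A p f" "smooth_near A p g"
  obtains U where "open U" "p \<in> U" "smooth_fun A U f" "smooth_fun A U g"
proof -
  from assms obtain V W where "open V" "p \<in> V" "smooth_fun A V f" "open W" "p \<in> W" "smooth_fun A W g"
    unfolding smooth_near_def by auto
  then show ?thesis using that[of "V \<inter> W"] smooth_fun_subset by blast
qed

lemma smooth_near_const: "smooth_near A p (\<lambda>q. c)"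
  using smooth_fun_const smooth_fun_near by blast

lemma smooth_near_add: "smooth_near A p f \<Longrightarrow> smooth_near A p g \<Longrightarrow> smooth_near A p (\<lambda>q. f q + g q)"
  by (erule (1) smooth_near_common) (blast intro: smooth_fun_near smooth_fun_add)

lemma smooth_near_mult: "smooth_near A p f \<Longrightarrow> smooth_near A p g \<Longrightarrow> smooth_near A p (\<lambda>q. f q * g q)"
  by (erule (1) smooth_near_common) (blast intro: smooth_fun_near smooth_fun_mult)

lemma smooth_near_sum: "(\<And>i. i \<in> I \<Longrightarrow> smooth_near A p (f i)) \<Longrightarrow> smooth_near A p (\<lambda>q. \<Sum>i\<in>I. f i q)"
  by (induction I rule: infinite_finite_induct) (auto intro: smooth_near_const smooth_near_add)

lemma smooth_near_cmult: "smooth_near A p f \<Longrightarrow> smooth_near A p (\<lambda>q. c * f q)"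
  by (intro smooth_near_mult smooth_near_const)

lemma smooth_near_differentiable:
  assumes "smooth_near A p f" "(V, x) \<in> A" "p \<in> V"
  shows "(f \<circ> inv_into V x) differentiable (at (x p))"
proof -
  from assms(1) obtain U where U: "open U" "p \<in> U" "smooth_fun A U f" unfolding smooth_near_def by auto
  then have "Ck_on (Suc 0) (x ` (U \<inter> V)) (f \<circ> inv_into V x)"
    using assms unfolding smooth_fun_def smooth_on_def by blast
  then show ?thesis using U assms by auto
qed

lemma frechet_chart_cong:
  assumes "open U" "p \<in> U" "\<And>q. q \<in> U \<Longrightarrow> f q = g q" "(V, x) \<in> A" "p \<in> V"
  shows "frechet_derivative (f \<circ> inv_into V x) (at (x p)) = frechet_derivative (g \<circ> inv_into V x) (at (x p))"
proof -
  have o: "open (x ` (U \<inter> V))" "x p \<in> x ` (U \<inter> V)" using chart_image_open assms by auto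
  have eq: "(f \<circ> inv_into V x) z = (g \<circ> inv_into V x) z" if "z \<in> x ` (U \<inter> V)" for z
    using that chart_inj[OF assms(4)] assms(3) by auto
  have "(F has_derivative L) (at (x p)) \<longleftrightarrow> (G has_derivative L) (at (x p))"
    if "F = f \<circ> inv_into V x" "G = g \<circ> inv_into V x" for F G L
    using has_derivative_transform_within_open[OF _ o] eq that by metis
  then show ?thesis unfolding frechet_derivative_def by simp
qed

section \<open>Tangent vectors as derivations in a chart\<close>

definition tvec :: "'m set \<Rightarrow> ('m \<Rightarrow> real^'n) \<Rightarrow> 'm \<Rightarrow> real^'n \<Rightarrow> 'm tangent" where
  "tvec V x p w = (\<lambda>f. if smooth_near A p f then frechet_derivative (f \<circ> inv_into V x) (at (x p)) w else 0)"

lemma tvec_linear: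
  assumes "(V, x) \<in> A" "p \<in> V"
  shows "tvec V x p (r *\<^sub>R w + w') = (\<lambda>f. r * tvec V x p w f + tvec V x p w' f)"
proof
  fix f
  show "tvec V x p (r *\<^sub>R w + w') f = r * tvec V x p w f + tvec V x p w' f"
  proof (cases "smooth_near A p f")
    case True
    then have "linear (frechet_derivative (f \<circ> inv_into V x) (at (x p)))"
      using linear_frechet_derivative smooth_near_differentiable assms by blast
    then show ?thesis unfolding tvec_def using True by (simp add: linear_add linear_scale)
  qed (simp add: tvec_def)
qed

text \<open>\<open>tangent_space\<close> unites the operators of all charts around \<open>p\<close>.
  By the chain rule a transition map carries the operators of one chart to those of another, so one
  fixed chart yields them all; linearity and the derivation rules are then read off there.\<close>

lemma tangent_space_chart:
  assumes "(V, x) \<in> A" "p \<in> V"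
  shows "tangent_space A p = range (tvec V x p)"
proof -
  have ch: "\<exists>w'. tvec U y p w = tvec V x p w'" if "(U, y) \<in> A" "p \<in> U" for U y w
  proof -
    let ?t = "x \<circ> inv_into U y"
    have "Ck_on (Suc 0) (y ` (U \<inter> V)) ?t"
      using transition_smooth[OF that(1) assms(1)] unfolding smooth_on_def by blast
    then have dt: "(?t has_derivative frechet_derivative ?t (at (y p))) (at (y p))"
      using that assms frechet_derivative_works by auto
    have yp: "inv_into U y (y p) = p" using chart_inj[OF that(1)] that by simp
    have "tvec U y p w f = tvec V x p (frechet_derivative ?t (at (y p)) w) f" for f
    proof (cases "smooth_near A p f")
      case True
      let ?F = "f \<circ> inv_into V x"
      have dF: "(?F has_derivative frechet_derivative ?F (at (x p))) (at (?t (y p)))"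
        using smooth_near_differentiable[OF True assms] frechet_derivative_works yp by auto
      have "(?F \<circ> ?t has_derivative frechet_derivative ?F (at (x p)) \<circ> frechet_derivative ?t (at (y p))) (at (y p))"
        by (rule diff_chain_at[OF dt dF])
      \<comment> \<open>\<open>inv_into V x (x q)\<close> equals \<open>q\<close> only on
        \<open>V\<close>, so the chain rule treats a function that agrees with \<open>f\<close> near
        \<open>p\<close> but perhaps not elsewhere; \<open>frechet_chart_cong\<close> bridges the
        gap.\<close>
      moreover have "((\<lambda>q. f (inv_into V x (x q))) \<circ> inv_into U y) = ?F \<circ> ?t"
        by (simp add: fun_eq_iff)
      moreover have "frechet_derivative ((\<lambda>q. f (inv_into V x (x q))) \<circ> inv_into U y) (at (y p))
          = frechet_derivative (f \<circ> inv_into U y) (at (y p))"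
        by (rule frechet_chart_cong[of V])
          (use chart_inj[OF assms(1)] assms that chart[OF assms(1)] in auto)
      ultimately have "frechet_derivative (f \<circ> inv_into U y) (at (y p)) w
          = frechet_derivative ?F (at (x p)) (frechet_derivative ?t (at (y p)) w)"
        using frechet_derivative_at by (metis comp_apply)
      then show ?thesis using True by (simp add: tvec_def)
    qed (simp add: tvec_def)
    then show ?thesis by blast
  qed
  have "v \<in> tangent_space A p \<longleftrightarrow> (\<exists>U y w. (U, y) \<in> A \<and> p \<in> U \<and> v = tvec U y p w)" for v
    unfolding tangent_space_def tvec_def by blast
  then have "v \<in> tangent_space A p \<longleftrightarrow> v \<in> range (tvec V x p)" for v
    using ch assms by (metis rangeE rangeI)
  then show ?thesis by blast
qed

lemma tangent_lincomb:
  assumes "u \<in> tangent_space A p" "v \<in> tangent_space A p"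
  shows "(\<lambda>f. r * u f + v f) \<in> tangent_space A p"
proof -
  obtain V x where c: "(V, x) \<in> A" "p \<in> V" using ex_chart by blast
  then obtain w w' where "u = tvec V x p w" "v = tvec V x p w'" using assms tangent_space_chart[OF c] by auto
  then have "(\<lambda>f. r * u f + v f) = tvec V x p (r *\<^sub>R w + w')" by (simp add: tvec_linear[OF c])
  then show ?thesis using tangent_space_chart[OF c] by auto
qed

lemma tangent_zero: "(\<lambda>f. 0) \<in> tangent_space A p"
proof -
  obtain V x where c: "(V, x) \<in> A" "p \<in> V" using ex_chart by blast
  \<comment> \<open>Linearity is stated as one law for \<open>r * u + v\<close>. With
    \<open>r = -1\<close> and zero vectors it reads z = - z + z. The same instance gives the zero
    laws of the metric, of tensorial functionals and of 3-forms.\<close>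
  have "(\<lambda>f. 0) = tvec V x p 0"
    using tvec_linear[OF c, of "-1" 0 0] by (simp add: fun_eq_iff)
  then show ?thesis using tangent_space_chart[OF c] by auto
qed

lemma tangent_sum:
  assumes "\<And>i. i \<in> I \<Longrightarrow> u i \<in> tangent_space A p"
  shows "(\<lambda>f. \<Sum>i\<in>I. r i * u i f) \<in> tangent_space A p"
  using assms
  by (induction I rule: infinite_finite_induct) (auto intro: tangent_zero tangent_lincomb)

lemma tangent_not_near: "v \<in> tangent_space A p \<Longrightarrow> \<not> smooth_near A p f \<Longrightarrow> v f = 0"
  unfolding tangent_space_def by auto

lemma tangent_cong:
  assumes "v \<in> tangent_space A p" "open U" "p \<in> U" "\<And>q. q \<in> U \<Longrightarrow> f q = g q"
  shows "v f = v g"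
proof -
  obtain V x where c: "(V, x) \<in> A" "p \<in> V" using ex_chart by blast
  then obtain w where "v = tvec V x p w" using assms tangent_space_chart[OF c] by auto
  then show ?thesis
    using frechet_chart_cong[OF assms(2-4) c] smooth_near_cong[OF assms(2-4)] by (simp add: tvec_def)
qed

lemma tangent_const:
  assumes "v \<in> tangent_space A p" shows "v (\<lambda>q. c) = 0"
proof -
  obtain V x where ch: "(V, x) \<in> A" "p \<in> V" using ex_chart by blast
  then obtain w where "v = tvec V x p w" using assms tangent_space_chart[OF ch] by auto
  then show ?thesis by (simp add: tvec_def o_def frechet_derivative_const)
qed

lemma tangent_add:
  assumes "v \<in> tangent_space A p" "smooth_near A p f" "smooth_near A p g"
  shows "v (\<lambda>q. f q + g q) = v f + v g"
proof -
  obtain V x where ch: "(V, x) \<in> A" "p \<in> V" using ex_chart by blast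
  then obtain w where w: "v = tvec V x p w" using assms tangent_space_chart[OF ch] by auto
  note d = smooth_near_differentiable[OF assms(2) ch] smooth_near_differentiable[OF assms(3) ch]
  have "((\<lambda>q. f q + g q) \<circ> inv_into V x has_derivative (\<lambda>h. frechet_derivative (f \<circ> inv_into V x) (at (x p)) h
      + frechet_derivative (g \<circ> inv_into V x) (at (x p)) h)) (at (x p))"
    using has_derivative_add[OF frechet_derivative_works[THEN iffD1, OF d(1)] frechet_derivative_works[THEN iffD1, OF d(2)]]
    by (simp add: o_def)
  from frechet_derivative_at[OF this, symmetric] show ?thesis using assms smooth_near_add
    by (simp add: w tvec_def)
qed

lemma tangent_mult:
  assumes "v \<in> tangent_space A p" "smooth_near A p f" "smooth_near A p g"
  shows "v (\<lambda>q. f q * g q) = v f * g p + f p * v g"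
proof -
  obtain V x where ch: "(V, x) \<in> A" "p \<in> V" using ex_chart by blast
  then obtain w where w: "v = tvec V x p w" using assms tangent_space_chart[OF ch] by auto
  note d = smooth_near_differentiable[OF assms(2) ch] smooth_near_differentiable[OF assms(3) ch]
  have "((\<lambda>q. f q * g q) \<circ> inv_into V x has_derivative (\<lambda>h. f p * frechet_derivative (g \<circ> inv_into V x) (at (x p)) h
      + frechet_derivative (f \<circ> inv_into V x) (at (x p)) h * g p)) (at (x p))"
    using has_derivative_mult[OF frechet_derivative_works[THEN iffD1, OF d(1)] frechet_derivative_works[THEN iffD1, OF d(2)]]
      chart_inj[OF ch(1)] ch(2)
    by (simp add: o_def)
  from frechet_derivative_at[OF this, symmetric] show ?thesis using assms smooth_near_mult
    by (simp add: w tvec_def)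
qed

lemma tangent_cmult:
  assumes "v \<in> tangent_space A p" "smooth_near A p f"
  shows "v (\<lambda>q. c * f q) = c * v f"
  using tangent_mult[OF assms(1) smooth_near_const assms(2)] tangent_const[OF assms(1)] by simp

lemma tangent_diff:
  assumes "v \<in> tangent_space A p" "smooth_near A p f" "smooth_near A p g"
  shows "v (\<lambda>q. f q - g q) = v f - v g"
  using tangent_add[OF assms(1,2) smooth_near_cmult[OF assms(3), of "-1"]] tangent_cmult[OF assms(1,3), of "-1"] by simp

lemma tangent_sum_fun:
  assumes "v \<in> tangent_space A p" "\<And>i. i \<in> I \<Longrightarrow> smooth_near A p (f i)"
  shows "v (\<lambda>q. \<Sum>i\<in>I. f i q) = (\<Sum>i\<in>I. v (f i))"
  using assms(2)
  by (induction I rule: infinite_finite_induct)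
    (auto simp: tangent_const[OF assms(1)] tangent_add[OF assms(1)] smooth_near_sum)

section \<open>Local vector fields\<close>

lemma vf_tangent: "X \<in> vector_fields A U \<Longrightarrow> p \<in> U \<Longrightarrow> X p \<in> tangent_space A p"
  unfolding vector_fields_def by blast

lemma vf_smooth:
  "X \<in> vector_fields A U \<Longrightarrow> open V \<Longrightarrow> V \<subseteq> U \<Longrightarrow> smooth_fun A V f \<Longrightarrow> smooth_fun A V (\<lambda>p. X p f)"
  unfolding vector_fields_def by blast

lemma vf_near:
  assumes "X \<in> vector_fields A U" "open U" "p \<in> U" "smooth_near A p f"
  shows "smooth_near A p (\<lambda>p. X p f)"
proof -
  obtain V where V: "open V" "p \<in> V" "smooth_fun A V f" using assms(4) unfolding smooth_near_def by auto
  have "smooth_fun A (U \<inter> V) (\<lambda>p. X p f)"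
    by (rule vf_smooth[OF assms(1)]) (use assms V smooth_fun_subset[OF V(3)] in auto)
  then show ?thesis by (rule smooth_fun_near) (use V assms in auto)
qed

lemma vf_subset: "X \<in> vector_fields A U \<Longrightarrow> W \<subseteq> U \<Longrightarrow> X \<in> vector_fields A W"
  unfolding vector_fields_def by (auto dest: subset_trans subsetD)

lemma vf_cong:
  assumes "X \<in> vector_fields A U" "\<And>q. q \<in> U \<Longrightarrow> X' q = X q"
  shows "X' \<in> vector_fields A U"
proof -
  have "smooth_fun A V (\<lambda>p. X' p f)" if "open V" "V \<subseteq> U" "smooth_fun A V f" for V f
  proof -
    have eq: "X' q f = X q f" if "q \<in> V" for q
      using assms(2) that \<open>V \<subseteq> U\<close> by auto
    show ?thesis
      using vf_smooth[OF assms(1) that] smooth_fun_cong[OF that(1), of "\<lambda>p. X' p f" "\<lambda>p. X p f"] eq by blast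
  qed
  then show ?thesis using assms unfolding vector_fields_def by auto
qed

lemma vf_lincomb:
  assumes "X \<in> vector_fields A U" "X' \<in> vector_fields A U" "smooth_fun A U h" "open U"
  shows "(\<lambda>q f. h q * X q f + X' q f) \<in> vector_fields A U"
proof -
  have "smooth_fun A V (\<lambda>p. h p * X p f + X' p f)" if "open V" "V \<subseteq> U" "smooth_fun A V f" for V f
    by (intro smooth_fun_add smooth_fun_mult smooth_fun_subset[OF assms(3)] vf_smooth[OF assms(1)]
      vf_smooth[OF assms(2)] that)
  then show ?thesis using tangent_lincomb[OF vf_tangent[OF assms(1)] vf_tangent[OF assms(2)]]
    unfolding vector_fields_def by simp
qed

lemma vf_zero: "(\<lambda>q f. 0) \<in> vector_fields A U"
  unfolding vector_fields_def using tangent_zero smooth_fun_const by auto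

lemma vf_diff:
  assumes "X \<in> vector_fields A U" "X' \<in> vector_fields A U" "open U"
  shows "(\<lambda>q f. X q f - X' q f) \<in> vector_fields A U"
  using vf_lincomb[OF assms(2,1) smooth_fun_const[of U "-1"] assms(3)] by simp

lemma vf_sum:
  assumes "\<And>i. i \<in> I \<Longrightarrow> X i \<in> vector_fields A U" "\<And>i. i \<in> I \<Longrightarrow> smooth_fun A U (h i)" "open U"
  shows "(\<lambda>q f. \<Sum>i\<in>I. h i q * X i q f) \<in> vector_fields A U"
  using assms(1,2)
  by (induction I rule: infinite_finite_induct) (auto intro: vf_zero vf_lincomb assms(3))

end

section \<open>Frames and the Levi-Civita curvature\<close>

context smooth_manifold
begin

lemma tvec_sum:
  assumes "(V, x) \<in> A" "p \<in> V"
  shows "tvec V x p (\<Sum>a\<in>I. c a *\<^sub>R w a) = (\<lambda>f. \<Sum>a\<in>I. c a * tvec V x p (w a) f)"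
proof (induction I rule: infinite_finite_induct)
  case (insert a I)
  then show ?case by (simp add: tvec_linear[OF assms])
qed (use tvec_linear[OF assms, of "-1" 0 0] in \<open>simp_all add: fun_eq_iff\<close>)

text \<open>One law combines additivity and linearity over smooth functions, the remaining arguments
  and \<open>p\<close> being frozen. Curvature, Hessian and 3-forms enter through it, so identities
  between them need checking on frame fields only.\<close>

definition tensorial :: "'m set \<Rightarrow> 'm \<Rightarrow> ('m vfield \<Rightarrow> real) \<Rightarrow> bool" where
  "tensorial W p F \<longleftrightarrow> (\<forall>X\<in>vector_fields A W. \<forall>X'\<in>vector_fields A W. \<forall>h. smooth_fun A W h \<longrightarrow>
     F (\<lambda>q f. h q * X q f + X' q f) = h p * F X + F X')"

lemma tensorialD:
  "tensorial W p F \<Longrightarrow> X \<in> vector_fields A W \<Longrightarrow> X' \<in> vector_fields A W \<Longrightarrow> smooth_fun A W h \<Longrightarrow>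
     F (\<lambda>q f. h q * X q f + X' q f) = h p * F X + F X'"
  unfolding tensorial_def by blast

text \<open>
  Two fields that agree on \<open>W\<close> differ by a multiple \<open>h Z\<close> with \<open>h = 0\<close> on \<open>W\<close>, and \<open>smooth_fun A W h\<close>
  does not constrain \<open>h\<close> outside \<open>W\<close>.
\<close>
lemma off_set_difference:
  fixes W :: "'m set" and X X' :: "'m vfield"
  defines "h \<equiv> \<lambda>q. if q \<in> W then 0 else 1 :: real"
  defines "Z \<equiv> \<lambda>q. if q \<in> W then X q else (\<lambda>f. X' q f - X q f)"
  assumes "open W" "X \<in> vector_fields A W" "\<And>q. q \<in> W \<Longrightarrow> X' q = X q"
  shows "X' = (\<lambda>q f. h q * Z q f + X q f)" "smooth_fun A W h" "Z \<in> vector_fields A W"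
proof -
  show "X' = (\<lambda>q f. h q * Z q f + X q f)"
    using assms(5) by (auto simp: fun_eq_iff h_def Z_def)
  show "smooth_fun A W h"
    using smooth_fun_cong[OF assms(3), of h "\<lambda>_. 0"] smooth_fun_const by (auto simp: h_def)
  show "Z \<in> vector_fields A W"
    by (rule vf_cong[OF assms(4)]) (simp add: Z_def)
qed

text \<open>Locality follows from linearity over functions: the coefficient of the difference of the
  two fields vanishes at \<open>p\<close>.\<close>

lemma tensorial_cong:
  assumes "tensorial W p F" "open W" "p \<in> W" "X \<in> vector_fields A W" "\<And>q. q \<in> W \<Longrightarrow> X' q = X q"
  shows "F X' = F X"
  using off_set_difference(1)[OF assms(2,4,5)]
    tensorialD[OF assms(1) off_set_difference(3)[OF assms(2,4,5)] assms(4) off_set_difference(2)[OF assms(2,4,5)]] assms(3)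
  by simp

lemma tensorial_zero:
  assumes "tensorial W p F"
  shows "F (\<lambda>q f. 0) = 0"
  using tensorialD[OF assms vf_zero vf_zero smooth_fun_const[of W "-1"]] by simp

lemma tensorial_sum:
  assumes "tensorial W p F" "open W" "\<And>i. i \<in> I \<Longrightarrow> X i \<in> vector_fields A W"
    "\<And>i. i \<in> I \<Longrightarrow> smooth_fun A W (h i)"
  shows "F (\<lambda>q f. \<Sum>i\<in>I. h i q * X i q f) = (\<Sum>i\<in>I. h i p * F (X i))"
  using assms(3,4)
proof (induction I rule: infinite_finite_induct)
  case (insert i I)
  then show ?case
    using tensorialD[OF assms(1) _ vf_sum[of I X W h, OF _ _ assms(2)], of "X i" "h i"] by simp
qed (simp_all add: tensorial_zero[OF assms(1)])

end

section \<open>Orthonormal frames\<close>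

context riemannian_manifold
begin

lemma metric_zero:
  assumes "u \<in> tangent_space A p"
  shows "g p (\<lambda>f. 0) u = 0"
  using metric_linear[OF tangent_zero tangent_zero assms, of "-1"] by simp

lemma metric_sum:
  assumes "\<And>i. i \<in> I \<Longrightarrow> u i \<in> tangent_space A p" "w \<in> tangent_space A p"
  shows "g p (\<lambda>f. \<Sum>i\<in>I. r i * u i f) w = (\<Sum>i\<in>I. r i * g p (u i) w)"
  using assms(1)
proof (induction I rule: infinite_finite_induct)
  case (insert i I)
  then show ?case
    using metric_linear[OF _ tangent_sum[of I u p r] assms(2), of "u i" "r i"] by simp
qed (simp_all add: metric_zero[OF assms(2)])

lemma metric_add:
  "u \<in> tangent_space A p \<Longrightarrow> v \<in> tangent_space A p \<Longrightarrow> w \<in> tangent_space A p \<Longrightarrow>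
    g p (\<lambda>f. u f + v f) w = g p u w + g p v w"
  using metric_linear[of u p v w 1] by simp

lemma metric_diff:
  "u \<in> tangent_space A p \<Longrightarrow> v \<in> tangent_space A p \<Longrightarrow> w \<in> tangent_space A p \<Longrightarrow>
    g p (\<lambda>f. u f - v f) w = g p u w - g p v w"
  using metric_linear[of v p u w "-1"] by simp

text \<open>A dimension count: pairing with \<open>e b\<close> recovers the coefficients of a linear
  combination, so the map \<open>L\<close> from coefficients to chart coordinates is injective,
  hence surjective.\<close>

lemma tangent_expand:
  fixes e :: "'n \<Rightarrow> 'm tangent"
  assumes e: "\<And>a. e a \<in> tangent_space A p" and on: "\<And>a b. g p (e a) (e b) = (if a = b then 1 else 0)"
    and v: "v \<in> tangent_space A p"
  shows "v = (\<lambda>f. \<Sum>a\<in>UNIV. g p v (e a) * e a f)"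
proof -
  obtain V x where c: "(V, x) \<in> A" "p \<in> V" using ex_chart by blast
  have "\<exists>w. e a = tvec V x p w" for a using e[of a] tangent_space_chart[OF c] by auto
  then obtain w where w: "\<And>a. e a = tvec V x p (w a)" by metis
  define L where "L = (\<lambda>c :: real^'n. \<Sum>a\<in>UNIV. (c $ a) *\<^sub>R w a)"
  have L: "tvec V x p (L c) = (\<lambda>f. \<Sum>a\<in>UNIV. c $ a * e a f)" for c
    unfolding L_def using tvec_sum[OF c, of "\<lambda>a. c $ a" w UNIV] by (simp add: w)
  have co: "g p (tvec V x p (L c)) (e b) = c $ b" for c b
    unfolding L using metric_sum[of UNIV e p "e b" "\<lambda>a. c $ a"] e by (simp add: on if_distrib cong: if_cong)
  have lin: "linear L"
    unfolding L_def by (rule linearI) (simp_all add: sum.distrib scaleR_add_left scaleR_sum_right)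
  have "inj L"
    by (rule injI) (metis co vec_eq_iff)
  then have "surj L" using linear_injective_imp_surjective[OF lin] by simp
  moreover obtain z where "v = tvec V x p z" using v tangent_space_chart[OF c] by auto
  ultimately obtain c where "v = tvec V x p (L c)" by (metis surjD)
  then show ?thesis using L co by simp
qed

lemma frame_tangent: "orthonormal_frame A g W e \<Longrightarrow> q \<in> W \<Longrightarrow> e a q \<in> tangent_space A q"
  unfolding orthonormal_frame_def using vf_tangent by blast

lemma frame_field: "orthonormal_frame A g W e \<Longrightarrow> e a \<in> vector_fields A W"
  unfolding orthonormal_frame_def by blast

lemma frame_on: "orthonormal_frame A g W e \<Longrightarrow> q \<in> W \<Longrightarrow> g q (e a q) (e b q) = (if a = b then 1 else 0)"
  unfolding orthonormal_frame_def by blast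

lemma frame_subset:
  "orthonormal_frame A g U e \<Longrightarrow> W \<subseteq> U \<Longrightarrow> orthonormal_frame A g W e"
  unfolding orthonormal_frame_def using vf_subset[of _ U W] by blast

lemma frame_expand:
  assumes "orthonormal_frame A g W e" "q \<in> W" "v \<in> tangent_space A q"
  shows "v = (\<lambda>f. \<Sum>a\<in>UNIV. g q v (e a q) * e a q f)"
  by (rule tangent_expand) (use assms frame_tangent frame_on in auto)

lemma metric_frame:
  assumes "orthonormal_frame A g W e" "q \<in> W" "u \<in> tangent_space A q" "v \<in> tangent_space A q"
  shows "g q u v = (\<Sum>a\<in>UNIV. g q u (e a q) * g q v (e a q))"
proof -
  have "g q u v = g q (\<lambda>f. \<Sum>a\<in>UNIV. g q u (e a q) * e a q f) v"
    using frame_expand[OF assms(1-3)] by simp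
  also have "\<dots> = (\<Sum>a\<in>UNIV. g q u (e a q) * g q (e a q) v)"
    by (rule metric_sum) (use assms frame_tangent in auto)
  finally show ?thesis using metric_sym[OF assms(4) frame_tangent[OF assms(1,2)]] by simp
qed

text \<open>The frame expansion of \<open>X\<close> holds at points of \<open>W\<close> only, so
  \<open>tensorial_cong\<close> must replace \<open>X\<close> by it before linearity
  applies.\<close>

lemma tensorial_expand:
  assumes "tensorial W p F" "open W" "p \<in> W" "orthonormal_frame A g W e" "X \<in> vector_fields A W"
  shows "F X = (\<Sum>a\<in>UNIV. g p (X p) (e a p) * F (e a))"
proof -
  have sm: "smooth_fun A W (\<lambda>q. g q (X q) (e a q))" for a
    by (rule metric_smooth[OF assms(2,5)]) (rule frame_field[OF assms(4)])
  have "F X = F (\<lambda>q f. \<Sum>a\<in>UNIV. g q (X q) (e a q) * e a q f)"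
    by (rule tensorial_cong[OF assms(1-3)])
      (use vf_sum[of UNIV e W] frame_field[OF assms(4)] sm assms frame_expand[OF assms(4) _ vf_tangent[OF assms(5)]] in auto)
  also have "\<dots> = (\<Sum>a\<in>UNIV. g p (X p) (e a p) * F (e a))"
    by (rule tensorial_sum[OF assms(1,2)]) (use frame_field[OF assms(4)] sm in auto)
  finally show ?thesis .
qed

end

section \<open>Locality of the connection, Lie brackets\<close>

context levi_civita_connection
begin

lemma nabla_tangent:
  "open W \<Longrightarrow> X \<in> vector_fields A W \<Longrightarrow> Y \<in> vector_fields A W \<Longrightarrow> p \<in> W \<Longrightarrow> nabla X Y p \<in> tangent_space A p"
  using vf_tangent nabla_field by blast

lemma nabla_tensorial_1:
  "open W \<Longrightarrow> Y \<in> vector_fields A W \<Longrightarrow> p \<in> W \<Longrightarrow> tensorial W p (\<lambda>X. nabla X Y p f)"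
  unfolding tensorial_def using nabla_tensorial[of W] by auto

text \<open>The differentiated slot is not linear over functions: Leibniz adds the derivative of the
  coefficient. That term vanishes because the coefficient is zero on the whole neighbourhood
  \<open>W\<close>, not merely at \<open>p\<close>.\<close>

lemma nabla_cong_2:
  assumes W: "open W" "p \<in> W" "X \<in> vector_fields A W" "Y \<in> vector_fields A W" "\<And>q. q \<in> W \<Longrightarrow> Y' q = Y q"
  shows "nabla X Y' p = nabla X Y p"
proof -
  note d = off_set_difference[OF W(1,4,5)]
  have "X p (\<lambda>q. if q \<in> W then 0 else 1 :: real) = X p (\<lambda>q. 0)"
    by (rule tangent_cong[OF vf_tangent[OF W(3,2)] W(1,2)]) simp
  also have "\<dots> = 0" by (rule tangent_const[OF vf_tangent[OF W(3,2)]])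
  finally show ?thesis
    using nabla_leibniz[OF W(1,3) d(3) W(4) d(2) W(2)] d(1) W(2) by simp
qed

lemma nabla_diff_2:
  assumes W: "open W" "p \<in> W" "X \<in> vector_fields A W" "Y \<in> vector_fields A W" "Z \<in> vector_fields A W"
  shows "nabla X (\<lambda>q f. Y q f - Z q f) p f = nabla X Y p f - nabla X Z p f"
  using fun_cong[OF nabla_leibniz[OF W(1,3) W(5,4) smooth_fun_const[of W "-1"] W(2)], of f]
    tangent_const[OF vf_tangent[OF W(3,2)]] by simp

lemma bracket_nabla:
  assumes W: "open W" "X \<in> vector_fields A W" "Y \<in> vector_fields A W" "p \<in> W"
  shows "lie_bracket A X Y p = (\<lambda>f. nabla X Y p f - nabla Y X p f)"
  using nabla_torsion_free[OF W] by simp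

text \<open>Torsion-freeness presents the bracket as a difference of covariant derivatives, which
  spares a computation with symmetric second derivatives in charts.\<close>

lemma bracket_field:
  assumes W: "open W" "X \<in> vector_fields A W" "Y \<in> vector_fields A W"
  shows "lie_bracket A X Y \<in> vector_fields A W"
  by (rule vf_cong[OF vf_diff[OF nabla_field[OF W] nabla_field[OF W(1,3,2)] W(1)]])
    (rule bracket_nabla[OF W])

lemma jacobi:
  assumes W: "open W" "X \<in> vector_fields A W" "Y \<in> vector_fields A W" "Z \<in> vector_fields A W" "p \<in> W"
  shows "lie_bracket A X (lie_bracket A Y Z) p f + lie_bracket A Y (lie_bracket A Z X) p f
    + lie_bracket A Z (lie_bracket A X Y) p f = 0"
proof (cases "smooth_near A p f")
  case True
  then obtain V where V: "open V" "p \<in> V" "smooth_fun A V f" unfolding smooth_near_def by auto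
  have *: "lie_bracket A X (lie_bracket A Y Z) p f
      = X p (\<lambda>q. Y q (\<lambda>r. Z r f)) - X p (\<lambda>q. Z q (\<lambda>r. Y r f)) - (Y p (\<lambda>q. Z q (\<lambda>r. X r f)) - Z p (\<lambda>q. Y q (\<lambda>r. X r f)))"
    if F: "X \<in> vector_fields A W" "Y \<in> vector_fields A W" "Z \<in> vector_fields A W" for X Y Z
  proof -
    have n: "smooth_near A p (\<lambda>r. X r f)" if "X \<in> vector_fields A W" for X
      using vf_near[OF that W(1,5) True] .
    have nn: "smooth_near A p (\<lambda>q. X q (\<lambda>r. Y r f))" if "X \<in> vector_fields A W" "Y \<in> vector_fields A W" for X Y
      using vf_near[OF that(1) W(1,5) n[OF that(2)]] .
    \<comment> \<open>Under the outer derivative the inner bracket is needed at all points near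
      \<open>p\<close>. Its case distinction is settled on \<open>V\<close>, where \<open>f\<close>
      is smooth, and \<open>tangent_cong\<close> ignores the rest.\<close>
    have "X p (\<lambda>q. lie_bracket A Y Z q f) = X p (\<lambda>q. Y q (\<lambda>r. Z r f) - Z q (\<lambda>r. Y r f))"
      by (rule tangent_cong[OF vf_tangent[OF F(1) W(5)] V(1,2)])
        (use smooth_fun_near[OF V(3,1)] in \<open>simp add: lie_bracket_def\<close>)
    also have "\<dots> = X p (\<lambda>q. Y q (\<lambda>r. Z r f)) - X p (\<lambda>q. Z q (\<lambda>r. Y r f))"
      by (rule tangent_diff[OF vf_tangent[OF F(1) W(5)]]) (intro nn F)+
    finally show ?thesis using True n[OF F(1)]
      by (simp add: lie_bracket_def)
  qed
  show ?thesis using *[OF W(2,3,4)] *[OF W(3,4,2)] *[OF W(4,2,3)] by simp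
qed (simp add: lie_bracket_def)

section \<open>Symmetries and tensoriality of the curvature\<close>

lemma curvature_tangent:
  assumes W: "open W" "X \<in> vector_fields A W" "Y \<in> vector_fields A W" "Z \<in> vector_fields A W" "p \<in> W"
  shows "curvature A nabla X Y Z p \<in> tangent_space A p"
  unfolding curvature_def
  by (rule vf_tangent[OF vf_diff[OF vf_diff]])
    (use W in \<open>auto intro: nabla_field bracket_field\<close>)

lemma curvature_antisym_1:
  assumes W: "open W" "X \<in> vector_fields A W" "Y \<in> vector_fields A W" "Z \<in> vector_fields A W" "p \<in> W"
  shows "curvature A nabla Y X Z p f = - curvature A nabla X Y Z p f"
proof -
  have eq: "lie_bracket A Y X = (\<lambda>q f. (-1) * lie_bracket A X Y q f + 0)"
    by (auto simp: lie_bracket_def fun_eq_iff)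
  have "nabla (lie_bracket A Y X) Z p f = - nabla (lie_bracket A X Y) Z p f"
    unfolding eq
    using tensorialD[OF nabla_tensorial_1[OF W(1,4,5)] bracket_field[OF W(1-3)] vf_zero smooth_fun_const[of W "-1"], of f]
      tensorial_zero[OF nabla_tensorial_1[OF W(1,4,5)], of f] by linarith
  then show ?thesis by (simp add: curvature_def)
qed

text \<open>Regrouping the cyclic sum by the outer derivative, torsion-freeness used twice turns
  each group into an iterated bracket, and the Jacobi identity remains.\<close>

lemma curvature_bianchi:
  assumes W: "open W" "X \<in> vector_fields A W" "Y \<in> vector_fields A W" "Z \<in> vector_fields A W" "p \<in> W"
  shows "curvature A nabla X Y Z p f + curvature A nabla Y Z X p f + curvature A nabla Z X Y p f = 0"
proof -
  have *: "nabla X (nabla Y Z) p f - nabla X (nabla Z Y) p f - nabla (lie_bracket A Y Z) X p f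
      = lie_bracket A X (lie_bracket A Y Z) p f"
    if F: "X \<in> vector_fields A W" "Y \<in> vector_fields A W" "Z \<in> vector_fields A W" for X Y Z
  proof -
    have "nabla X (nabla Y Z) p f - nabla X (nabla Z Y) p f = nabla X (\<lambda>q f. nabla Y Z q f - nabla Z Y q f) p f"
      using nabla_diff_2[OF W(1,5) F(1) nabla_field[OF W(1) F(2,3)] nabla_field[OF W(1) F(3,2)]] by simp
    also have "\<dots> = nabla X (lie_bracket A Y Z) p f"
      by (rule fun_cong[OF nabla_cong_2[OF W(1,5) F(1) bracket_field[OF W(1) F(2,3)]]])
        (simp add: bracket_nabla[OF W(1) F(2,3)])
    finally show ?thesis using bracket_nabla[OF W(1) F(1) bracket_field[OF W(1) F(2,3)] W(5)] by simp
  qed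
  show ?thesis
    using *[OF W(2,3,4)] *[OF W(3,4,2)] *[OF W(4,2,3)] jacobi[OF W, of f] unfolding curvature_def by simp
qed

text \<open>The derivative \<open>Y h\<close> arises twice, from Leibniz in the second term and from
  the bracket of \<open>h X + X'\<close> with \<open>Y\<close>; the two contributions
  cancel.\<close>

lemma curvature_tensorial_1:
  assumes W: "open W" "Y \<in> vector_fields A W" "Z \<in> vector_fields A W" "p \<in> W"
  shows "tensorial W p (\<lambda>X. curvature A nabla X Y Z p f)"
  unfolding tensorial_def
proof (intro ballI allI impI)
  fix X X' and h :: "'m \<Rightarrow> real"
  assume F: "X \<in> vector_fields A W" "X' \<in> vector_fields A W" "smooth_fun A W h"
  let ?X = "\<lambda>q f. h q * X q f + X' q f"
  have Yh: "smooth_fun A W (\<lambda>q. - Y q h)"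
    using smooth_fun_mult[OF W(1) smooth_fun_const[of W "-1"] vf_smooth[OF W(2,1) order_refl F(3)]] by simp
  have 1: "nabla ?X (nabla Y Z) p f = h p * nabla X (nabla Y Z) p f + nabla X' (nabla Y Z) p f"
    by (rule fun_cong[OF nabla_tensorial[OF W(1) F(1,2) nabla_field[OF W(1-3)] F(3) W(4)]])
  have "nabla Y (nabla ?X Z) p f = nabla Y (\<lambda>q f. h q * nabla X Z q f + nabla X' Z q f) p f"
    by (rule fun_cong[OF nabla_cong_2[OF W(1,4,2)]])
      (use W F in \<open>auto intro!: vf_lincomb nabla_field nabla_tensorial\<close>)
  also have "\<dots> = Y p h * nabla X Z p f + h p * nabla Y (nabla X Z) p f + nabla Y (nabla X' Z) p f"
    by (rule fun_cong[OF nabla_leibniz[OF W(1,2) nabla_field[OF W(1) F(1) W(3)] nabla_field[OF W(1) F(2) W(3)] F(3) W(4)]])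
  finally have 2: "nabla Y (nabla ?X Z) p f = \<dots>" .
  let ?B = "\<lambda>q f. h q * lie_bracket A X Y q f + (- Y q h * X q f + lie_bracket A X' Y q f)"
  have B': "(\<lambda>q f. - Y q h * X q f + lie_bracket A X' Y q f) \<in> vector_fields A W"
    by (intro vf_lincomb F W Yh bracket_field)
  have B: "?B \<in> vector_fields A W"
    by (rule vf_lincomb[OF bracket_field[OF W(1) F(1) W(2)] B' F(3) W(1)])
  \<comment> \<open>Equality of operators includes functions that are not smooth near
    \<open>q\<close>. There the brackets are 0 by definition and \<open>X q f\<close> is 0 because
    \<open>X q\<close> is a tangent vector.\<close>
  have "lie_bracket A ?X Y q f = ?B q f" if q: "q \<in> W" for q f
  proof (cases "smooth_near A q f")
    case True
    have hn: "smooth_near A q h" using smooth_fun_near[OF F(3) W(1) q] .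
    have n: "smooth_near A q (\<lambda>r. X r f)" if "X \<in> vector_fields A W" for X
      using vf_near[OF that W(1) q True] .
    have Yq: "Y q \<in> tangent_space A q" by (rule vf_tangent[OF W(2) q])
    have "Y q (\<lambda>r. h r * X r f + X' r f) = Y q (\<lambda>r. h r * X r f) + Y q (\<lambda>r. X' r f)"
      by (intro tangent_add[OF Yq] smooth_near_mult hn n F)
    also have "Y q (\<lambda>r. h r * X r f) = Y q h * X q f + h q * Y q (\<lambda>r. X r f)"
      by (intro tangent_mult[OF Yq] hn n F)
    finally show ?thesis using True by (simp add: lie_bracket_def algebra_simps)
  qed (use tangent_not_near[OF vf_tangent[OF F(1) q]] in \<open>simp add: lie_bracket_def\<close>)
  then have "nabla (lie_bracket A ?X Y) Z p f = nabla ?B Z p f"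
    by (intro tensorial_cong[OF nabla_tensorial_1[OF W(1,3,4), of f] W(1,4) B] ext)
  also have "\<dots> = h p * nabla (lie_bracket A X Y) Z p f + (- Y p h * nabla X Z p f + nabla (lie_bracket A X' Y) Z p f)"
    using fun_cong[OF nabla_tensorial[OF W(1) bracket_field[OF W(1) F(1) W(2)] B' W(3) F(3) W(4)], of f]
      fun_cong[OF nabla_tensorial[OF W(1) F(1) bracket_field[OF W(1) F(2) W(2)] W(3) Yh W(4)], of f] by linarith
  finally show "curvature A nabla ?X Y Z p f = h p * curvature A nabla X Y Z p f + curvature A nabla X' Y Z p f"
    unfolding curvature_def 1 2 by (simp add: algebra_simps)
qed

definition Rm :: "'m vfield \<Rightarrow> 'm vfield \<Rightarrow> 'm vfield \<Rightarrow> 'm vfield \<Rightarrow> 'm \<Rightarrow> real" where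
  "Rm X Y Z V p = g p (curvature A nabla X Y Z p) (V p)"

lemma Rm_antisym_1:
  assumes W: "open W" "X \<in> vector_fields A W" "Y \<in> vector_fields A W" "Z \<in> vector_fields A W"
    "V \<in> vector_fields A W" "p \<in> W"
  shows "Rm Y X Z V p = - Rm X Y Z V p"
proof -
  have "curvature A nabla Y X Z p = (\<lambda>f. (-1) * curvature A nabla X Y Z p f + 0)"
    using curvature_antisym_1[OF W(1-4,6)] by (simp add: fun_eq_iff)
  then show ?thesis
    using metric_linear[OF curvature_tangent[OF W(1-4,6)] tangent_zero vf_tangent[OF W(5,6)], of "-1"]
      metric_zero[OF vf_tangent[OF W(5,6)]] unfolding Rm_def by simp
qed

lemma Rm_bianchi:
  assumes W: "open W" "X \<in> vector_fields A W" "Y \<in> vector_fields A W" "Z \<in> vector_fields A W"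
    "V \<in> vector_fields A W" "p \<in> W"
  shows "Rm X Y Z V p + Rm Y Z X V p + Rm Z X Y V p = 0"
proof -
  note t = curvature_tangent[OF W(1,2,3,4,6)] curvature_tangent[OF W(1,3,4,2,6)] curvature_tangent[OF W(1,4,2,3,6)]
  note V = vf_tangent[OF W(5,6)]
  have s: "(\<lambda>f. curvature A nabla X Y Z p f + curvature A nabla Y Z X p f) \<in> tangent_space A p"
    using tangent_lincomb[OF t(1,2), of 1] by simp
  have "(\<lambda>f. curvature A nabla X Y Z p f + curvature A nabla Y Z X p f + curvature A nabla Z X Y p f) = (\<lambda>f. 0)"
    using curvature_bianchi[OF W(1-4,6)] by (simp add: fun_eq_iff)
  then show ?thesis
    using metric_add[OF s t(3) V] metric_add[OF t(1,2) V] metric_zero[OF V] unfolding Rm_def by simp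
qed

text \<open>Metric compatibility trades second covariant derivatives for derivatives of real
  functions, which in a frame are the connection symbols.\<close>

lemma Rm_eq:
  assumes W: "open W" "X \<in> vector_fields A W" "Y \<in> vector_fields A W" "Z \<in> vector_fields A W"
    "V \<in> vector_fields A W" "p \<in> W"
  shows "Rm X Y Z V p = X p (\<lambda>q. g q (nabla Y Z q) (V q)) - Y p (\<lambda>q. g q (nabla X Z q) (V q))
    + g p (nabla X Z p) (nabla Y V p) - g p (nabla Y Z p) (nabla X V p) - g p (nabla (lie_bracket A X Y) Z p) (V p)"
proof -
  have t: "nabla X (nabla Y Z) p \<in> tangent_space A p" "nabla Y (nabla X Z) p \<in> tangent_space A p"
    "nabla (lie_bracket A X Y) Z p \<in> tangent_space A p"
    by (rule nabla_tangent[OF W(1) _ _ W(6)]; intro nabla_field bracket_field W)+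
  note V = vf_tangent[OF W(5,6)]
  have "Rm X Y Z V p = g p (nabla X (nabla Y Z) p) (V p) - g p (nabla Y (nabla X Z) p) (V p)
      - g p (nabla (lie_bracket A X Y) Z p) (V p)"
    unfolding Rm_def curvature_def
    using metric_diff[OF _ t(3) V, of "\<lambda>f. nabla X (nabla Y Z) p f - nabla Y (nabla X Z) p f"] metric_diff[OF t(1,2) V]
      tangent_lincomb[OF t(2,1), of "-1"] by simp
  moreover have "X p (\<lambda>q. g q (nabla Y Z q) (V q)) = g p (nabla X (nabla Y Z) p) (V p) + g p (nabla Y Z p) (nabla X V p)"
    by (rule nabla_metric[OF W(1,2) nabla_field[OF W(1,3,4)] W(5,6)])
  moreover have "Y p (\<lambda>q. g q (nabla X Z q) (V q)) = g p (nabla Y (nabla X Z) p) (V p) + g p (nabla X Z p) (nabla Y V p)"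
    by (rule nabla_metric[OF W(1,3) nabla_field[OF W(1,2,4)] W(5,6)])
  ultimately show ?thesis by simp
qed

text \<open>Apply \<open>X Y - Y X - [X,Y] = 0\<close> to the function \<open>g(Z,V)\<close> and
  expand each derivative by metric compatibility.\<close>

lemma Rm_antisym_2:
  assumes W: "open W" "X \<in> vector_fields A W" "Y \<in> vector_fields A W" "Z \<in> vector_fields A W"
    "V \<in> vector_fields A W" "p \<in> W"
  shows "Rm X Y V Z p = - Rm X Y Z V p"
proof -
  let ?G = "\<lambda>q. g q (Z q) (V q)"
  have G: "smooth_fun A W ?G" by (rule metric_smooth[OF W(1,4,5)])
  have *: "X p (\<lambda>q. Y q ?G) = X p (\<lambda>q. g q (nabla Y Z q) (V q)) + X p (\<lambda>q. g q (nabla Y V q) (Z q))"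
    if F: "X \<in> vector_fields A W" "Y \<in> vector_fields A W" for X Y
  proof -
    have "Y q ?G = g q (nabla Y Z q) (V q) + g q (nabla Y V q) (Z q)" if q: "q \<in> W" for q
      using nabla_metric[OF W(1) F(2) W(4,5) q] metric_sym[OF vf_tangent[OF W(4) q] nabla_tangent[OF W(1) F(2) W(5) q]]
      by simp
    then have "X p (\<lambda>q. Y q ?G) = X p (\<lambda>q. g q (nabla Y Z q) (V q) + g q (nabla Y V q) (Z q))"
      by (intro tangent_cong[OF vf_tangent[OF F(1) W(6)] W(1,6)])
    also have "\<dots> = X p (\<lambda>q. g q (nabla Y Z q) (V q)) + X p (\<lambda>q. g q (nabla Y V q) (Z q))"
      by (intro tangent_add[OF vf_tangent[OF F(1) W(6)]] smooth_fun_near[OF _ W(1,6)] metric_smooth nabla_field W F)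
    finally show ?thesis .
  qed
  have "lie_bracket A X Y p ?G = X p (\<lambda>q. Y q ?G) - Y p (\<lambda>q. X q ?G)"
    using smooth_fun_near[OF G W(1,6)] by (simp add: lie_bracket_def)
  moreover have "lie_bracket A X Y p ?G
      = g p (nabla (lie_bracket A X Y) Z p) (V p) + g p (Z p) (nabla (lie_bracket A X Y) V p)"
    by (rule nabla_metric[OF W(1) bracket_field[OF W(1-3)] W(4-6)])
  moreover have "g p (Z p) (nabla (lie_bracket A X Y) V p) = g p (nabla (lie_bracket A X Y) V p) (Z p)"
    by (intro metric_sym vf_tangent[OF W(4,6)] nabla_tangent[OF W(1) _ W(5,6)] bracket_field W)
  moreover have "g p (nabla X Z p) (nabla Y V p) = g p (nabla Y V p) (nabla X Z p)"
    "g p (nabla Y Z p) (nabla X V p) = g p (nabla X V p) (nabla Y Z p)"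
    by (intro metric_sym nabla_tangent[OF W(1) _ _ W(6)] W)+
  ultimately show ?thesis
    using *[OF W(2,3)] *[OF W(3,2)] Rm_eq[OF W] Rm_eq[OF W(1-3) W(5,4,6)] by simp
qed

text \<open>The octahedron argument: four Bianchi identities, one for each field held in the last
  slot, are combined by the two antisymmetries so that all other terms cancel.\<close>

lemma Rm_pair_sym:
  assumes W: "open W" "X \<in> vector_fields A W" "Y \<in> vector_fields A W" "Z \<in> vector_fields A W"
    "V \<in> vector_fields A W" "p \<in> W"
  shows "Rm X Y Z V p = Rm Z V X Y p"
proof -
  have a1: "Rm b a c d p = - Rm a b c d p" and a2: "Rm a b d c p = - Rm a b c d p"
    and bi: "Rm a b c d p + Rm b c a d p + Rm c a b d p = 0"
    if "a \<in> vector_fields A W" "b \<in> vector_fields A W" "c \<in> vector_fields A W" "d \<in> vector_fields A W" for a b c d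
    using Rm_antisym_1[OF W(1) that W(6)] Rm_antisym_2[OF W(1) that W(6)] Rm_bianchi[OF W(1) that W(6)] by auto
  note z = W(2) and x = W(3) and y = W(4) and v = W(5)
  show ?thesis
    using bi[OF x y z v] bi[OF y z v x] bi[OF z v x y] bi[OF v x y z]
      a2[OF x y z v] a2[OF y z x v] a2[OF z v x y] a2[OF v x y z]
      a1[OF z x y v] a2[OF x z y v] a1[OF v y z x] a2[OF y v z x]
    by linarith
qed

lemma Rm_tensorial_1:
  assumes W: "open W" "Y \<in> vector_fields A W" "Z \<in> vector_fields A W" "V \<in> vector_fields A W" "p \<in> W"
  shows "tensorial W p (\<lambda>X. Rm X Y Z V p)"
  unfolding tensorial_def
proof (intro ballI allI impI)
  fix X X' and h :: "'m \<Rightarrow> real"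
  assume F: "X \<in> vector_fields A W" "X' \<in> vector_fields A W" "smooth_fun A W h"
  have "curvature A nabla (\<lambda>q f. h q * X q f + X' q f) Y Z p
      = (\<lambda>f. h p * curvature A nabla X Y Z p f + curvature A nabla X' Y Z p f)"
    using tensorialD[OF curvature_tensorial_1[OF W(1,2,3,5)] F] by (simp add: fun_eq_iff)
  then show "Rm (\<lambda>q f. h q * X q f + X' q f) Y Z V p = h p * Rm X Y Z V p + Rm X' Y Z V p"
    unfolding Rm_def using metric_linear curvature_tangent[OF W(1) _ W(2,3,5)] F vf_tangent[OF W(4,5)] by simp
qed

text \<open>The symmetries carry tensoriality from the first slot to the other three, so the Leibniz
  computation is done once.\<close>

lemma Rm_tensorial_2:
  assumes W: "open W" "Y \<in> vector_fields A W" "Z \<in> vector_fields A W" "V \<in> vector_fields A W" "p \<in> W"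
  shows "tensorial W p (\<lambda>X. Rm Y X Z V p)"
  unfolding tensorial_def
  using tensorialD[OF Rm_tensorial_1[OF W]] Rm_antisym_1[OF W(1) _ W(2-5)] vf_lincomb[OF _ _ _ W(1)] by simp

lemma Rm_tensorial_3:
  assumes W: "open W" "Y \<in> vector_fields A W" "Z \<in> vector_fields A W" "V \<in> vector_fields A W" "p \<in> W"
  shows "tensorial W p (\<lambda>X. Rm Y Z X V p)"
  unfolding tensorial_def
  using tensorialD[OF Rm_tensorial_1[OF W(1,4,2,3,5)]] Rm_pair_sym[OF W(1,2,3) _ W(4,5)] vf_lincomb[OF _ _ _ W(1)] by simp

lemma Rm_tensorial_4:
  assumes W: "open W" "Y \<in> vector_fields A W" "Z \<in> vector_fields A W" "V \<in> vector_fields A W" "p \<in> W"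
  shows "tensorial W p (\<lambda>X. Rm Y Z V X p)"
  unfolding tensorial_def
  using tensorialD[OF Rm_tensorial_3[OF W]] Rm_antisym_2[OF W(1-3) _ W(4,5)] vf_lincomb[OF _ _ _ W(1)] by simp

section \<open>The Hessian of a function\<close>

lemma hessian_sym:
  assumes W: "open W" "X \<in> vector_fields A W" "Y \<in> vector_fields A W" "p \<in> W" "smooth_fun A W \<phi>"
  shows "hessian nabla \<phi> X Y p = hessian nabla \<phi> Y X p"
  using fun_cong[OF bracket_nabla[OF W(1-4)], of \<phi>] smooth_fun_near[OF W(5,1,4)]
  unfolding hessian_def lie_bracket_def by simp

lemma hessian_tensorial_1:
  assumes W: "open W" "Y \<in> vector_fields A W" "p \<in> W" "smooth_fun A W \<phi>"
  shows "tensorial W p (\<lambda>X. hessian nabla \<phi> X Y p)"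
  unfolding tensorial_def hessian_def
  using tensorialD[OF nabla_tensorial_1[OF W(1-3)]] by (simp add: algebra_simps)

lemma hessian_tensorial_2:
  assumes W: "open W" "Y \<in> vector_fields A W" "p \<in> W" "smooth_fun A W \<phi>"
  shows "tensorial W p (\<lambda>X. hessian nabla \<phi> Y X p)"
  unfolding tensorial_def
  using tensorialD[OF hessian_tensorial_1[OF W]] hessian_sym[OF W(1,2) _ W(3,4)] vf_lincomb[OF _ _ _ W(1)] by simp

lemma ricci_Rm: "ricci A g nabla E X Y p = (\<Sum>a\<in>UNIV. Rm (E a) X Y (E a) p)"
  unfolding ricci_def Rm_def ..

end

section \<open>Clifford algebra\<close>

text \<open>Real linearity and the anticommutators suffice for the algebra, since all coefficients
  are real; matrices and the complex structure stay outside.\<close>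

locale clifford_action =
  fixes c :: "'n::finite \<Rightarrow> 'v::real_vector \<Rightarrow> 'v"
  assumes lin: "linear (c a)"
    and rel: "c a (c b s) + c b (c a s) = (if a = b then -2 else 0) *\<^sub>R s"
begin

lemma c_add: "c a (s + t) = c a s + c a t"
  and c_diff: "c a (s - t) = c a s - c a t"
  and c_minus: "c a (- s) = - c a s"
  and c_scale: "c a (r *\<^sub>R s) = r *\<^sub>R c a s"
  and c_sum: "c a (\<Sum>i\<in>I. f i) = (\<Sum>i\<in>I. c a (f i))"
  and c_zero: "c a 0 = 0"
  using lin[of a] by (simp_all add: linear_add linear_diff linear_neg linear_scale linear_sum linear_0)

definition C1 :: "('n \<Rightarrow> real) \<Rightarrow> 'v \<Rightarrow> 'v" where
  "C1 u s = (\<Sum>a\<in>UNIV. u a *\<^sub>R c a s)"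

text \<open>Summing over all indices, here and in \<open>C3\<close>, counts a 2-form twice and a
  3-form six times. In return it makes sense for coefficients that are not alternating, such as the
  curvature with one slot fixed.\<close>

definition C2 :: "('n \<Rightarrow> 'n \<Rightarrow> real) \<Rightarrow> 'v \<Rightarrow> 'v" where
  "C2 w s = (\<Sum>a\<in>UNIV. \<Sum>b\<in>UNIV. w a b *\<^sub>R c a (c b s))"

definition C3 :: "('n \<Rightarrow> 'n \<Rightarrow> 'n \<Rightarrow> real) \<Rightarrow> 'v \<Rightarrow> 'v" where
  "C3 t s = (\<Sum>a\<in>UNIV. \<Sum>b\<in>UNIV. \<Sum>d\<in>UNIV. t a b d *\<^sub>R c a (c b (c d s)))"

lemma C1_add: "C1 (\<lambda>a. u a + v a) s = C1 u s + C1 v s"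
  by (simp add: C1_def scaleR_add_left sum.distrib)

lemma C1_scale: "C1 (\<lambda>a. r * u a) s = r *\<^sub>R C1 u s"
  by (simp add: C1_def scaleR_sum_right)

lemma C2_add: "C2 (\<lambda>a b. u a b + v a b) s = C2 u s + C2 v s"
  by (simp add: C2_def scaleR_add_left sum.distrib)

lemma C2_scale: "C2 (\<lambda>a b. r * u a b) s = r *\<^sub>R C2 u s"
  by (simp add: C2_def scaleR_sum_right)

lemma C2_sum: "C2 (\<lambda>a b. \<Sum>i\<in>I. u i a b) s = (\<Sum>i\<in>I. C2 (u i) s)"
proof (induction I rule: infinite_finite_induct)
  case (insert i I)
  then show ?case by (simp add: C2_add)
qed (simp_all add: C2_def)

lemma C3_add: "C3 (\<lambda>a b d. u a b d + v a b d) s = C3 u s + C3 v s"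
  by (simp add: C3_def scaleR_add_left sum.distrib)

lemma C3_scale: "C3 (\<lambda>a b d. r * u a b d) s = r *\<^sub>R C3 u s"
  by (simp add: C3_def scaleR_sum_right)

lemma C2_linear: "linear (C2 w)"
  by (rule linearI) (simp_all add: C2_def c_add c_scale scaleR_add_right sum.distrib scaleR_sum_right mult.commute)

lemma C1_linear: "linear (C1 u)"
  by (rule linearI) (simp_all add: C1_def c_add c_scale scaleR_add_right sum.distrib scaleR_sum_right mult.commute)

lemma C3_linear: "linear (C3 t)"
  by (rule linearI) (simp_all add: C3_def c_add c_scale scaleR_add_right sum.distrib scaleR_sum_right mult.commute)

section \<open>Commutators and cyclic rotation of Clifford products\<close>

lemma c_anticommute: "a \<noteq> b \<Longrightarrow> c a (c b s) = - c b (c a s)"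
  using rel[of a b s] by (simp add: eq_neg_iff_add_eq_0)

lemma triple_swap:
  "c a (c b (c d s)) = c d (c a (c b s)) - (if b = d then 2 else 0) *\<^sub>R c a s + (if a = d then 2 else 0) *\<^sub>R c b s"
proof -
  have "c b (c d s) = (if b = d then -2 else 0) *\<^sub>R s - c d (c b s)"
    using rel[of b d s] by (simp add: algebra_simps)
  moreover have "c a (c d (c b s)) = (if a = d then -2 else 0) *\<^sub>R c b s - c d (c a (c b s))"
    using rel[of a d "c b s"] by (simp add: algebra_simps)
  ultimately show ?thesis by (auto simp: c_diff c_scale c_minus)
qed

text \<open>A bivector acts on vectors as an infinitesimal rotation. The 4 is the 2 of the
  anticommutator, doubled because by antisymmetry of \<open>w\<close> both contractions
  agree.\<close>

lemma C2_commute: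
  assumes w: "\<And>a b. w b a = - w a b"
  shows "C2 w (c d s) = c d (C2 w s) + 4 *\<^sub>R C1 (w d) s"
proof -
  have "C2 w (c d s) = (\<Sum>a\<in>UNIV. \<Sum>b\<in>UNIV. w a b *\<^sub>R c d (c a (c b s))
      - (w a b * (if b = d then 2 else 0)) *\<^sub>R c a s + (w a b * (if a = d then 2 else 0)) *\<^sub>R c b s)"
    unfolding C2_def triple_swap[of _ _ d] by (simp add: scaleR_add_right scaleR_diff_right)
  also have "\<dots> = c d (C2 w s) - (\<Sum>a\<in>UNIV. (2 * w a d) *\<^sub>R c a s) + (\<Sum>b\<in>UNIV. (2 * w d b) *\<^sub>R c b s)"
  proof -
    have "(\<Sum>a\<in>UNIV. \<Sum>b\<in>UNIV. (w a b * (if b = d then 2 else 0)) *\<^sub>R c a s) = (\<Sum>a\<in>UNIV. (2 * w a d) *\<^sub>R c a s)"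
      by (simp add: if_distrib[of "\<lambda>x. (_ * x) *\<^sub>R _"] mult.commute cong: if_cong)
    moreover have "(\<Sum>a\<in>UNIV. \<Sum>b\<in>UNIV. (w a b * (if a = d then 2 else 0)) *\<^sub>R c b s) = (\<Sum>b\<in>UNIV. (2 * w d b) *\<^sub>R c b s)"
      by (subst sum.swap) (simp add: if_distrib[of "\<lambda>x. (_ * x) *\<^sub>R _"] mult.commute cong: if_cong)
    ultimately show ?thesis
      by (simp add: sum.distrib sum_subtractf C2_def c_sum c_scale)
  qed
  also have "\<dots> = c d (C2 w s) + 4 *\<^sub>R C1 (w d) s"
    by (simp add: w[of _ d] C1_def scaleR_sum_right sum_negf flip: sum.distrib scaleR_add_left)
  finally show ?thesis .
qed

text \<open>\<open>C2 u\<close> acts as a derivation on Clifford products. The result says that -1/4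
  times \<open>C2\<close> is a homomorphism from antisymmetric matrices under the commutator: the
  infinitesimal spin representation.\<close>

lemma C2_bracket:
  assumes u: "\<And>a b. u b a = - u a b" and w: "\<And>a b. w b a = - w a b"
  shows "C2 u (C2 w s) - C2 w (C2 u s) = 4 *\<^sub>R C2 (\<lambda>a b. \<Sum>f\<in>UNIV. w a f * u f b - u a f * w f b) s"
proof -
  have "C2 u (c a (c b s)) = c a (c b (C2 u s)) + 4 *\<^sub>R (\<Sum>f\<in>UNIV. u b f *\<^sub>R c a (c f s))
      + 4 *\<^sub>R (\<Sum>f\<in>UNIV. u a f *\<^sub>R c f (c b s))" for a b
    by (simp add: C2_commute[OF u] c_add c_scale C1_def c_sum)
  then have "C2 u (C2 w s) = (\<Sum>a\<in>UNIV. \<Sum>b\<in>UNIV. w a b *\<^sub>R (c a (c b (C2 u s)) + 4 *\<^sub>R (\<Sum>f\<in>UNIV. u b f *\<^sub>R c a (c f s))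
      + 4 *\<^sub>R (\<Sum>f\<in>UNIV. u a f *\<^sub>R c f (c b s))))"
    by (simp add: C2_def[of w s] linear_sum[OF C2_linear] linear_scale[OF C2_linear])
  also have "\<dots> = C2 w (C2 u s) + (\<Sum>a\<in>UNIV. \<Sum>b\<in>UNIV. \<Sum>f\<in>UNIV. (4 * w a b * u b f) *\<^sub>R c a (c f s))
      + (\<Sum>a\<in>UNIV. \<Sum>b\<in>UNIV. \<Sum>f\<in>UNIV. (4 * w a b * u a f) *\<^sub>R c f (c b s))"
    by (simp add: C2_def[of w "C2 u s"] scaleR_add_right sum.distrib scaleR_sum_right ac_simps)
  \<comment> \<open>Both remaining sums are reindexed so that \<open>c a (c b s)\<close> is the
    common factor and \<open>f\<close> the contracted index.\<close>
  also have "(\<Sum>a\<in>UNIV. \<Sum>b\<in>UNIV. \<Sum>f\<in>UNIV. (4 * w a b * u b f) *\<^sub>R c a (c f s))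
      = (\<Sum>a\<in>UNIV. \<Sum>b\<in>UNIV. \<Sum>f\<in>UNIV. (4 * w a f * u f b) *\<^sub>R c a (c b s))"
    by (rule sum.cong[OF refl], rule sum.swap)
  also have "(\<Sum>a\<in>UNIV. \<Sum>b\<in>UNIV. \<Sum>f\<in>UNIV. (4 * w a b * u a f) *\<^sub>R c f (c b s))
      = (\<Sum>a\<in>UNIV. \<Sum>f\<in>UNIV. \<Sum>b\<in>UNIV. (4 * w a b * u a f) *\<^sub>R c f (c b s))"
    by (rule sum.cong[OF refl], rule sum.swap)
  also have "\<dots> = (\<Sum>a\<in>UNIV. \<Sum>f\<in>UNIV. \<Sum>b\<in>UNIV. (4 * w f b * u f a) *\<^sub>R c a (c b s))"
    by (rule sum.swap)
  also have "\<dots> = (\<Sum>a\<in>UNIV. \<Sum>b\<in>UNIV. \<Sum>f\<in>UNIV. (4 * w f b * u f a) *\<^sub>R c a (c b s))"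
    by (rule sum.cong[OF refl], rule sum.swap)
  finally have "C2 u (C2 w s) - C2 w (C2 u s)
      = (\<Sum>a\<in>UNIV. \<Sum>b\<in>UNIV. \<Sum>f\<in>UNIV. (4 * w a f * u f b + 4 * w f b * u f a) *\<^sub>R c a (c b s))"
    by (simp add: sum.distrib scaleR_add_left)
  also have "\<dots> = (\<Sum>a\<in>UNIV. \<Sum>b\<in>UNIV. (4 * (\<Sum>f\<in>UNIV. w a f * u f b - u a f * w f b)) *\<^sub>R c a (c b s))"
  proof -
    have "4 * w a f * u f b + 4 * w f b * u f a = 4 * (w a f * u f b - u a f * w f b)" for a b f
      by (simp add: u[of f a] algebra_simps)
    then show ?thesis by (simp only: sum_distrib_left scaleR_sum_left)
  qed
  finally show ?thesis by (simp add: C2_def scaleR_sum_right)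
qed

text \<open>The cyclic sum of such a \<open>t\<close> is alternating. Rotating the three Clifford
  factors gives back \<open>C3 t\<close> up to contractions, 4 traces for one rotation and 2 for the
  other; this splits off the trace of a curvature tensor.\<close>

lemma C3_trace:
  assumes t: "\<And>a b d. t a d b = - t a b d"
  shows "3 *\<^sub>R C3 t s = C3 (\<lambda>a b d. t a b d + t b d a + t d a b) s - 6 *\<^sub>R C1 (\<lambda>b. \<Sum>a\<in>UNIV. t a a b) s"
proof -
  let ?T = "\<Sum>b\<in>UNIV. \<Sum>a\<in>UNIV. t a a b *\<^sub>R c b s"
  have tt: "t d a d = - t d d a" for a d using t .
  have T: "C1 (\<lambda>b. \<Sum>a\<in>UNIV. t a a b) s = ?T" unfolding C1_def scaleR_sum_left ..
  \<comment> \<open>The factor with the first index of \<open>t\<close> moves from the last place to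
    the front. Both contractions are traces, and antisymmetry makes them add up.\<close>
  have 1: "C3 (\<lambda>a b d. t d a b) s = C3 t s + 4 *\<^sub>R ?T"
  proof -
    have "C3 (\<lambda>a b d. t d a b) s = (\<Sum>a\<in>UNIV. \<Sum>d\<in>UNIV. \<Sum>b\<in>UNIV. t d a b *\<^sub>R c a (c b (c d s)))"
      unfolding C3_def by (rule sum.cong[OF refl], rule sum.swap)
    also have "\<dots> = (\<Sum>d\<in>UNIV. \<Sum>a\<in>UNIV. \<Sum>b\<in>UNIV. t d a b *\<^sub>R c a (c b (c d s)))"
      by (rule sum.swap)
    also have "\<dots> = (\<Sum>d\<in>UNIV. \<Sum>a\<in>UNIV. \<Sum>b\<in>UNIV. t d a b *\<^sub>R c d (c a (c b s))
        - (t d a b * (if b = d then 2 else 0)) *\<^sub>R c a s + (t d a b * (if a = d then 2 else 0)) *\<^sub>R c b s)"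
      by (intro sum.cong refl, subst triple_swap, simp add: scaleR_add_right scaleR_diff_right)
    also have "\<dots> = C3 t s - (\<Sum>d\<in>UNIV. \<Sum>a\<in>UNIV. (2 * t d a d) *\<^sub>R c a s) + (\<Sum>d\<in>UNIV. \<Sum>b\<in>UNIV. (2 * t d d b) *\<^sub>R c b s)"
    proof -
      have "(\<Sum>d\<in>UNIV. \<Sum>a\<in>UNIV. \<Sum>b\<in>UNIV. (t d a b * (if b = d then 2 else 0)) *\<^sub>R c a s)
          = (\<Sum>d\<in>UNIV. \<Sum>a\<in>UNIV. (2 * t d a d) *\<^sub>R c a s)"
        by (simp add: if_distrib[of "\<lambda>x. (_ * x) *\<^sub>R _"] mult.commute cong: if_cong)
      moreover have "(\<Sum>d\<in>UNIV. \<Sum>a\<in>UNIV. \<Sum>b\<in>UNIV. (t d a b * (if a = d then 2 else 0)) *\<^sub>R c b s)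
          = (\<Sum>d\<in>UNIV. \<Sum>b\<in>UNIV. (2 * t d d b) *\<^sub>R c b s)"
        by (rule sum.cong[OF refl], subst sum.swap)
          (simp add: if_distrib[of "\<lambda>x. (_ * x) *\<^sub>R _"] mult.commute cong: if_cong)
      ultimately show ?thesis by (simp add: sum.distrib sum_subtractf C3_def)
    qed
    also have "\<dots> = C3 t s + (\<Sum>d\<in>UNIV. \<Sum>b\<in>UNIV. (4 * t d d b) *\<^sub>R c b s)"
      by (simp add: tt sum_negf flip: sum.distrib scaleR_add_left)
    also have "(\<Sum>d\<in>UNIV. \<Sum>b\<in>UNIV. (4 * t d d b) *\<^sub>R c b s) = 4 *\<^sub>R ?T"
      by (subst sum.swap) (simp add: scaleR_sum_right)
    finally show ?thesis .
  qed
  \<comment> \<open>Here the front factor, with the last index of \<open>t\<close>, moves to the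
    end. Passing the middle index contracts an antisymmetric pair and gives 0, so a single
    contraction survives.\<close>
  have 2: "C3 (\<lambda>a b d. t b d a) s = C3 t s + 2 *\<^sub>R ?T"
  proof -
    have "C3 (\<lambda>a b d. t b d a) s = (\<Sum>a\<in>UNIV. \<Sum>b\<in>UNIV. \<Sum>d\<in>UNIV. t b d a *\<^sub>R c b (c d (c a s))
        + (t b d a * (if d = a then 2 else 0)) *\<^sub>R c b s - (t b d a * (if b = a then 2 else 0)) *\<^sub>R c d s)"
    proof -
      have "c a (c b (c d s)) = c b (c d (c a s)) + (if d = a then 2 else 0) *\<^sub>R c b s - (if b = a then 2 else 0) *\<^sub>R c d s"
        for a b d by (simp add: triple_swap[of b d a s])
      then show ?thesis
        unfolding C3_def by (intro sum.cong refl) (metis scaleR_add_right scaleR_diff_right scaleR_scaleR)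
    qed
    also have "\<dots> = (\<Sum>a\<in>UNIV. \<Sum>b\<in>UNIV. \<Sum>d\<in>UNIV. t b d a *\<^sub>R c b (c d (c a s)))
       - (\<Sum>a\<in>UNIV. \<Sum>d\<in>UNIV. (2 * t a d a) *\<^sub>R c d s)"
    proof -
      have "t b d d = 0" for b d using t[of b d d] by simp
      then have "(\<Sum>a\<in>UNIV. \<Sum>b\<in>UNIV. \<Sum>d\<in>UNIV. (t b d a * (if d = a then 2 else 0)) *\<^sub>R c b s) = 0"
        by (simp add: if_distrib[of "\<lambda>x. (_ * x) *\<^sub>R _"] mult.commute cong: if_cong)
      moreover have "(\<Sum>a\<in>UNIV. \<Sum>b\<in>UNIV. \<Sum>d\<in>UNIV. (t b d a * (if b = a then 2 else 0)) *\<^sub>R c d s)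
          = (\<Sum>a\<in>UNIV. \<Sum>d\<in>UNIV. (2 * t a d a) *\<^sub>R c d s)"
        by (rule sum.cong[OF refl], subst sum.swap)
          (simp add: if_distrib[of "\<lambda>x. (_ * x) *\<^sub>R _"] mult.commute cong: if_cong)
      ultimately show ?thesis by (simp add: sum.distrib sum_subtractf)
    qed
    also have "(\<Sum>a\<in>UNIV. \<Sum>b\<in>UNIV. \<Sum>d\<in>UNIV. t b d a *\<^sub>R c b (c d (c a s)))
        = (\<Sum>b\<in>UNIV. \<Sum>a\<in>UNIV. \<Sum>d\<in>UNIV. t b d a *\<^sub>R c b (c d (c a s)))"
      by (rule sum.swap)
    also have "\<dots> = C3 t s" unfolding C3_def by (rule sum.cong[OF refl], rule sum.swap)
    also have "(\<Sum>a\<in>UNIV. \<Sum>d\<in>UNIV. (2 * t a d a) *\<^sub>R c d s) = - (2 *\<^sub>R ?T)"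
      by (subst sum.swap) (simp add: tt scaleR_sum_right sum_negf)
    finally show ?thesis by simp
  qed
  have "C3 (\<lambda>a b d. t a b d + t b d a + t d a b) s = 3 *\<^sub>R C3 t s + 6 *\<^sub>R ?T"
  proof -
    have "3 *\<^sub>R C3 t s = C3 t s + C3 t s + C3 t s"
      using scaleR_add_left[of 1 2 "C3 t s"] by (simp add: scaleR_2)
    moreover have "6 *\<^sub>R ?T = 2 *\<^sub>R ?T + 4 *\<^sub>R ?T" by (simp flip: scaleR_add_left)
    ultimately show ?thesis unfolding C3_add 1 2 by simp
  qed
  then show ?thesis unfolding T by simp
qed

lemma C1_C2_commute:
  assumes w: "\<And>a b. w b a = - w a b"
  shows "C1 u (C2 w s) = C2 w (C1 u s) - 4 *\<^sub>R C1 (\<lambda>a. \<Sum>f\<in>UNIV. u f * w f a) s"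
proof -
  have "C2 w (C1 u s) = (\<Sum>a\<in>UNIV. u a *\<^sub>R (c a (C2 w s) + 4 *\<^sub>R C1 (w a) s))"
    by (simp add: C1_def[of u] linear_sum[OF C2_linear] linear_scale[OF C2_linear] C2_commute[OF w])
  also have "\<dots> = C1 u (C2 w s) + 4 *\<^sub>R (\<Sum>a\<in>UNIV. \<Sum>b\<in>UNIV. (u a * w a b) *\<^sub>R c b s)"
    by (simp add: C1_def scaleR_add_right sum.distrib scaleR_sum_right ac_simps)
  also have "(\<Sum>a\<in>UNIV. \<Sum>b\<in>UNIV. (u a * w a b) *\<^sub>R c b s) = C1 (\<lambda>a. \<Sum>f\<in>UNIV. u f * w f a) s"
    by (subst sum.swap) (simp add: C1_def scaleR_sum_left)
  finally show ?thesis by simp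
qed

text \<open>\<open>C2 w\<close> rotates one Clifford factor at a time, by \<open>C2_commute\<close>.
  The three sums are the connection terms of the covariant derivative of a 3-form with connection
  form \<open>w\<close>.\<close>

lemma C3_C2_commute:
  assumes w: "\<And>a b. w b a = - w a b"
  shows "C3 t (C2 w s) = C2 w (C3 t s)
    - 4 *\<^sub>R C3 (\<lambda>a b d. \<Sum>f\<in>UNIV. t f b d * w f a + t a f d * w f b + t a b f * w f d) s"
proof -
  have "C2 w (C3 t s) = (\<Sum>a\<in>UNIV. \<Sum>b\<in>UNIV. \<Sum>d\<in>UNIV. t a b d *\<^sub>R C2 w (c a (c b (c d s))))"
    by (simp add: C3_def linear_sum[OF C2_linear] linear_scale[OF C2_linear])
  also have "\<dots> = C3 t (C2 w s) + 4 *\<^sub>R ((\<Sum>a\<in>UNIV. \<Sum>b\<in>UNIV. \<Sum>d\<in>UNIV. \<Sum>f\<in>UNIV. (t a b d * w d f) *\<^sub>R c a (c b (c f s)))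
     + (\<Sum>a\<in>UNIV. \<Sum>b\<in>UNIV. \<Sum>d\<in>UNIV. \<Sum>f\<in>UNIV. (t a b d * w b f) *\<^sub>R c a (c f (c d s)))
     + (\<Sum>a\<in>UNIV. \<Sum>b\<in>UNIV. \<Sum>d\<in>UNIV. \<Sum>f\<in>UNIV. (t a b d * w a f) *\<^sub>R c f (c b (c d s))))"
    by (simp add: C2_commute[OF w] C1_def c_add c_scale c_sum C3_def scaleR_add_right sum.distrib scaleR_sum_right ac_simps)
  also have "(\<Sum>a\<in>UNIV. \<Sum>b\<in>UNIV. \<Sum>d\<in>UNIV. \<Sum>f\<in>UNIV. (t a b d * w d f) *\<^sub>R c a (c b (c f s)))
      = C3 (\<lambda>a b d. \<Sum>f\<in>UNIV. t a b f * w f d) s"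
    unfolding C3_def scaleR_sum_left by (rule sum.cong[OF refl], rule sum.cong[OF refl], rule sum.swap)
  also have "(\<Sum>a\<in>UNIV. \<Sum>b\<in>UNIV. \<Sum>d\<in>UNIV. \<Sum>f\<in>UNIV. (t a b d * w b f) *\<^sub>R c a (c f (c d s)))
      = (\<Sum>a\<in>UNIV. \<Sum>b\<in>UNIV. \<Sum>f\<in>UNIV. \<Sum>d\<in>UNIV. (t a b d * w b f) *\<^sub>R c a (c f (c d s)))"
    by (rule sum.cong[OF refl], rule sum.cong[OF refl], rule sum.swap)
  also have "\<dots> = (\<Sum>a\<in>UNIV. \<Sum>b\<in>UNIV. \<Sum>f\<in>UNIV. \<Sum>d\<in>UNIV. (t a f d * w f b) *\<^sub>R c a (c b (c d s)))"
    by (rule sum.cong[OF refl], rule sum.swap)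
  also have "\<dots> = C3 (\<lambda>a b d. \<Sum>f\<in>UNIV. t a f d * w f b) s"
    unfolding C3_def scaleR_sum_left by (rule sum.cong[OF refl], rule sum.cong[OF refl], rule sum.swap)
  also have "(\<Sum>a\<in>UNIV. \<Sum>b\<in>UNIV. \<Sum>d\<in>UNIV. \<Sum>f\<in>UNIV. (t a b d * w a f) *\<^sub>R c f (c b (c d s)))
      = (\<Sum>a\<in>UNIV. \<Sum>b\<in>UNIV. \<Sum>f\<in>UNIV. \<Sum>d\<in>UNIV. (t a b d * w a f) *\<^sub>R c f (c b (c d s)))"
    by (rule sum.cong[OF refl], rule sum.cong[OF refl], rule sum.swap)
  also have "\<dots> = (\<Sum>a\<in>UNIV. \<Sum>f\<in>UNIV. \<Sum>b\<in>UNIV. \<Sum>d\<in>UNIV. (t a b d * w a f) *\<^sub>R c f (c b (c d s)))"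
    by (rule sum.cong[OF refl], rule sum.swap)
  also have "\<dots> = (\<Sum>a\<in>UNIV. \<Sum>f\<in>UNIV. \<Sum>b\<in>UNIV. \<Sum>d\<in>UNIV. (t f b d * w f a) *\<^sub>R c a (c b (c d s)))"
    by (rule sum.swap)
  also have "\<dots> = (\<Sum>a\<in>UNIV. \<Sum>b\<in>UNIV. \<Sum>f\<in>UNIV. \<Sum>d\<in>UNIV. (t f b d * w f a) *\<^sub>R c a (c b (c d s)))"
    by (rule sum.cong[OF refl], rule sum.swap)
  also have "\<dots> = C3 (\<lambda>a b d. \<Sum>f\<in>UNIV. t f b d * w f a) s"
    unfolding C3_def scaleR_sum_left by (rule sum.cong[OF refl], rule sum.cong[OF refl], rule sum.swap)
  finally have "C2 w (C3 t s) = C3 t (C2 w s) + 4 *\<^sub>R C3 (\<lambda>a b d. \<Sum>f\<in>UNIV. t f b d * w f a + t a f d * w f b + t a b f * w f d) s"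
    by (simp add: sum.distrib C3_add scaleR_add_right)
  then show ?thesis by simp
qed

text \<open>
  All quantities are values at one point, in an orthonormal frame \<open>e\<close>: \<open>\<Gamma> d a b = g(\<nabla>\<^bsub>d\<^esub> e\<^sub>a, e\<^sub>b)\<close>,
  \<open>dG d x a b\<close> is the derivative along \<open>e\<^sub>d\<close> of \<open>\<Gamma> x a b\<close>, likewise \<open>dH\<close> and \<open>d\<phi>\<close>, and
  \<open>R d x a b = g(R(e\<^sub>d, e\<^sub>x) e\<^sub>a, e\<^sub>b)\<close>.  In the proof \<open>K\<close> is the curvature of \<open>\<nabla>\<^sup>+\<close>, \<open>N\<close> is \<open>\<nabla>\<^sup>+ H\<close>
  and \<open>h\<close> is \<open>\<nabla>\<^sup>+ d\<phi>\<close>.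
\<close>
lemma ricci_of_killing:
  fixes \<psi> :: 'v and \<Gamma> H :: "'n \<Rightarrow> 'n \<Rightarrow> 'n \<Rightarrow> real" and dG dH R :: "'n \<Rightarrow> 'n \<Rightarrow> 'n \<Rightarrow> 'n \<Rightarrow> real"
    and \<phi> :: "'n \<Rightarrow> real" and d\<phi> :: "'n \<Rightarrow> 'n \<Rightarrow> real"
  defines "w \<equiv> \<lambda>d a b. \<Gamma> d a b + H d a b / 2"
    and "dw \<equiv> \<lambda>d x a b. dG d x a b + dH d x a b / 2"
    and "hess \<equiv> \<lambda>d b. d\<phi> d b - (\<Sum>f\<in>UNIV. \<Gamma> d b f * \<phi> f)"
  assumes \<Gamma>_anti: "\<And>d a b. \<Gamma> d b a = - \<Gamma> d a b"
    and H_anti: "\<And>a b d. H b a d = - H a b d" "\<And>a b d. H a d b = - H a b d"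
    and dH_anti: "\<And>e a b d. dH e b a d = - dH e a b d" "\<And>e a b d. dH e a d b = - dH e a b d"
    and dG_anti: "\<And>e d a b. dG e d b a = - dG e d a b"
    and R: "\<And>d x a b. R d x a b = dG d x a b - dG x d a b
      + (\<Sum>f\<in>UNIV. \<Gamma> x a f * \<Gamma> d f b - \<Gamma> d a f * \<Gamma> x f b) - (\<Sum>f\<in>UNIV. (\<Gamma> d x f - \<Gamma> x d f) * \<Gamma> f a b)"
    and R_cyclic: "\<And>d x a b. R d x a b + R d a b x + R d b x a = 0"
    and R_ricci: "\<And>d x b. R b x x d = R d x x b"
    and hess_sym: "\<And>d b. hess d b = hess b d"
    and closed: "\<And>d x a b. dH d x a b - dH x d a b + dH a d x b - dH b d x a
      - (\<Sum>f\<in>UNIV. (\<Gamma> d x f - \<Gamma> x d f) * H f a b) + (\<Sum>f\<in>UNIV. (\<Gamma> d a f - \<Gamma> a d f) * H f x b)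
      - (\<Sum>f\<in>UNIV. (\<Gamma> d b f - \<Gamma> b d f) * H f x a) - (\<Sum>f\<in>UNIV. (\<Gamma> x a f - \<Gamma> a x f) * H f d b)
      + (\<Sum>f\<in>UNIV. (\<Gamma> x b f - \<Gamma> b x f) * H f d a) - (\<Sum>f\<in>UNIV. (\<Gamma> a b f - \<Gamma> b a f) * H f d x) = 0"
    and integrable: "\<And>d x. C2 (dw d x) \<psi> - C2 (dw x d) \<psi> + (1/4) *\<^sub>R (C2 (w d) (C2 (w x) \<psi>) - C2 (w x) (C2 (w d) \<psi>))
      = (\<Sum>f\<in>UNIV. (\<Gamma> d x f - \<Gamma> x d f) *\<^sub>R C2 (w f) \<psi>)"
    and dilatino: "C1 \<phi> \<psi> + (1/12) *\<^sub>R C3 H \<psi> = 0"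
    and d_dilatino: "\<And>d. C1 (d\<phi> d) \<psi> + (1/12) *\<^sub>R C3 (dH d) \<psi>
      - (1/4) *\<^sub>R (C1 \<phi> (C2 (w d) \<psi>) + (1/12) *\<^sub>R C3 H (C2 (w d) \<psi>)) = 0"
    and faithful: "\<And>u. C1 u \<psi> = 0 \<Longrightarrow> u = (\<lambda>_. 0)"
  shows "(\<Sum>x\<in>UNIV. R d x x b) = - 2 * hess d b + (1/4) * (\<Sum>x\<in>UNIV. \<Sum>f\<in>UNIV. H d x f * H b x f)"
proof -
  \<comment> \<open>\<open>Q\<close> and \<open>G\<close> abbreviate the contractions of H with H
    and of \<Gamma> with H. Treated as atoms, they make the tensor identities below linear.\<close>
  define Q where "Q = (\<lambda>x y z v. \<Sum>f\<in>UNIV. H x y f * H z v f)"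
  define G where "G = (\<lambda>x y z v. \<Sum>f\<in>UNIV. \<Gamma> x y f * H f z v)"
  \<comment> \<open>The last sum involves \<Gamma> instead of \<open>w\<close> in its difference
    because it expresses the Lie bracket of frame fields, which the torsion-free connection
    computes.\<close>
  define K where "K = (\<lambda>d x a b. dw d x a b - dw x d a b + (\<Sum>f\<in>UNIV. w x a f * w d f b - w d a f * w x f b)
    - (\<Sum>f\<in>UNIV. (\<Gamma> d x f - \<Gamma> x d f) * w f a b))"
  define N where "N = (\<lambda>d a b x. dH d a b x + (\<Sum>f\<in>UNIV. H f b x * w d f a + H a f x * w d f b + H a b f * w d f x))"
  define h where "h = (\<lambda>d a. d\<phi> d a + (\<Sum>f\<in>UNIV. \<phi> f * w d f a))"
  have w_anti: "w d b a = - w d a b" for d a b unfolding w_def using \<Gamma>_anti[of d b a] H_anti(2)[of d b a] by simp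
  have Q_anti: "Q y x z v = - Q x y z v" "Q x y v z = - Q x y z v" "Q z v x y = Q x y z v" for x y z v
    unfolding Q_def by (simp_all add: H_anti(1)[of y x] H_anti(1)[of v z] sum_negf mult.commute)
  have G_anti: "G x y v z = - G x y z v" for x y z v
    unfolding G_def by (simp add: H_anti(2)[of _ v z] sum_negf)
  have K_anti: "K d x b a = - K d x a b" for d x a b
  proof -
    have "w x b f * w d f a - w d b f * w x f a = - (w x a f * w d f b - w d a f * w x f b)" for f
      using w_anti[of x b f] w_anti[of d f a] w_anti[of d b f] w_anti[of x f a] by simp
    then show ?thesis
      unfolding K_def dw_def
      by (simp only: w_anti[of _ b a] dG_anti[of _ _ b a] dH_anti(2)[of _ _ b a] sum_negf mult_minus_right)
  qed
  have K_eq: "K d x a b = R d x a b + (1/2) * (dH d x a b - dH x d a b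
    + G x a b d - G d b x a - G d a b x + G x b d a - G d x a b + G x d a b) + (1/4) * (Q d a x b - Q x a d b)" for d x a b
  proof -
    have "(\<Sum>f\<in>UNIV. w x a f * w d f b - w d a f * w x f b) = (\<Sum>f\<in>UNIV. \<Gamma> x a f * \<Gamma> d f b - \<Gamma> d a f * \<Gamma> x f b)
      + (1/2) * (G x a b d - G d b x a - G d a b x + G x b d a) + (1/4) * (Q d a x b - Q x a d b)"
    proof -
      have "w x a f * w d f b - w d a f * w x f b = (\<Gamma> x a f * \<Gamma> d f b - \<Gamma> d a f * \<Gamma> x f b)
        + (1/2) * (\<Gamma> x a f * H f b d - \<Gamma> d b f * H f x a - \<Gamma> d a f * H f b x + \<Gamma> x b f * H f d a)
        + (1/4) * (H d a f * H x b f - H x a f * H d b f)" for f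
      proof -
        have c: "H p q f = H f p q" for p q using H_anti(1)[of f p q] H_anti(2)[of p q f] by simp
        have e: "w x a f = \<Gamma> x a f + H f x a / 2" "w d a f = \<Gamma> d a f + H f d a / 2"
          "w d f b = \<Gamma> d f b + H f b d / 2" "w x f b = \<Gamma> x f b + H f b x / 2"
          unfolding w_def using c[of b d] c[of b x] H_anti(1)[of f d b] H_anti(1)[of f x b] H_anti(2)[of f b d] H_anti(2)[of f b x]
          by (simp_all add: c)
        show ?thesis
          unfolding e c using H_anti(2)[of f b d] H_anti(2)[of f b x] \<Gamma>_anti[of d b f] \<Gamma>_anti[of x b f]
          by (simp add: field_simps)
      qed
      then show ?thesis
        by (simp only: G_def Q_def sum_distrib_left[symmetric] sum_subtractf sum.distrib)
    qed
    moreover have "(\<Sum>f\<in>UNIV. (\<Gamma> d x f - \<Gamma> x d f) * w f a b) = (\<Sum>f\<in>UNIV. (\<Gamma> d x f - \<Gamma> x d f) * \<Gamma> f a b)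
      + (1/2) * (G d x a b - G x d a b)"
      unfolding G_def sum_subtractf[symmetric] sum.distrib[symmetric] sum_distrib_left w_def
      by (intro sum.cong refl) (simp add: field_simps)
    ultimately show ?thesis unfolding K_def R dw_def by (simp add: field_simps)
  qed
  have N_eq: "N d a b x = dH d a b x - G d a b x - G d b x a - G d x a b - (1/2) * (Q d a b x + Q d b x a + Q d x a b)" for d a b x
  proof -
    have "(\<Sum>f\<in>UNIV. H f b x * w d f a + H a f x * w d f b + H a b f * w d f x)
      = - G d a b x - G d b x a - G d x a b - (1/2) * (Q d a b x + Q d b x a + Q d x a b)"
    proof -
      have "H f b x * w d f a + H a f x * w d f b + H a b f * w d f x
        = - (\<Gamma> d a f * H f b x) - \<Gamma> d b f * H f x a - \<Gamma> d x f * H f a b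
          - (1/2) * (H d a f * H b x f + H d b f * H x a f + H d x f * H a b f)" for f
      proof -
        have c: "H p q f = H f p q" for p q using H_anti(1)[of f p q] H_anti(2)[of p q f] by simp
        have e: "w d f a = - \<Gamma> d a f - H f d a / 2" "w d f b = - \<Gamma> d b f - H f d b / 2"
          "w d f x = - \<Gamma> d x f - H f d x / 2" "H a f x = H f x a"
          unfolding w_def using H_anti(1)[of a f x] H_anti(2)[of f a x]
          by (simp_all add: \<Gamma>_anti[of d f] H_anti(1)[of d f] c)
        show ?thesis unfolding e c by (simp add: field_simps)
      qed
      then show ?thesis
        by (simp only: G_def Q_def sum_distrib_left[symmetric] sum_subtractf sum.distrib sum_negf)
    qed
    then show ?thesis unfolding N_def by simp
  qed
  \<comment> \<open>The R terms cancel by Bianchi. The direct derivatives of H in direction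
    \<open>d\<close> add up to 3/2; closedness trades those in directions \<open>x\<close>,
    \<open>a\<close>, \<open>b\<close> for another -1/2, with \<Gamma> corrections, leaving
    coefficient 1.\<close>
  have cyc: "K d x a b + K d a b x + K d b x a = N d x a b" for d x a b
  proof -
    have cl: "dH d x a b - dH x d a b + dH a d x b - dH b d x a - (G d x a b - G x d a b) + (G d a x b - G a d x b)
      - (G d b x a - G b d x a) - (G x a d b - G a x d b) + (G x b d a - G b x d a) - (G a b d x - G b a d x) = 0"
      using closed[of d x a b] by (simp add: G_def left_diff_distrib sum_subtractf)
    have e: "dH d a b x = dH d x a b" "dH d b x a = dH d x a b" "dH a d b x = - dH a d x b"
      "Q x a d b = - Q d b a x" "Q a b d x = - Q d x b a" "Q b x d a = - Q d a x b"
      "Q d x a b = - Q d x b a" "Q d a b x = - Q d a x b" "Q d b x a = - Q d b a x"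
      using dH_anti(2)[of d a x b] dH_anti(1)[of d a x b] dH_anti(1)[of d b x a] dH_anti(2)[of d x b a]
        dH_anti(2)[of a d b x] Q_anti(3)[of x a d b] Q_anti(3)[of a b d x] Q_anti(3)[of b x d a]
        Q_anti(2)[of d x a b] Q_anti(2)[of d a b x] Q_anti(2)[of d b x a]
      by linarith+
    show ?thesis
      using cl R_cyclic[of d x a b]
      unfolding K_eq N_eq e G_anti[of _ _ x d] G_anti[of _ _ a d] G_anti[of _ _ b d] G_anti[of _ _ a x] G_anti[of _ _ b x]
        G_anti[of _ _ b a] distrib_left right_diff_distrib
      by linarith
  qed
  \<comment> \<open>The 4 of \<open>C2_bracket\<close> cancels the 1/4 in \<open>integrable\<close>,
    so the latter is exactly the vanishing of the curvature on the spinor.\<close>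
  have C2K: "C2 (K d x) \<psi> = 0" for d x
  proof -
    have "C2 (K d x) \<psi> = C2 (dw d x) \<psi> - C2 (dw x d) \<psi> + (1/4) *\<^sub>R (C2 (w d) (C2 (w x) \<psi>) - C2 (w x) (C2 (w d) \<psi>))
      - (\<Sum>f\<in>UNIV. (\<Gamma> d x f - \<Gamma> x d f) *\<^sub>R C2 (w f) \<psi>)"
    proof -
      have e: "K d x = (\<lambda>a b. dw d x a b + ((-1) * dw x d a b + ((\<Sum>f\<in>UNIV. w x a f * w d f b - w d a f * w x f b)
          + (-1) * (\<Sum>f\<in>UNIV. (\<Gamma> d x f - \<Gamma> x d f) * w f a b))))"
        unfolding K_def by (simp add: fun_eq_iff)
      show ?thesis
        unfolding e C2_add C2_scale C2_sum C2_bracket[OF w_anti w_anti]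
        by simp
    qed
    then show ?thesis using integrable by simp
  qed
  \<comment> \<open>The torsion adds only a term antisymmetric in \<open>d\<close> and
    \<open>b\<close>, which disappears on symmetrising.\<close>
  have h_eq: "h d b = hess d b - (1/2) * (\<Sum>f\<in>UNIV. H d b f * \<phi> f)" for d b
  proof -
    have "\<phi> f * w d f b = - (\<Gamma> d b f * \<phi> f) - (1/2) * (H d b f * \<phi> f)" for f
      unfolding w_def by (simp add: \<Gamma>_anti[of d f] H_anti(2)[of d f] field_simps)
    then show ?thesis
      unfolding h_def hess_def by (simp only: sum_subtractf sum_negf sum_distrib_left[symmetric])
  qed
  \<comment> \<open>Moving \<open>C2 (w d)\<close> to the outside costs exactly the connection terms
    in \<open>h\<close> and \<open>N\<close>; what it then acts on is zero by
    \<open>dilatino\<close>.\<close>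
  have dil: "C1 (h d) \<psi> + (1/12) *\<^sub>R C3 (N d) \<psi> = 0" for d
  proof -
    have "C1 \<phi> (C2 (w d) \<psi>) + (1/12) *\<^sub>R C3 H (C2 (w d) \<psi>) = C2 (w d) (C1 \<phi> \<psi> + (1/12) *\<^sub>R C3 H \<psi>)
      - 4 *\<^sub>R C1 (\<lambda>a. \<Sum>f\<in>UNIV. \<phi> f * w d f a) \<psi>
      - (1/3) *\<^sub>R C3 (\<lambda>a b x. \<Sum>f\<in>UNIV. H f b x * w d f a + H a f x * w d f b + H a b f * w d f x) \<psi>"
      unfolding C1_C2_commute[OF w_anti] C3_C2_commute[OF w_anti]
      by (simp add: linear_add[OF C2_linear] linear_scale[OF C2_linear] algebra_simps)
    then have e: "C1 \<phi> (C2 (w d) \<psi>) + (1/12) *\<^sub>R C3 H (C2 (w d) \<psi>) =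
      - 4 *\<^sub>R C1 (\<lambda>a. \<Sum>f\<in>UNIV. \<phi> f * w d f a) \<psi>
      - (1/3) *\<^sub>R C3 (\<lambda>a b x. \<Sum>f\<in>UNIV. H f b x * w d f a + H a f x * w d f b + H a b f * w d f x) \<psi>"
      unfolding dilatino by (simp add: linear_0[OF C2_linear])
    show ?thesis
      using d_dilatino[of d] unfolding e h_def N_def C1_add C3_add by (simp add: algebra_simps)
  qed
  \<comment> \<open>The coefficient 1/2 is the 6 of \<open>C3_trace\<close> times the 1/12 of the
    dilatino equation.\<close>
  have "C1 (\<lambda>b. h d b + (1/2) * (\<Sum>x\<in>UNIV. K d x x b)) \<psi> = 0" for d
  proof -
    have "C3 (K d) \<psi> = (\<Sum>x\<in>UNIV. c x (C2 (K d x) \<psi>))"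
      by (simp add: C3_def C2_def c_sum c_scale)
    then have "C3 (K d) \<psi> = 0" by (simp add: C2K c_zero)
    moreover have "(\<lambda>a b x. K d a b x + K d b x a + K d x a b) = N d"
      using cyc[of d] by (simp add: fun_eq_iff)
    ultimately have "C3 (N d) \<psi> = 6 *\<^sub>R C1 (\<lambda>b. \<Sum>x\<in>UNIV. K d x x b) \<psi>"
      using C3_trace[of "K d" \<psi>, OF K_anti] by simp
    with dil[of d] show ?thesis unfolding C1_add C1_scale by simp
  qed
  from faithful[OF this] have main: "h d b + (1/2) * (\<Sum>x\<in>UNIV. K d x x b) = 0" for d b
    by (simp add: fun_eq_iff)
  \<comment> \<open>Terms in H with a repeated index vanish; the surviving derivatives of H are
    antisymmetric in \<open>d\<close> and \<open>b\<close> and cancel in the sum, together with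
    their \<Gamma> corrections.\<close>
  have KK: "K d x x b + K b x x d = 2 * R d x x b - (1/2) * Q d x b x" for x
    using K_eq[of d x x b] K_eq[of b x x d] R_ricci[of b x d]
      dH_anti(1)[of d x x b] dH_anti(1)[of b x x d] dH_anti(2)[of x d x b] dH_anti(1)[of x d b x] dH_anti(2)[of x b x d]
      G_anti[of x x b d] G_anti[of d b x x] G_anti[of b d x x] G_anti[of d x b x] G_anti[of b x d x]
      G_anti[of x b d x] G_anti[of x d b x]
      Q_anti(1)[of x x d b] Q_anti(1)[of x x b d] Q_anti(2)[of d x x b] Q_anti(2)[of b x x d] Q_anti(3)[of b x d x]
    unfolding distrib_left right_diff_distrib by linarith
  have "(\<Sum>x\<in>UNIV. K d x x b) + (\<Sum>x\<in>UNIV. K b x x d) = 2 * (\<Sum>x\<in>UNIV. R d x x b) - (1/2) * (\<Sum>x\<in>UNIV. Q d x b x)"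
    unfolding sum.distrib[symmetric] KK by (simp add: sum_subtractf sum_distrib_left)
  moreover have "(\<Sum>f\<in>UNIV. H b d f * \<phi> f) = - (\<Sum>f\<in>UNIV. H d b f * \<phi> f)"
    by (simp add: H_anti(1)[of b d] sum_negf)
  ultimately show ?thesis
    using main[of d b] main[of b d] h_eq[of d b] h_eq[of b d] hess_sym[of d b] unfolding Q_def by simp
qed

end

section \<open>Derivatives of spinors\<close>

lemma sum_triple:
  "(\<Sum>(a, b, d)\<in>UNIV. f a b d) = (\<Sum>a\<in>UNIV. \<Sum>b\<in>UNIV. \<Sum>d\<in>UNIV. f a b d)"
  for f :: "'a::finite \<Rightarrow> 'b::finite \<Rightarrow> 'c::finite \<Rightarrow> 'v::comm_monoid_add"
  by (simp add: sum.cartesian_product UNIV_Times_UNIV)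

lemma sum_pair:
  "(\<Sum>(a, b)\<in>UNIV. f a b) = (\<Sum>a\<in>UNIV. \<Sum>b\<in>UNIV. f a b)"
  for f :: "'a::finite \<Rightarrow> 'b::finite \<Rightarrow> 'v::comm_monoid_add"
  by (simp add: sum.cartesian_product UNIV_Times_UNIV)

lemma sum_symmetric_pairs:
  fixes f :: "'n::{finite,linorder} \<Rightarrow> 'n \<Rightarrow> 'v::real_vector"
  assumes sym: "\<And>a b. f b a = f a b" and diag: "\<And>a. f a a = 0"
  shows "(\<Sum>a\<in>UNIV. \<Sum>b\<in>UNIV. f a b) = 2 *\<^sub>R (\<Sum>(a, b)\<in>{(a, b). a < b}. f a b)"
proof -
  define h where "h = (\<lambda>a b. if a < b then f a b else 0)"
  have "f a b = h a b + h b a" for a b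
    using sym[of a b] diag by (cases a b rule: linorder_cases) (auto simp: h_def)
  then have "(\<Sum>a\<in>UNIV. \<Sum>b\<in>UNIV. f a b) = (\<Sum>a\<in>UNIV. \<Sum>b\<in>UNIV. h a b) + (\<Sum>a\<in>UNIV. \<Sum>b\<in>UNIV. h b a)"
    by (simp add: sum.distrib)
  also have "(\<Sum>a\<in>UNIV. \<Sum>b\<in>UNIV. h b a) = (\<Sum>a\<in>UNIV. \<Sum>b\<in>UNIV. h a b)"
    by (rule sum.swap)
  finally have "(\<Sum>a\<in>UNIV. \<Sum>b\<in>UNIV. f a b) = 2 *\<^sub>R (\<Sum>a\<in>UNIV. \<Sum>b\<in>UNIV. h a b)"
    by (simp add: scaleR_2)
  also have "(\<Sum>a\<in>UNIV. \<Sum>b\<in>UNIV. h a b) = (\<Sum>(a, b)\<in>{(a, b). a < b}. f a b)"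
    unfolding sum_pair[symmetric] by (rule sum.mono_neutral_cong_right) (auto simp: h_def split: if_splits)
  finally show ?thesis .
qed

text \<open>Distinct indices have exactly one increasing order, so \<open>f\<close> is the sum of
  its restriction \<open>h\<close> over the six orders; with a repeated index both sides
  vanish.\<close>

lemma sum_symmetric_triples:
  fixes f :: "'n::{finite,linorder} \<Rightarrow> 'n \<Rightarrow> 'n \<Rightarrow> 'v::real_vector"
  assumes sym: "\<And>a b d. f b a d = f a b d" "\<And>a b d. f a d b = f a b d" and diag: "\<And>a b. f a a b = 0"
  shows "(\<Sum>a\<in>UNIV. \<Sum>b\<in>UNIV. \<Sum>d\<in>UNIV. f a b d) = 6 *\<^sub>R (\<Sum>(a, b, d)\<in>{(a, b, d). a < b \<and> b < d}. f a b d)"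
proof -
  define h where "h = (\<lambda>a b d. if a < b \<and> b < d then f a b d else 0)"
  let ?S = "\<Sum>a\<in>UNIV. \<Sum>b\<in>UNIV. \<Sum>d\<in>UNIV. h a b d"
  have diag': "f a b a = 0" "f b a a = 0" for a b
    using diag sym by metis+
  have "f a b d = h a b d + h a d b + (h b a d + h b d a) + (h d a b + h d b a)" for a b d
  proof -
    have "f a d b = f a b d" "f b a d = f a b d" "f b d a = f a b d" "f d a b = f a b d" "f d b a = f a b d"
      using sym by metis+
    then show ?thesis
      using diag[of a d] diag'[of a b] diag'[of b a]
      by (cases a b rule: linorder_cases; cases b d rule: linorder_cases; cases a d rule: linorder_cases)
        (auto simp: h_def)
  qed
  then have "(\<Sum>a\<in>UNIV. \<Sum>b\<in>UNIV. \<Sum>d\<in>UNIV. f a b d) = ?S + (\<Sum>a\<in>UNIV. \<Sum>b\<in>UNIV. \<Sum>d\<in>UNIV. h a d b)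
      + ((\<Sum>a\<in>UNIV. \<Sum>b\<in>UNIV. \<Sum>d\<in>UNIV. h b a d) + (\<Sum>a\<in>UNIV. \<Sum>b\<in>UNIV. \<Sum>d\<in>UNIV. h b d a))
      + ((\<Sum>a\<in>UNIV. \<Sum>b\<in>UNIV. \<Sum>d\<in>UNIV. h d a b) + (\<Sum>a\<in>UNIV. \<Sum>b\<in>UNIV. \<Sum>d\<in>UNIV. h d b a))"
    by (simp add: sum.distrib)
  moreover have 1: "(\<Sum>a\<in>UNIV. \<Sum>b\<in>UNIV. \<Sum>d\<in>UNIV. h a d b) = ?S"
    by (rule sum.cong[OF refl], rule sum.swap)
  moreover have "(\<Sum>a\<in>UNIV. \<Sum>b\<in>UNIV. \<Sum>d\<in>UNIV. h b a d) = ?S"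
    by (rule sum.swap)
  moreover have 2: "(\<Sum>a\<in>UNIV. \<Sum>b\<in>UNIV. \<Sum>d\<in>UNIV. h b d a) = ?S"
    by (subst sum.swap) (rule 1)
  moreover have 3: "(\<Sum>a\<in>UNIV. \<Sum>b\<in>UNIV. \<Sum>d\<in>UNIV. h d a b) = ?S"
    unfolding 2[symmetric] by (subst sum.swap, rule sum.cong[OF refl], rule sum.swap)
  moreover have "(\<Sum>a\<in>UNIV. \<Sum>b\<in>UNIV. \<Sum>d\<in>UNIV. h d b a) = ?S"
    by (subst sum.swap) (rule 3)
  ultimately have "(\<Sum>a\<in>UNIV. \<Sum>b\<in>UNIV. \<Sum>d\<in>UNIV. f a b d) = ?S + ?S + (?S + ?S) + (?S + ?S)" by simp
  also have "\<dots> = 6 *\<^sub>R ?S" 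
    using scaleR_add_left[of 2 4 ?S] scaleR_add_left[of 2 2 ?S] by (simp add: scaleR_2)
  also have "?S = (\<Sum>(a, b, d)\<in>{(a, b, d). a < b \<and> b < d}. f a b d)"
    unfolding sum_triple[symmetric] by (rule sum.mono_neutral_cong_right) (auto simp: h_def split: if_splits)
  finally show ?thesis .
qed

section \<open>Spinor-valued functions\<close>

context smooth_manifold
begin

definition smooth_spinor_near :: "'m \<Rightarrow> ('m \<Rightarrow> complex^'k::finite) \<Rightarrow> bool" where
  "smooth_spinor_near p \<psi> \<longleftrightarrow> (\<forall>j. smooth_near A p (\<lambda>q. Re (\<psi> q $ j)) \<and> smooth_near A p (\<lambda>q. Im (\<psi> q $ j)))"

lemma smooth_spinor:
  assumes "smooth_fun A U \<psi>" "open U" "p \<in> U"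
  shows "smooth_spinor_near p \<psi>"
proof -
  have "bounded_linear (\<lambda>z :: complex^'a. Re (z $ j))" "bounded_linear (\<lambda>z :: complex^'a. Im (z $ j))" for j
    by (intro bounded_linear_compose[OF bounded_linear_Re] bounded_linear_compose[OF bounded_linear_Im] bounded_linear_vec_nth)+
  then show ?thesis
    unfolding smooth_spinor_near_def
    using smooth_fun_near[OF smooth_fun_linear[OF _ assms(2,1)] assms(2,3)] by blast
qed

lemma spinor_deriv_cong:
  assumes "v \<in> tangent_space A p" "open U" "p \<in> U" "\<And>q. q \<in> U \<Longrightarrow> \<psi> q = \<psi>' q"
  shows "spinor_deriv v \<psi> = spinor_deriv v \<psi>'"
  using tangent_cong[OF assms(1-3), of "\<lambda>q. Re (\<psi> q $ j)" "\<lambda>q. Re (\<psi>' q $ j)" for j]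
    tangent_cong[OF assms(1-3), of "\<lambda>q. Im (\<psi> q $ j)" "\<lambda>q. Im (\<psi>' q $ j)" for j] assms(4)
  by (simp add: spinor_deriv_def)

text \<open>Constant matrices with real coefficient functions cover \<open>C1\<close>,
  \<open>C2\<close> and \<open>C3\<close> at once, indexed by single indices, pairs or
  triples.\<close>

lemma spinor_deriv_matrices:
  assumes v: "v \<in> tangent_space A p" and r: "\<And>i. i \<in> I \<Longrightarrow> smooth_near A p (r i)" and \<psi>: "smooth_spinor_near p \<psi>"
  shows "spinor_deriv v (\<lambda>q. \<Sum>i\<in>I. r i q *\<^sub>R (B i *v \<psi> q))
    = (\<Sum>i\<in>I. v (r i) *\<^sub>R (B i *v \<psi> p) + r i p *\<^sub>R (B i *v spinor_deriv v \<psi>))"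
proof -
  have n: "smooth_near A p (\<lambda>q. Re (\<psi> q $ j))" "smooth_near A p (\<lambda>q. Im (\<psi> q $ j))" for j
    using \<psi> unfolding smooth_spinor_near_def by auto
  have re: "v (\<lambda>q. \<Sum>k\<in>UNIV. c k * Re (\<psi> q $ k) + d k * Im (\<psi> q $ k))
      = (\<Sum>k\<in>UNIV. c k * v (\<lambda>q. Re (\<psi> q $ k)) + d k * v (\<lambda>q. Im (\<psi> q $ k)))" for c d
    by (subst tangent_sum_fun[OF v])
      (simp_all add: tangent_add[OF v] tangent_cmult[OF v] n smooth_near_add smooth_near_cmult)
  have sn: "smooth_near A p (\<lambda>q. \<Sum>k\<in>UNIV. c k * Re (\<psi> q $ k) + d k * Im (\<psi> q $ k))" for c d
    by (intro smooth_near_sum smooth_near_add smooth_near_cmult n)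
  \<comment> \<open>\<open>c\<close> and \<open>d\<close> anticipate the matrix entries:
    \<open>Re\<close> and \<open>- Im\<close> for the real part of the product, \<open>Im\<close>
    and \<open>Re\<close> for the imaginary part.\<close>
  have main: "v (\<lambda>q. \<Sum>i\<in>I. r i q * (\<Sum>k\<in>UNIV. c i k * Re (\<psi> q $ k) + d i k * Im (\<psi> q $ k)))
      = (\<Sum>i\<in>I. v (r i) * (\<Sum>k\<in>UNIV. c i k * Re (\<psi> p $ k) + d i k * Im (\<psi> p $ k)))
         + (\<Sum>i\<in>I. r i p * (\<Sum>k\<in>UNIV. c i k * v (\<lambda>q. Re (\<psi> q $ k)) + d i k * v (\<lambda>q. Im (\<psi> q $ k))))" for c d
    unfolding sum.distrib[of "\<lambda>i. v (r i) * _ i", symmetric]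
    by (subst tangent_sum_fun[OF v])
      (auto intro!: sum.cong smooth_near_mult r sn simp: tangent_mult[OF v r sn] re)
  have Re: "Re ((\<Sum>i\<in>I. r i q *\<^sub>R (B i *v s)) $ j)
      = (\<Sum>i\<in>I. r i q * (\<Sum>k\<in>UNIV. Re (B i $ j $ k) * Re (s $ k) + (- Im (B i $ j $ k)) * Im (s $ k)))"
    and Im: "Im ((\<Sum>i\<in>I. r i q *\<^sub>R (B i *v s)) $ j)
      = (\<Sum>i\<in>I. r i q * (\<Sum>k\<in>UNIV. Im (B i $ j $ k) * Re (s $ k) + Re (B i $ j $ k) * Im (s $ k)))" for q s j r
    by (simp_all add: matrix_vector_mult_def add.commute)
  have "Re (spinor_deriv v (\<lambda>q. \<Sum>i\<in>I. r i q *\<^sub>R (B i *v \<psi> q)) $ j)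
      = Re ((\<Sum>i\<in>I. v (r i) *\<^sub>R (B i *v \<psi> p) + r i p *\<^sub>R (B i *v spinor_deriv v \<psi>)) $ j)"
    "Im (spinor_deriv v (\<lambda>q. \<Sum>i\<in>I. r i q *\<^sub>R (B i *v \<psi> q)) $ j)
      = Im ((\<Sum>i\<in>I. v (r i) *\<^sub>R (B i *v \<psi> p) + r i p *\<^sub>R (B i *v spinor_deriv v \<psi>)) $ j)" for j
    unfolding sum.distrib
    unfolding vector_add_component plus_complex.sel Re[of "\<lambda>i _. v (r i)"] Im[of "\<lambda>i _. v (r i)"]
      Re[of "\<lambda>i _. r i p"] Im[of "\<lambda>i _. r i p"]
    by (simp_all only: spinor_deriv_def vec_lambda_beta complex.sel Re Im main)
  then show ?thesis by (simp add: vec_eq_iff complex_eq_iff)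
qed

lemma spinor_deriv_comb:
  "spinor_deriv (\<lambda>f. \<Sum>i\<in>I. r i * u i f) \<psi> = (\<Sum>i\<in>I. r i *\<^sub>R spinor_deriv (u i) \<psi>)"
  by (simp add: spinor_deriv_def vec_eq_iff complex_eq_iff)

lemma spinor_deriv_bracket:
  assumes "smooth_spinor_near p \<psi>"
  shows "spinor_deriv (lie_bracket A X Y p) \<psi>
    = spinor_deriv (X p) (\<lambda>q. spinor_deriv (Y q) \<psi>) - spinor_deriv (Y p) (\<lambda>q. spinor_deriv (X q) \<psi>)"
  using assms by (simp add: smooth_spinor_near_def spinor_deriv_def lie_bracket_def vec_eq_iff complex_eq_iff)

end

section \<open>The spinor module as a Clifford action\<close>

lemma cl_vec_axis: "cl_vec cl (axis a 1) = cl a"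
  by (simp add: cl_vec_def axis_def if_distrib[of "\<lambda>x. x *\<^sub>R _"] cong: if_cong)

lemma scaleR_matrix_vector: "(r *\<^sub>R B) *v s = r *\<^sub>R (B *v s)" for B :: "complex^'k^'j"
  by (simp add: matrix_vector_mult_def vec_eq_iff scaleR_sum_right)

lemma matrix_vector_scaleR: "B *v (r *\<^sub>R s) = r *\<^sub>R (B *v s)" for B :: "complex^'k^'j"
  by (simp add: matrix_vector_mult_def vec_eq_iff scaleR_sum_right)

lemma matrix_vector_sum: "(\<Sum>i\<in>I. B i) *v s = (\<Sum>i\<in>I. B i *v s)" for B :: "_ \<Rightarrow> complex^'k^'j"
  by (induction I rule: infinite_finite_induct) (simp_all add: matrix_vector_mult_add_rdistrib)

lemma spinor_module_clifford_action:
  assumes "spinor_module cl"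
  shows "clifford_action (\<lambda>a. (*v) (cl a))"
proof (rule clifford_action.intro)
  show "linear ((*v) (cl a))" for a
    by (rule linearI) (simp_all add: matrix_vector_right_distrib matrix_vector_scaleR)
  fix a b s
  have "cl_vec cl (axis a 1) ** cl_vec cl (axis b 1) + cl_vec cl (axis b 1) ** cl_vec cl (axis a 1)
      = (- 2 * (axis a 1 \<bullet> axis b (1::real))) *\<^sub>R mat 1"
    using assms unfolding spinor_module_def by blast
  then have "cl a ** cl b + cl b ** cl a = (if a = b then -2 else 0) *\<^sub>R mat 1"
    by (auto simp: cl_vec_axis inner_axis_axis)
  then have "(cl a ** cl b + cl b ** cl a) *v s = (if a = b then -2 else 0) *\<^sub>R s"
    by (simp add: scaleR_matrix_vector)
  then show "cl a *v (cl b *v s) + cl b *v (cl a *v s) = (if a = b then -2 else 0) *\<^sub>R s"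
    by (simp add: matrix_vector_mult_add_rdistrib matrix_vector_mul_assoc)
qed

lemma clifford2_C2:
  fixes cl :: "'n::{finite,linorder} \<Rightarrow> complex^'k^'k::finite"
  assumes "spinor_module cl" and anti: "\<And>a b. w b a = - w a b"
  shows "(\<Sum>(a, b)\<in>{(a, b). a < b}. w a b *\<^sub>R (cl a *v (cl b *v s))) = (1/2) *\<^sub>R clifford_action.C2 (\<lambda>a. (*v) (cl a)) w s"
proof -
  interpret clifford_action "\<lambda>a. (*v) (cl a)" by (rule spinor_module_clifford_action[OF assms(1)])
  have "C2 w s = 2 *\<^sub>R (\<Sum>(a, b)\<in>{(a, b). a < b}. w a b *\<^sub>R (cl a *v (cl b *v s)))"
    unfolding C2_def
  proof (rule sum_symmetric_pairs)
    show "w b a *\<^sub>R (cl b *v (cl a *v s)) = w a b *\<^sub>R (cl a *v (cl b *v s))" for a b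
      using c_anticommute[of b a s] anti[of b a] by (cases "a = b") auto
    show "w a a *\<^sub>R (cl a *v (cl a *v s)) = 0" for a
      using anti[of a a] by simp
  qed
  then show ?thesis by simp
qed

lemma clifford3_C3:
  fixes cl :: "'n::{finite,linorder} \<Rightarrow> complex^'k^'k::finite"
  assumes "spinor_module cl" and anti: "\<And>a b d. t b a d = - t a b d" "\<And>a b d. t a d b = - t a b d"
  shows "(\<Sum>(a, b, d)\<in>{(a, b, d). a < b \<and> b < d}. t a b d *\<^sub>R (cl a *v (cl b *v (cl d *v s))))
    = (1/6) *\<^sub>R clifford_action.C3 (\<lambda>a. (*v) (cl a)) t s"
proof -
  interpret clifford_action "\<lambda>a. (*v) (cl a)" by (rule spinor_module_clifford_action[OF assms(1)])
  have "C3 t s = 6 *\<^sub>R (\<Sum>(a, b, d)\<in>{(a, b, d). a < b \<and> b < d}. t a b d *\<^sub>R (cl a *v (cl b *v (cl d *v s))))"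
    unfolding C3_def
  proof (rule sum_symmetric_triples)
    show "t b a d *\<^sub>R (cl b *v (cl a *v (cl d *v s))) = t a b d *\<^sub>R (cl a *v (cl b *v (cl d *v s)))" for a b d
      using c_anticommute[of b a "cl d *v s"] anti(1)[of b a d] by (cases "a = b") auto
    show "t a d b *\<^sub>R (cl a *v (cl d *v (cl b *v s))) = t a b d *\<^sub>R (cl a *v (cl b *v (cl d *v s)))" for a b d
      using c_anticommute[of d b s] anti(2)[of a d b] by (cases "b = d") (auto simp: c_minus)
    show "t a a b *\<^sub>R (cl a *v (cl a *v (cl b *v s))) = 0" for a b
      using anti(1)[of a a b] by simp
  qed
  then show ?thesis by simp
qed

text \<open>A real vector acts as its length times an isometry.\<close>

lemma spinor_module_faithful:
  assumes "spinor_module cl" "\<psi> \<noteq> 0" "clifford_action.C1 (\<lambda>a. (*v) (cl a)) u \<psi> = 0"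
  shows "u = (\<lambda>_. 0)"
proof -
  interpret clifford_action "\<lambda>a. (*v) (cl a)" by (rule spinor_module_clifford_action[OF assms(1)])
  have "C1 u \<psi> = cl_vec cl (\<chi> a. u a) *v \<psi>"
    by (simp add: C1_def cl_vec_def matrix_vector_sum scaleR_matrix_vector)
  then have "norm (\<chi> a. u a) * norm \<psi> = 0"
    using assms unfolding spinor_module_def by (metis norm_zero)
  then show ?thesis using assms(2) by (auto simp: fun_eq_iff vec_eq_iff)
qed

lemma (in smooth_manifold)
  fixes cl :: "'a::finite \<Rightarrow> complex^'k^'k::finite"
  assumes cl: "spinor_module cl" and v: "v \<in> tangent_space A p" and \<psi>: "smooth_spinor_near p \<psi>"
  shows spinor_deriv_C1: "(\<And>a. smooth_near A p (\<lambda>q. u q a)) \<Longrightarrow>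
      spinor_deriv v (\<lambda>q. clifford_action.C1 (\<lambda>a. (*v) (cl a)) (u q) (\<psi> q))
      = clifford_action.C1 (\<lambda>a. (*v) (cl a)) (\<lambda>a. v (\<lambda>q. u q a)) (\<psi> p)
      + clifford_action.C1 (\<lambda>a. (*v) (cl a)) (u p) (spinor_deriv v \<psi>)" (is "PROP ?A1 \<Longrightarrow> ?P1")
    and spinor_deriv_C2: "(\<And>a b. smooth_near A p (\<lambda>q. w q a b)) \<Longrightarrow>
      spinor_deriv v (\<lambda>q. clifford_action.C2 (\<lambda>a. (*v) (cl a)) (w q) (\<psi> q))
      = clifford_action.C2 (\<lambda>a. (*v) (cl a)) (\<lambda>a b. v (\<lambda>q. w q a b)) (\<psi> p)
      + clifford_action.C2 (\<lambda>a. (*v) (cl a)) (w p) (spinor_deriv v \<psi>)" (is "PROP ?A2 \<Longrightarrow> ?P2")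
    and spinor_deriv_C3: "(\<And>a b d. smooth_near A p (\<lambda>q. t q a b d)) \<Longrightarrow>
      spinor_deriv v (\<lambda>q. clifford_action.C3 (\<lambda>a. (*v) (cl a)) (t q) (\<psi> q))
      = clifford_action.C3 (\<lambda>a. (*v) (cl a)) (\<lambda>a b d. v (\<lambda>q. t q a b d)) (\<psi> p)
      + clifford_action.C3 (\<lambda>a. (*v) (cl a)) (t p) (spinor_deriv v \<psi>)" (is "PROP ?A3 \<Longrightarrow> ?P3")
proof -
  interpret clifford_action "\<lambda>a. (*v) (cl a)" by (rule spinor_module_clifford_action[OF cl])
  have C1: "C1 u s = (\<Sum>a\<in>UNIV. u a *\<^sub>R (cl a *v s))" for u s
    by (simp add: C1_def)
  have C2: "C2 w s = (\<Sum>i\<in>UNIV. w (fst i) (snd i) *\<^sub>R ((cl (fst i) ** cl (snd i)) *v s))" for w s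
    unfolding C2_def sum_pair[symmetric] by (simp add: matrix_vector_mul_assoc case_prod_unfold)
  have C3: "C3 t s = (\<Sum>i\<in>UNIV. t (fst i) (fst (snd i)) (snd (snd i)) *\<^sub>R
      ((cl (fst i) ** (cl (fst (snd i)) ** cl (snd (snd i)))) *v s))" for t s
    unfolding C3_def sum_triple[symmetric] by (simp add: matrix_vector_mul_assoc case_prod_unfold)
  show "PROP ?A1 \<Longrightarrow> ?P1" unfolding C1 sum.distrib[symmetric] by (rule spinor_deriv_matrices[OF v _ \<psi>])
  show "PROP ?A2 \<Longrightarrow> ?P2" unfolding C2 sum.distrib[symmetric] by (rule spinor_deriv_matrices[OF v _ \<psi>])
  show "PROP ?A3 \<Longrightarrow> ?P3" unfolding C3 sum.distrib[symmetric] by (rule spinor_deriv_matrices[OF v _ \<psi>])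
qed

section \<open>Ricci curvature in a spin frame\<close>

lemma sum_orthogonal:
  fixes O1 :: "'a::finite \<Rightarrow> 'b::finite \<Rightarrow> real"
  assumes "\<And>i j. (\<Sum>a\<in>UNIV. O1 a i * O1 a j) = (if i = j then 1 else 0)"
  shows "(\<Sum>a\<in>UNIV. \<Sum>i\<in>UNIV. \<Sum>j\<in>UNIV. O1 a i * (O1 a j * B i j)) = (\<Sum>i\<in>UNIV. B i i)"
proof -
  have "(\<Sum>a\<in>UNIV. \<Sum>i\<in>UNIV. \<Sum>j\<in>UNIV. O1 a i * (O1 a j * B i j))
      = (\<Sum>i\<in>UNIV. \<Sum>a\<in>UNIV. \<Sum>j\<in>UNIV. O1 a i * (O1 a j * B i j))"
    by (rule sum.swap)
  also have "\<dots> = (\<Sum>i\<in>UNIV. \<Sum>j\<in>UNIV. \<Sum>a\<in>UNIV. O1 a i * (O1 a j * B i j))"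
    by (rule sum.cong[OF refl], rule sum.swap)
  also have "\<dots> = (\<Sum>i\<in>UNIV. \<Sum>j\<in>UNIV. (if i = j then 1 else 0) * B i j)"
    unfolding assms[symmetric] by (simp add: sum_distrib_right mult.assoc)
  also have "\<dots> = (\<Sum>i\<in>UNIV. B i i)"
    by (simp add: if_distrib[of "\<lambda>x. x * _"] cong: if_cong)
  finally show ?thesis .
qed

context smooth_manifold
begin

lemma tensorial_sum_fun:
  assumes "\<And>i. i \<in> I \<Longrightarrow> tensorial W p (F i)"
  shows "tensorial W p (\<lambda>X. \<Sum>i\<in>I. F i X)"
proof -
  have "(\<Sum>i\<in>I. F i (\<lambda>q f. h q * X q f + X' q f)) = h p * (\<Sum>i\<in>I. F i X) + (\<Sum>i\<in>I. F i X')"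
    if "X \<in> vector_fields A W" "X' \<in> vector_fields A W" "smooth_fun A W h" for X X' h
    unfolding sum_distrib_left sum.distrib[symmetric]
    by (intro sum.cong refl tensorialD[OF assms] that)
  then show ?thesis unfolding tensorial_def by blast
qed

lemma tensorial_lincomb:
  assumes "tensorial W p F" "tensorial W p F'"
  shows "tensorial W p (\<lambda>X. r * F X + F' X)"
  unfolding tensorial_def
  using tensorialD[OF assms(1)] tensorialD[OF assms(2)] by (simp add: algebra_simps)

lemma tensorial_mult_right: "tensorial W p F \<Longrightarrow> tensorial W p (\<lambda>X. F X * r)"
  unfolding tensorial_def by (simp add: algebra_simps)

lemma tensorial_mult_left: "tensorial W p F \<Longrightarrow> tensorial W p (\<lambda>X. r * F X)"
  unfolding tensorial_def by (simp add: algebra_simps)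

context
  fixes H :: "'m \<Rightarrow> 'm tangent \<Rightarrow> 'm tangent \<Rightarrow> 'm tangent \<Rightarrow> real"
  assumes H: "three_form A H"
begin

lemma three_form_linear:
  assumes "u \<in> tangent_space A p" "u' \<in> tangent_space A p" "v \<in> tangent_space A p" "w \<in> tangent_space A p"
  shows "H p (\<lambda>f. r * u f + u' f) v w = r * H p u v w + H p u' v w"
  using conjunct1[OF H[unfolded three_form_def]] assms by simp

lemma
  assumes "u \<in> tangent_space A p" "v \<in> tangent_space A p" "w \<in> tangent_space A p"
  shows three_form_swap_12: "H p v u w = - H p u v w" and three_form_swap_23: "H p u w v = - H p u v w"
  using conjunct1[OF conjunct2[OF H[unfolded three_form_def]]] assms by blast+

lemma three_form_smooth:
  assumes "open U" "X \<in> vector_fields A U" "Y \<in> vector_fields A U" "Z \<in> vector_fields A U"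
  shows "smooth_fun A U (\<lambda>p. H p (X p) (Y p) (Z p))"
  using conjunct2[OF conjunct2[OF H[unfolded three_form_def]]] assms by blast

lemma three_form_sum:
  assumes "\<And>i. i \<in> I \<Longrightarrow> u i \<in> tangent_space A p" "v \<in> tangent_space A p" "w \<in> tangent_space A p"
  shows "H p (\<lambda>f. \<Sum>i\<in>I. r i * u i f) v w = (\<Sum>i\<in>I. r i * H p (u i) v w)"
  using assms(1)
proof (induction I rule: infinite_finite_induct)
  case (insert i I)
  then show ?case
    using three_form_linear[OF _ tangent_sum[of I u p r] assms(2,3), of "u i" "r i"] by simp
qed (use three_form_linear[OF tangent_zero tangent_zero assms(2,3), of "-1"] in simp_all)

lemma three_form_tensorial:
  assumes "open W" "p \<in> W" "u \<in> tangent_space A p" "v \<in> tangent_space A p"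
  shows "tensorial W p (\<lambda>X. H p (X p) u v)"
  unfolding tensorial_def using three_form_linear vf_tangent assms by auto

end

end

section \<open>Structure equations in an orthonormal frame\<close>

context levi_civita_connection
begin

lemma connection_antisym:
  assumes "open W" "orthonormal_frame A g W e" "q \<in> W" "X \<in> vector_fields A W"
  shows "g q (nabla X (e b) q) (e a q) = - g q (nabla X (e a) q) (e b q)"
proof -
  note e = frame_field[OF assms(2)]
  have "X q (\<lambda>r. g r (e a r) (e b r)) = X q (\<lambda>r. if a = b then 1 else 0)"
    by (rule tangent_cong[OF vf_tangent[OF assms(4,3)] assms(1,3)]) (simp add: frame_on[OF assms(2)])
  then have "g q (nabla X (e a) q) (e b q) + g q (e a q) (nabla X (e b) q) = 0"
    using tangent_const[OF vf_tangent[OF assms(4,3)]] nabla_metric[OF assms(1,4) e e assms(3)] by simp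
  then show ?thesis
    using metric_sym[OF frame_tangent[OF assms(2,3)] nabla_tangent[OF assms(1,4) e assms(3)], of a b] by simp
qed

lemma bracket_frame:
  assumes W: "open W" "orthonormal_frame A g W e" "q \<in> W"
  shows "lie_bracket A (e d) (e x) q
    = (\<lambda>f. \<Sum>a\<in>UNIV. (g q (nabla (e d) (e x) q) (e a q) - g q (nabla (e x) (e d) q) (e a q)) * e a q f)"
proof -
  note e = frame_field[OF W(2)]
  note t = nabla_tangent[OF W(1) e e W(3)]
  have "g q (lie_bracket A (e d) (e x) q) (e a q) = g q (nabla (e d) (e x) q) (e a q) - g q (nabla (e x) (e d) q) (e a q)" for a
    unfolding bracket_nabla[OF W(1) e e W(3)] by (rule metric_diff[OF t t frame_tangent[OF W(2,3)]])
  then show ?thesis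
    using frame_expand[OF W(2,3) vf_tangent[OF bracket_field[OF W(1) e e] W(3)], of d x] by simp
qed

text \<open>Cartan's second structure equation in components. The last sum accounts for the brackets
  of the frame fields.\<close>

lemma Rm_frame:
  fixes e p
  defines "\<Gamma> \<equiv> \<lambda>q x a b. g q (nabla (e x) (e a) q) (e b q)"
  assumes W: "open W" "orthonormal_frame A g W e" "p \<in> W"
  shows "Rm (e d) (e x) (e a) (e b) p = e d p (\<lambda>q. \<Gamma> q x a b) - e x p (\<lambda>q. \<Gamma> q d a b)
    + (\<Sum>f\<in>UNIV. \<Gamma> p x a f * \<Gamma> p d f b - \<Gamma> p d a f * \<Gamma> p x f b)
    - (\<Sum>f\<in>UNIV. (\<Gamma> p d x f - \<Gamma> p x d f) * \<Gamma> p f a b)"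
proof -
  note e = frame_field[OF W(2)]
  note t = nabla_tangent[OF W(1) e e W(3)]
  have anti: "\<Gamma> p x b a = - \<Gamma> p x a b" for x a b
    unfolding \<Gamma>_def by (rule connection_antisym[OF W e])
  have prod: "g p (nabla (e x) (e a) p) (nabla (e d) (e b) p) = - (\<Sum>f\<in>UNIV. \<Gamma> p x a f * \<Gamma> p d f b)" for x a d b
    unfolding metric_frame[OF W(2,3) t t] sum_negf[symmetric]
    using anti[of d b] unfolding \<Gamma>_def by simp
  have T: "tensorial W p (\<lambda>X. g p (nabla X (e a) p) (e b p))"
    unfolding tensorial_def
    using nabla_tensorial[OF W(1) _ _ e _ W(3)] metric_linear nabla_tangent[OF W(1) _ e W(3)] frame_tangent[OF W(2,3)]
    by simp
  have "g p (nabla (lie_bracket A (e d) (e x)) (e a) p) (e b p)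
      = (\<Sum>f\<in>UNIV. g p (lie_bracket A (e d) (e x) p) (e f p) * \<Gamma> p f a b)"
    unfolding \<Gamma>_def by (rule tensorial_expand[OF T W(1,3,2) bracket_field[OF W(1) e e]])
  also have "\<dots> = (\<Sum>f\<in>UNIV. (\<Gamma> p d x f - \<Gamma> p x d f) * \<Gamma> p f a b)"
    unfolding \<Gamma>_def bracket_nabla[OF W(1) e e W(3)]
    by (simp add: metric_diff[OF t t frame_tangent[OF W(2,3)]])
  finally show ?thesis
    unfolding Rm_eq[OF W(1) e e e e W(3)] prod by (simp add: \<Gamma>_def sum_subtractf)
qed

text \<open>The passage from analysis to algebra: both spinor equations hold on all of
  \<open>W\<close>, so they can be differentiated, and the values at \<open>p\<close> feed
  \<open>ricci_of_killing\<close>.\<close>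

lemma ricci_in_parallel_spin_frame:
  fixes cl :: "'n \<Rightarrow> complex^'k^'k::finite" and e H p
  defines "\<Gamma> \<equiv> \<lambda>q x a b. g q (nabla (e x) (e a) q) (e b q)"
    and "Hc \<equiv> \<lambda>q a b d. H q (e a q) (e b q) (e d q)"
  assumes cl: "spinor_module cl" and W: "open W" "orthonormal_frame A g W e" "p \<in> W"
    and H: "closed_three_form A H" and \<phi>: "smooth_fun A W \<phi>"
    and \<psi>: "smooth_fun A W \<psi>" "\<psi> p \<noteq> 0"
    and killing: "\<And>q x. q \<in> W \<Longrightarrow> spinor_deriv (e x q) \<psi>
      = - ((1/4) *\<^sub>R clifford_action.C2 (\<lambda>a. (*v) (cl a)) (\<lambda>a b. \<Gamma> q x a b + Hc q x a b / 2) (\<psi> q))"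
    and dilatino: "\<And>q. q \<in> W \<Longrightarrow> clifford_action.C1 (\<lambda>a. (*v) (cl a)) (\<lambda>a. e a q \<phi>) (\<psi> q)
      + (1/12) *\<^sub>R clifford_action.C3 (\<lambda>a. (*v) (cl a)) (Hc q) (\<psi> q) = 0"
  shows "(\<Sum>x\<in>UNIV. Rm (e x) (e d) (e b) (e x) p) = - 2 * hessian nabla \<phi> (e d) (e b) p
    + (1/4) * (\<Sum>x\<in>UNIV. \<Sum>f\<in>UNIV. Hc p d x f * Hc p b x f)"
proof -
  interpret clifford_action "\<lambda>a. (*v) (cl a)" by (rule spinor_module_clifford_action[OF cl])
  have H3: "three_form A H" using H unfolding closed_three_form_def by blast
  note e = frame_field[OF W(2)] and et = frame_tangent[OF W(2)]
  note ep = et[OF W(3)]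
  note sp = smooth_spinor[OF \<psi>(1) W(1,3)]
  define w where "w = (\<lambda>q x a b. \<Gamma> q x a b + Hc q x a b / 2)"
  define dG where "dG = (\<lambda>d x a b. e d p (\<lambda>q. \<Gamma> q x a b))"
  define dH where "dH = (\<lambda>d x a b. e d p (\<lambda>q. Hc q x a b))"
  define \<phi>c where "\<phi>c = (\<lambda>q a. e a q \<phi>)"
  define d\<phi> where "d\<phi> = (\<lambda>d a. e d p (\<lambda>q. \<phi>c q a))"
  have \<Gamma>n: "smooth_near A p (\<lambda>q. \<Gamma> q x a b)" for x a b
    unfolding \<Gamma>_def by (rule smooth_fun_near[OF metric_smooth[OF W(1) nabla_field[OF W(1) e e] e] W(1,3)])
  have Hn: "smooth_near A p (\<lambda>q. Hc q x a b)" for x a b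
    unfolding Hc_def by (rule smooth_fun_near[OF three_form_smooth[OF H3 W(1) e e e] W(1,3)])
  have \<phi>n: "smooth_near A p (\<lambda>q. \<phi>c q a)" for a
    unfolding \<phi>c_def by (rule smooth_fun_near[OF vf_smooth[OF e W(1) order_refl \<phi>] W(1,3)])
  have wn: "smooth_near A p (\<lambda>q. w q x a b)" for x a b
    using smooth_near_add[OF \<Gamma>n smooth_near_cmult[OF Hn, of "1/2"]] unfolding w_def by simp
  have dw: "e d p (\<lambda>q. w q x a b) = dG d x a b + dH d x a b / 2" for d x a b
    using tangent_add[OF ep \<Gamma>n smooth_near_cmult[OF Hn, of "1/2"]] tangent_cmult[OF ep Hn, of _ "1/2"]
    unfolding w_def dG_def dH_def by simp
  have \<Gamma>_anti: "\<Gamma> q x b a = - \<Gamma> q x a b" if "q \<in> W" for q x a b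
    unfolding \<Gamma>_def by (rule connection_antisym[OF W(1,2) that e])
  have Hc_anti: "Hc q b a d = - Hc q a b d" "Hc q a d b = - Hc q a b d" if "q \<in> W" for q a b d
    unfolding Hc_def by (rule three_form_swap_12[OF H3 et et et] three_form_swap_23[OF H3 et et et]; rule that)+
  have neg: "e d p f = - e d p h" if "smooth_near A p h" "\<And>q. q \<in> W \<Longrightarrow> f q = - h q" for d f h
    using tangent_cong[OF ep W(1,3), of f "\<lambda>q. (-1) * h q" d] tangent_cmult[OF ep that(1), of d "-1"] that(2) by simp
  have hess: "hessian nabla \<phi> (e d) (e b) p = d\<phi> d b - (\<Sum>f\<in>UNIV. \<Gamma> p d b f * \<phi>c p f)" for d b
    using fun_cong[OF frame_expand[OF W(2,3) nabla_tangent[OF W(1) e e W(3)]], of d b \<phi>]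
    unfolding hessian_def d\<phi>_def \<phi>c_def \<Gamma>_def by simp
  define R where "R = (\<lambda>d x a b. Rm (e d) (e x) (e a) (e b) p)"
  have a1: "R b a c d = - R a b c d" and a2: "R a b d c = - R a b c d" and ps: "R a b c d = R c d a b"
    and bi: "R a b c d + R b c a d + R c a b d = 0" for a b c d
    unfolding R_def
    using Rm_antisym_1[OF W(1) e e e e W(3)] Rm_antisym_2[OF W(1) e e e e W(3)] Rm_pair_sym[OF W(1) e e e e W(3)]
      Rm_bianchi[OF W(1) e e e e W(3)] by blast+
  have br: "H p (lie_bracket A (e d) (e x) p) (e a p) (e b p) = (\<Sum>f\<in>UNIV. (\<Gamma> p d x f - \<Gamma> p x d f) * Hc p f a b)" for d x a b
    unfolding bracket_frame[OF W] \<Gamma>_def Hc_def by (rule three_form_sum[OF H3 ep ep ep])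
  \<comment> \<open>The first-order equation is differentiated and substituted into itself. The
    operator of the direction differentiated first, \<open>e x\<close>, ends up outermost.\<close>
  have sdx: "spinor_deriv (e d p) (\<lambda>q. spinor_deriv (e x q) \<psi>)
      = - ((1/4) *\<^sub>R (C2 (\<lambda>a b. dG d x a b + dH d x a b / 2) (\<psi> p) - (1/4) *\<^sub>R C2 (w p x) (C2 (w p d) (\<psi> p))))" for d x
  proof -
    have "spinor_deriv (e d p) (\<lambda>q. spinor_deriv (e x q) \<psi>) = spinor_deriv (e d p) (\<lambda>q. C2 (\<lambda>a b. (-1/4) * w q x a b) (\<psi> q))"
      by (rule spinor_deriv_cong[OF ep W(1,3)]) (subst C2_scale, simp add: killing w_def)
    also have "\<dots> = C2 (\<lambda>a b. e d p (\<lambda>q. (-1/4) * w q x a b)) (\<psi> p) + C2 (\<lambda>a b. (-1/4) * w p x a b) (spinor_deriv (e d p) \<psi>)"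
      by (rule spinor_deriv_C2[OF cl ep sp]) (rule smooth_near_cmult[OF wn])
    also have "C2 (\<lambda>a b. e d p (\<lambda>q. (-1/4) * w q x a b)) (\<psi> p) = - ((1/4) *\<^sub>R C2 (\<lambda>a b. dG d x a b + dH d x a b / 2) (\<psi> p))"
      unfolding tangent_cmult[OF ep wn] dw C2_scale by simp
    also have "C2 (\<lambda>a b. (-1/4) * w p x a b) (spinor_deriv (e d p) \<psi>) = (1/16) *\<^sub>R C2 (w p x) (C2 (w p d) (\<psi> p))"
      unfolding C2_scale killing[OF W(3)] w_def by (simp add: linear_neg[OF C2_linear] linear_scale[OF C2_linear])
    finally show ?thesis by (simp add: scaleR_diff_right)
  qed
  \<comment> \<open>Up to the factor -1/4, both sides are the derivative of the spinor along the
    bracket of \<open>e d\<close> and \<open>e x\<close>: once as a commutator of derivatives, once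
    through the frame expansion.\<close>
  have integrable: "C2 (\<lambda>a b. dG d x a b + dH d x a b / 2) (\<psi> p) - C2 (\<lambda>a b. dG x d a b + dH x d a b / 2) (\<psi> p)
      + (1/4) *\<^sub>R (C2 (w p d) (C2 (w p x) (\<psi> p)) - C2 (w p x) (C2 (w p d) (\<psi> p)))
      = (\<Sum>f\<in>UNIV. (\<Gamma> p d x f - \<Gamma> p x d f) *\<^sub>R C2 (w p f) (\<psi> p))" (is "?l = ?r") for d x
  proof -
    have "- ((1/4) *\<^sub>R ?l) = spinor_deriv (lie_bracket A (e d) (e x) p) \<psi>"
      unfolding spinor_deriv_bracket[OF sp] sdx by (simp add: algebra_simps)
    also have "\<dots> = (\<Sum>f\<in>UNIV. (\<Gamma> p d x f - \<Gamma> p x d f) *\<^sub>R - ((1/4) *\<^sub>R C2 (w p f) (\<psi> p)))"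
      unfolding bracket_frame[OF W] spinor_deriv_comb killing[OF W(3)] by (simp add: \<Gamma>_def w_def)
    also have "\<dots> = - ((1/4) *\<^sub>R ?r)"
      by (simp add: scaleR_sum_right sum_negf mult.commute)
    finally show ?thesis by simp
  qed
  have dd: "C1 (d\<phi> d) (\<psi> p) + (1/12) *\<^sub>R C3 (dH d) (\<psi> p)
      - (1/4) *\<^sub>R (C1 (\<phi>c p) (C2 (w p d) (\<psi> p)) + (1/12) *\<^sub>R C3 (Hc p) (C2 (w p d) (\<psi> p))) = 0" for d
  proof -
    have "C1 (\<phi>c q) (\<psi> q) = C3 (\<lambda>a b d. (-1/12) * Hc q a b d) (\<psi> q)" if "q \<in> W" for q
      using dilatino[OF that] unfolding C3_scale \<phi>c_def by (simp add: eq_neg_iff_add_eq_0)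
    then have "spinor_deriv (e d p) (\<lambda>q. C1 (\<phi>c q) (\<psi> q)) = spinor_deriv (e d p) (\<lambda>q. C3 (\<lambda>a b d. (-1/12) * Hc q a b d) (\<psi> q))"
      by (rule spinor_deriv_cong[OF ep W(1,3)])
    then show ?thesis
      unfolding spinor_deriv_C1[OF cl ep sp \<phi>n] spinor_deriv_C3[OF cl ep sp smooth_near_cmult[OF Hn]]
      unfolding tangent_cmult[OF ep Hn] C3_scale killing[OF W(3)]
      by (simp add: linear_neg[OF C1_linear] linear_neg[OF C3_linear] linear_scale[OF C1_linear] linear_scale[OF C3_linear]
        w_def d\<phi>_def dH_def algebra_simps)
  qed
  have "(\<Sum>x\<in>UNIV. R d x x b) = - 2 * (d\<phi> d b - (\<Sum>f\<in>UNIV. \<Gamma> p d b f * \<phi>c p f))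
      + (1/4) * (\<Sum>x\<in>UNIV. \<Sum>f\<in>UNIV. Hc p d x f * Hc p b x f)"
  proof (rule ricci_of_killing[where \<Gamma> = "\<Gamma> p" and H = "Hc p" and R = R and \<phi> = "\<phi>c p" and d\<phi> = d\<phi>
      and dG = dG and dH = dH and \<psi> = "\<psi> p"])
    show "\<Gamma> p d b a = - \<Gamma> p d a b" for d a b by (rule \<Gamma>_anti[OF W(3)])
    show "Hc p b a d = - Hc p a b d" "Hc p a d b = - Hc p a b d" for a b d by (rule Hc_anti[OF W(3)])+
    show "dH e b a d = - dH e a b d" "dH e a d b = - dH e a b d" for e a b d
      unfolding dH_def by (rule neg[OF Hn Hc_anti(1)] neg[OF Hn Hc_anti(2)]; assumption)+
    show "dG e d b a = - dG e d a b" for e d a b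
      unfolding dG_def by (rule neg[OF \<Gamma>n \<Gamma>_anti])
    show "R d x a b = dG d x a b - dG x d a b
      + (\<Sum>f\<in>UNIV. \<Gamma> p x a f * \<Gamma> p d f b - \<Gamma> p d a f * \<Gamma> p x f b) - (\<Sum>f\<in>UNIV. (\<Gamma> p d x f - \<Gamma> p x d f) * \<Gamma> p f a b)" for d x a b
      unfolding R_def dG_def \<Gamma>_def by (rule Rm_frame[OF W])
    \<comment> \<open>\<open>Rm_bianchi\<close> permutes the first three slots; pair symmetry moves
      the cycle to the last three.\<close>
    show "R d x a b + R d a b x + R d b x a = 0" for d x a b
      using ps[of d x a b] ps[of d a b x] ps[of d b x a] bi[of a b x d] a2[of a b x d] a2[of b x a d] a2[of x a b d] by simp
    show "R b x x d = R d x x b" for d x b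
      using ps[of b x x d] a1[of x d b x] a2[of d x b x] by linarith
    show "d\<phi> d b - (\<Sum>f\<in>UNIV. \<Gamma> p d b f * \<phi>c p f) = d\<phi> b d - (\<Sum>f\<in>UNIV. \<Gamma> p b d f * \<phi>c p f)" for d b
      using hessian_sym[OF W(1) e e W(3) \<phi>, of d b] unfolding hess .
    show "dH d x a b - dH x d a b + dH a d x b - dH b d x a
      - (\<Sum>f\<in>UNIV. (\<Gamma> p d x f - \<Gamma> p x d f) * Hc p f a b) + (\<Sum>f\<in>UNIV. (\<Gamma> p d a f - \<Gamma> p a d f) * Hc p f x b)
      - (\<Sum>f\<in>UNIV. (\<Gamma> p d b f - \<Gamma> p b d f) * Hc p f x a) - (\<Sum>f\<in>UNIV. (\<Gamma> p x a f - \<Gamma> p a x f) * Hc p f d b)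
      + (\<Sum>f\<in>UNIV. (\<Gamma> p x b f - \<Gamma> p b x f) * Hc p f d a) - (\<Sum>f\<in>UNIV. (\<Gamma> p a b f - \<Gamma> p b a f) * Hc p f d x) = 0" for d x a b
    proof -
      have "ext_deriv3 A H (e d) (e x) (e a) (e b) p = 0"
        using H W e unfolding closed_three_form_def by blast
      then show ?thesis unfolding ext_deriv3_def br dH_def Hc_def .
    qed
    show "C1 (\<phi>c p) (\<psi> p) + (1/12) *\<^sub>R C3 (Hc p) (\<psi> p) = 0"
      using dilatino[OF W(3)] unfolding \<phi>c_def .
    show "u = (\<lambda>_. 0)" if "C1 u (\<psi> p) = 0" for u
      by (rule spinor_module_faithful[OF cl \<psi>(2) that])
  qed (use integrable dd in \<open>simp_all add: w_def\<close>)
  \<comment> \<open>\<open>ricci\<close> contracts the outer slots, \<open>ricci_of_killing\<close>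
    the middle ones; two sign changes reconcile them.\<close>
  moreover have "Rm (e x) (e d) (e b) (e x) p = R d x x b" for x
    using a1[of d x x b] a2[of x d x b] unfolding R_def by simp
  ultimately show ?thesis unfolding hess by simp
qed

section \<open>Change of orthonormal frame\<close>

lemma frame_change_trace:
  assumes W: "orthonormal_frame A g W e" "orthonormal_frame A g W E" "p \<in> W"
  shows "(\<Sum>a\<in>UNIV. \<Sum>i\<in>UNIV. \<Sum>j\<in>UNIV. g p (E a p) (e i p) * (g p (E a p) (e j p) * B i j)) = (\<Sum>i\<in>UNIV. B i i)"
proof (rule sum_orthogonal)
  note et = frame_tangent[OF W(1,3)] and Et = frame_tangent[OF W(2,3)]
  show "(\<Sum>a\<in>UNIV. g p (E a p) (e i p) * g p (E a p) (e j p)) = (if i = j then 1 else 0)" for i j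
    using metric_frame[OF W(2,3) et et] metric_sym[OF et Et] frame_on[OF W(1,3)] by simp
qed

lemma ricci_change_frame:
  assumes W: "open W" "orthonormal_frame A g W e" "orthonormal_frame A g W E" "p \<in> W"
    and X: "X \<in> vector_fields A W" "Y \<in> vector_fields A W"
  shows "ricci A g nabla E X Y p = ricci A g nabla e X Y p"
proof -
  note e = frame_field[OF W(2)] and E = frame_field[OF W(3)]
  have "Rm (E a) X Y (E a) p = (\<Sum>i\<in>UNIV. \<Sum>j\<in>UNIV. g p (E a p) (e i p) * (g p (E a p) (e j p) * Rm (e i) X Y (e j) p))" for a
    using tensorial_expand[OF Rm_tensorial_1[OF W(1) X E W(4)] W(1,4,2) E]
      tensorial_expand[OF Rm_tensorial_4[OF W(1) e X W(4)] W(1,4,2) E]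
    by (simp add: sum_distrib_left)
  then show ?thesis unfolding ricci_Rm using frame_change_trace[OF W(2-4)] by simp
qed

text \<open>One slot at a time is a trace. Antisymmetry exchanges the slots in both factors at once,
  so the signs cancel and linearity in the first slot suffices.\<close>

lemma form_inner_change_frame:
  fixes \<alpha> \<beta> :: "'m tangent \<Rightarrow> 'm tangent \<Rightarrow> real"
  assumes W: "orthonormal_frame A g W e" "orthonormal_frame A g W E" "p \<in> W"
    and \<alpha>: "\<And>r u v. (\<And>i::'n. u i \<in> tangent_space A p) \<Longrightarrow> v \<in> tangent_space A p \<Longrightarrow>
      \<alpha> (\<lambda>f. \<Sum>i\<in>UNIV. r i * u i f) v = (\<Sum>i\<in>UNIV. r i * \<alpha> (u i) v)"
      "\<And>u v. u \<in> tangent_space A p \<Longrightarrow> v \<in> tangent_space A p \<Longrightarrow> \<alpha> v u = - \<alpha> u v"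
    and \<beta>: "\<And>r u v. (\<And>i::'n. u i \<in> tangent_space A p) \<Longrightarrow> v \<in> tangent_space A p \<Longrightarrow>
      \<beta> (\<lambda>f. \<Sum>i\<in>UNIV. r i * u i f) v = (\<Sum>i\<in>UNIV. r i * \<beta> (u i) v)"
      "\<And>u v. u \<in> tangent_space A p \<Longrightarrow> v \<in> tangent_space A p \<Longrightarrow> \<beta> v u = - \<beta> u v"
  shows "(\<Sum>a\<in>UNIV. \<Sum>b\<in>UNIV. \<alpha> (E a p) (E b p) * \<beta> (E a p) (E b p))
    = (\<Sum>a\<in>UNIV. \<Sum>b\<in>UNIV. \<alpha> (e a p) (e b p) * \<beta> (e a p) (e b p))"
proof -
  note et = frame_tangent[OF W(1,3)] and Et = frame_tangent[OF W(2,3)]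
  have E: "E a p = (\<lambda>f. \<Sum>i\<in>UNIV. g p (E a p) (e i p) * e i p f)" for a
    by (rule frame_expand[OF W(1,3) Et])
  have trace: "(\<Sum>a\<in>UNIV. \<alpha> (E a p) v * \<beta> (E a p) v) = (\<Sum>i\<in>UNIV. \<alpha> (e i p) v * \<beta> (e i p) v)"
    if v: "v \<in> tangent_space A p" for v
  proof -
    have "\<alpha> (E a p) v = (\<Sum>i\<in>UNIV. g p (E a p) (e i p) * \<alpha> (e i p) v)"
      "\<beta> (E a p) v = (\<Sum>i\<in>UNIV. g p (E a p) (e i p) * \<beta> (e i p) v)" for a
      by (subst E, rule \<alpha>(1)[OF et v], subst E, rule \<beta>(1)[OF et v])
    then have "(\<Sum>a\<in>UNIV. \<alpha> (E a p) v * \<beta> (E a p) v)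
      = (\<Sum>a\<in>UNIV. \<Sum>i\<in>UNIV. \<Sum>j\<in>UNIV. g p (E a p) (e i p) * (g p (E a p) (e j p) * (\<alpha> (e i p) v * \<beta> (e j p) v)))"
      by (simp add: sum_product ac_simps)
    then show ?thesis unfolding frame_change_trace[OF W] .
  qed
  have sw: "\<alpha> u v * \<beta> u v = \<alpha> v u * \<beta> v u" if "u \<in> tangent_space A p" "v \<in> tangent_space A p" for u v
    using \<alpha>(2)[OF that] \<beta>(2)[OF that] by simp
  have "(\<Sum>a\<in>UNIV. \<Sum>b\<in>UNIV. \<alpha> (E a p) (E b p) * \<beta> (E a p) (E b p))
      = (\<Sum>b\<in>UNIV. \<Sum>a\<in>UNIV. \<alpha> (E a p) (E b p) * \<beta> (E a p) (E b p))"
    by (rule sum.swap)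
  also have "\<dots> = (\<Sum>b\<in>UNIV. \<Sum>i\<in>UNIV. \<alpha> (E b p) (e i p) * \<beta> (E b p) (e i p))"
    unfolding trace[OF Et] using sw[OF et Et] by simp
  also have "\<dots> = (\<Sum>i\<in>UNIV. \<Sum>b\<in>UNIV. \<alpha> (E b p) (e i p) * \<beta> (E b p) (e i p))"
    by (rule sum.swap)
  also have "\<dots> = (\<Sum>i\<in>UNIV. \<Sum>j\<in>UNIV. \<alpha> (e i p) (e j p) * \<beta> (e i p) (e j p))"
    unfolding trace[OF et] using sw[OF et et] by simp
  finally show ?thesis .
qed

text \<open>The difference of the two sides is tensorial in \<open>X\<close> and in \<open>Y\<close>
  and vanishes on the frame \<open>e\<close>; the traces over \<open>e\<close> and \<open>E\<close>
  agree by orthogonality.\<close>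

lemma ricci_from_frame:
  assumes W: "open W" "orthonormal_frame A g W e" "orthonormal_frame A g W E" "p \<in> W"
    and X: "X \<in> vector_fields A W" "Y \<in> vector_fields A W"
    and H: "three_form A H" and \<phi>: "smooth_fun A W \<phi>"
    and frame: "\<And>d b. (\<Sum>x\<in>UNIV. Rm (e x) (e d) (e b) (e x) p) = - 2 * hessian nabla \<phi> (e d) (e b) p
      + (1/4) * (\<Sum>x\<in>UNIV. \<Sum>f\<in>UNIV. H p (e d p) (e x p) (e f p) * H p (e b p) (e x p) (e f p))"
  shows "ricci A g nabla E X Y p = - 2 * hessian nabla \<phi> X Y p
    + (1/4) * (\<Sum>a\<in>UNIV. \<Sum>b\<in>UNIV. H p (X p) (E a p) (E b p) * H p (Y p) (E a p) (E b p))"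
proof -
  note e = frame_field[OF W(2)] and et = frame_tangent[OF W(2,4)]
  \<comment> \<open>The nesting follows the pattern \<open>r * F + F'\<close> of
    \<open>tensorial_lincomb\<close>.\<close>
  define F where "F = (\<lambda>X Y. 2 * hessian nabla \<phi> X Y p + ((- 1/4) * (\<Sum>a\<in>UNIV. \<Sum>b\<in>UNIV.
    H p (X p) (e a p) (e b p) * H p (Y p) (e a p) (e b p)) + (\<Sum>x\<in>UNIV. Rm (e x) X Y (e x) p)))"
  have 1: "tensorial W p (\<lambda>X. F X Y)" if "Y \<in> vector_fields A W" for Y
    unfolding F_def
    by (intro tensorial_lincomb tensorial_sum_fun tensorial_mult_right hessian_tensorial_1
      Rm_tensorial_2 three_form_tensorial[OF H] W e et that \<phi>)
  have 2: "tensorial W p (\<lambda>Y. F X Y)" if "X \<in> vector_fields A W" for X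
    unfolding F_def
    by (intro tensorial_lincomb tensorial_sum_fun tensorial_mult_left hessian_tensorial_2
      Rm_tensorial_3 three_form_tensorial[OF H] W e et that \<phi>)
  have 0: "F (e d) (e b) = 0" for d b
    unfolding F_def frame by simp
  have "F X Y = 0"
    using tensorial_expand[OF 1[OF X(2)] W(1,4,2) X(1)] tensorial_expand[OF 2[OF e] W(1,4,2) X(2)] 0 by simp
  moreover have "(\<Sum>a\<in>UNIV. \<Sum>b\<in>UNIV. H p (X p) (E a p) (E b p) * H p (Y p) (E a p) (E b p))
      = (\<Sum>a\<in>UNIV. \<Sum>b\<in>UNIV. H p (X p) (e a p) (e b p) * H p (Y p) (e a p) (e b p))"
  proof -
    have sw: "H p (Z p) v u = - H p (Z p) u v"
      if "u \<in> tangent_space A p" "v \<in> tangent_space A p" "Z \<in> vector_fields A W" for Z u v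
      using three_form_swap_23[OF H vf_tangent[OF that(3) W(4)] that(1,2)] .
    have lin: "H p (Z p) (\<lambda>f. \<Sum>i\<in>UNIV. r i * u i f) v = (\<Sum>i\<in>UNIV. r i * H p (Z p) (u i) v)"
      if "\<And>i::'n. u i \<in> tangent_space A p" "v \<in> tangent_space A p" "Z \<in> vector_fields A W" for Z r u v
    proof -
      note Z = vf_tangent[OF that(3) W(4)]
      show ?thesis
        using three_form_sum[OF H, of UNIV u p "Z p" v r, OF that(1) Z that(2)]
          three_form_swap_12[OF H tangent_sum[of UNIV u p r, OF that(1)] Z that(2)]
          three_form_swap_12[OF H that(1) Z that(2)] by (simp add: sum_negf)
    qed
    show ?thesis
      by (rule form_inner_change_frame[OF W(2-4)]) (erule (1) sw lin; rule X)+
  qed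
  ultimately show ?thesis
    unfolding ricci_change_frame[OF W X] unfolding ricci_Rm F_def by simp
qed

end

theorem theorem5p6:
  fixes A :: "('m::{second_countable_topology,t2_space}, 'n::{finite,linorder}) chart set"
    and g :: "'m \<Rightarrow> 'm tangent \<Rightarrow> 'm tangent \<Rightarrow> real"
    and nabla :: "'m vfield \<Rightarrow> 'm vfield \<Rightarrow> 'm vfield"
    and cl :: "'n \<Rightarrow> complex^'k^'k::finite"
    and P :: "'p set" and proj :: "'p \<Rightarrow> 'm" and act :: "'p \<Rightarrow> complex^'k^'k \<Rightarrow> 'p"
    and fr :: "'p \<Rightarrow> 'n \<Rightarrow> 'm tangent" and S :: "('m set \<times> ('m \<Rightarrow> 'p)) set"
    and H :: "'m \<Rightarrow> 'm tangent \<Rightarrow> 'm tangent \<Rightarrow> 'm tangent \<Rightarrow> real"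
    and \<phi> :: "'m \<Rightarrow> real"
    and \<Psi>\<^sub>L \<Psi>\<^sub>R :: "'p \<Rightarrow> complex^'k"
  assumes "riemannian_spin_manifold A g cl P proj act fr S"
    and "levi_civita_connection A g nabla"
    and "closed_three_form A H"
    and "smooth_fun A UNIV \<phi>"
    and "spinor_field A cl P act S \<Psi>\<^sub>L" and "\<forall>b\<in>P. norm (\<Psi>\<^sub>L b) = 1"
    and "spinor_field A cl P act S \<Psi>\<^sub>R" and "\<forall>b\<in>P. norm (\<Psi>\<^sub>R b) = 1"
    and "\<forall>(U, s)\<in>S. \<forall>V X. open V \<longrightarrow> V \<subseteq> U \<longrightarrow> X \<in> vector_fields A V \<longrightarrow> (\<forall>p\<in>V.
        spin_nabla g nabla cl (\<lambda>a q. fr (s q) a) X (\<Psi>\<^sub>L \<circ> s) p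
          + (1/4) *\<^sub>R clifford2 cl (fr (s p)) (H p (X p)) (\<Psi>\<^sub>L (s p)) = 0)"
    and "\<forall>b\<in>P. clifford1 cl (fr b) (differential \<phi>) (\<Psi>\<^sub>L b)
          + (1/2) *\<^sub>R clifford3 cl (fr b) (H (proj b)) (\<Psi>\<^sub>L b) = 0"
    and "\<forall>(U, s)\<in>S. \<forall>V X. open V \<longrightarrow> V \<subseteq> U \<longrightarrow> X \<in> vector_fields A V \<longrightarrow> (\<forall>p\<in>V.
        spin_nabla g nabla cl (\<lambda>a q. fr (s q) a) X (\<Psi>\<^sub>R \<circ> s) p
          - (1/4) *\<^sub>R clifford2 cl (fr (s p)) (H p (X p)) (\<Psi>\<^sub>R (s p)) = 0)"
    and "\<forall>b\<in>P. clifford1 cl (fr b) (differential \<phi>) (\<Psi>\<^sub>R b)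
          - (1/2) *\<^sub>R clifford3 cl (fr b) (H (proj b)) (\<Psi>\<^sub>R b) = 0"
  shows "\<forall>U E. open U \<longrightarrow> orthonormal_frame A g U E \<longrightarrow> (\<forall>p\<in>U.
      (\<forall>X\<in>vector_fields A U. \<forall>Y\<in>vector_fields A U.
         ricci A g nabla E X Y p = - 2 * hessian nabla \<phi> X Y p
           + (1/2) * inner_form2 (\<lambda>a. E a p) (H p (X p)) (H p (Y p))) \<and>
      scalar_curvature A g nabla E p = 2 * laplacian nabla E \<phi> p
           + (3/2) * sqnorm_form3 (\<lambda>a. E a p) (H p))"
proof (intro allI impI conjI ballI)
  fix U E p
  assume U: "open U" and E: "orthonormal_frame A g U E" and p: "p \<in> U"
  interpret riemannian_spin_manifold A g cl P proj act fr S by (rule assms(1))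
  interpret levi_civita_connection A g nabla by (rule assms(2))
  have H: "three_form A H" using assms(3) unfolding closed_three_form_def by blast
  have "p \<in> (\<Union>(U, s)\<in>S. U)" using sections_cover by simp
  then obtain V s where s: "(V, s) \<in> S" "p \<in> V" by blast
  \<comment> \<open>\<open>E\<close> lives on \<open>U\<close> and the spin section on
    \<open>V\<close>; both frames are compared on the intersection.\<close>
  define W where "W = U \<inter> V"
  define e where "e = (\<lambda>a q. fr (s q) a)"
  define \<psi> where "\<psi> = \<Psi>\<^sub>L \<circ> s"
  have W: "open W" "p \<in> W" "W \<subseteq> U" "W \<subseteq> V"
    using U p s section_open[OF s(1)] unfolding W_def by auto
  have sP: "s q \<in> P" "proj (s q) = q" if "q \<in> W" for q
    using section_in_fibre[OF s(1)] that W(4) by auto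
  have eW: "orthonormal_frame A g W e"
    unfolding orthonormal_frame_def
  proof (intro conjI allI ballI)
    show "e a \<in> vector_fields A W" for a
      unfolding e_def by (rule vf_subset[OF section_frame[OF s(1)] W(4)])
    show "g q (e a q) (e b q) = (if a = b then 1 else 0)" if "q \<in> W" for q a b
      using fr_orthonormal[OF sP(1)[OF that], of a b] sP(2)[OF that] by (simp add: e_def)
  qed
  note ef = frame_field[OF eW] and et = frame_tangent[OF eW]
  have EW: "orthonormal_frame A g W E" by (rule frame_subset[OF E W(3)])
  have \<phi>: "smooth_fun A W \<phi>" using smooth_fun_subset[OF assms(4)] by simp
  have "smooth_fun A V \<psi>"
    using assms(5) s(1) unfolding spinor_field_def \<psi>_def by blast
  then have \<psi>: "smooth_fun A W \<psi>" by (rule smooth_fun_subset[OF _ W(4)])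
  have \<psi>0: "\<psi> p \<noteq> 0"
    using assms(6) sP(1)[OF W(2)] unfolding \<psi>_def by force
  interpret cl: clifford_action "\<lambda>a. (*v) (cl a)" by (rule spinor_module_clifford_action[OF module])
  have anti: "H q v u w = - H q u v w" "H q u w v = - H q u v w"
    if "u \<in> tangent_space A q" "v \<in> tangent_space A q" "w \<in> tangent_space A q" for q u v w
    using three_form_swap_12[OF H that] three_form_swap_23[OF H that] by blast+
  have killing: "spinor_deriv (e x q) \<psi> = - ((1/4) *\<^sub>R cl.C2
      (\<lambda>a b. g q (nabla (e x) (e a) q) (e b q) + H q (e x q) (e a q) (e b q) / 2) (\<psi> q))" if q: "q \<in> W" for q x
  proof -
    have "spin_nabla g nabla cl e (e x) \<psi> q + (1/4) *\<^sub>R clifford2 cl (\<lambda>a. e a q) (H q (e x q)) (\<psi> q) = 0"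
      using assms(9) s(1) W(1,4) ef[of x] q unfolding e_def \<psi>_def by fastforce
    moreover have "(\<Sum>(a, b)\<in>{(a, b). a < b}. g q (nabla (e x) (e a) q) (e b q) *\<^sub>R (cl a *v (cl b *v \<psi> q)))
        = (1/2) *\<^sub>R cl.C2 (\<lambda>a b. g q (nabla (e x) (e a) q) (e b q)) (\<psi> q)"
      by (rule clifford2_C2[OF module]) (rule connection_antisym[OF W(1) eW q ef])
    moreover have "clifford2 cl (\<lambda>a. e a q) (H q (e x q)) (\<psi> q)
        = (1/2) *\<^sub>R cl.C2 (\<lambda>a b. H q (e x q) (e a q) (e b q)) (\<psi> q)"
      unfolding clifford2_def by (rule clifford2_C2[OF module]) (rule anti(2)[OF et et et]; rule q)
    \<comment> \<open>Passing to sums over all pairs halves both coefficients, the 1/2 of the spin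
      connection and the 1/4 of H; the common factor 1/4 then leaves \<Gamma> + H/2.\<close>
    ultimately have "spinor_deriv (e x q) \<psi> + (1/4) *\<^sub>R cl.C2 (\<lambda>a b. g q (nabla (e x) (e a) q) (e b q)) (\<psi> q)
        + (1/8) *\<^sub>R cl.C2 (\<lambda>a b. H q (e x q) (e a q) (e b q)) (\<psi> q) = 0"
      unfolding spin_nabla_def by simp
    moreover have "cl.C2 (\<lambda>a b. g q (nabla (e x) (e a) q) (e b q) + H q (e x q) (e a q) (e b q) / 2) (\<psi> q)
        = cl.C2 (\<lambda>a b. g q (nabla (e x) (e a) q) (e b q)) (\<psi> q)
          + (1/2) *\<^sub>R cl.C2 (\<lambda>a b. H q (e x q) (e a q) (e b q)) (\<psi> q)"
      using cl.C2_scale[of "1/2"] by (simp add: cl.C2_add)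
    ultimately show ?thesis
      by (simp add: scaleR_add_right) (simp add: eq_diff_eq eq_neg_iff_add_eq_0 ac_simps)
  qed
  have dilatino: "cl.C1 (\<lambda>a. e a q \<phi>) (\<psi> q) + (1/12) *\<^sub>R cl.C3 (\<lambda>a b d. H q (e a q) (e b q) (e d q)) (\<psi> q) = 0"
    if q: "q \<in> W" for q
  proof -
    have "clifford1 cl (fr (s q)) (differential \<phi>) (\<Psi>\<^sub>L (s q)) + (1/2) *\<^sub>R clifford3 cl (fr (s q)) (H (proj (s q))) (\<Psi>\<^sub>L (s q)) = 0"
      using assms(10) sP(1)[OF q] by blast
    then have "clifford1 cl (\<lambda>a. e a q) (differential \<phi>) (\<psi> q) + (1/2) *\<^sub>R clifford3 cl (\<lambda>a. e a q) (H q) (\<psi> q) = 0"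
      using sP(2)[OF q] by (simp add: e_def \<psi>_def)
    moreover have "clifford3 cl (\<lambda>a. e a q) (H q) (\<psi> q) = (1/6) *\<^sub>R cl.C3 (\<lambda>a b d. H q (e a q) (e b q) (e d q)) (\<psi> q)"
      unfolding clifford3_def
      by (rule clifford3_C3[OF module]) (rule anti[OF et et et]; rule q)+
    ultimately show ?thesis by (simp add: clifford1_def differential_def cl.C1_def)
  qed
  have ricci: "ricci A g nabla E X Y p = - 2 * hessian nabla \<phi> X Y p
      + (1/2) * inner_form2 (\<lambda>a. E a p) (H p (X p)) (H p (Y p))"
    if "X \<in> vector_fields A U" "Y \<in> vector_fields A U" for X Y
  proof -
    have X: "X \<in> vector_fields A W" "Y \<in> vector_fields A W"
      using that vf_subset[OF _ W(3)] by blast+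
    note E = frame_tangent[OF EW W(2)]
    have Hn: "H p v (E b p) (E a p) = - H p v (E a p) (E b p)" if "v \<in> tangent_space A p" for v a b
      by (rule anti(2)[OF that E E])
    note HX = Hn[OF vf_tangent[OF X(1) W(2)]] and HY = Hn[OF vf_tangent[OF X(2) W(2)]]
    have "(\<Sum>a\<in>UNIV. \<Sum>b\<in>UNIV. H p (X p) (E a p) (E b p) * H p (Y p) (E a p) (E b p))
        = 2 *\<^sub>R (\<Sum>(a, b)\<in>{(a, b). a < b}. H p (X p) (E a p) (E b p) * H p (Y p) (E a p) (E b p))"
    proof (rule sum_symmetric_pairs)
      show "H p (X p) (E b p) (E a p) * H p (Y p) (E b p) (E a p)
          = H p (X p) (E a p) (E b p) * H p (Y p) (E a p) (E b p)" for a b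
        using HX[of b a] HY[of b a] by simp
      show "H p (X p) (E a p) (E a p) * H p (Y p) (E a p) (E a p) = 0" for a
        using HX[of a a] by simp
    qed
    moreover have "ricci A g nabla E X Y p = - 2 * hessian nabla \<phi> X Y p
        + (1/4) * (\<Sum>a\<in>UNIV. \<Sum>b\<in>UNIV. H p (X p) (E a p) (E b p) * H p (Y p) (E a p) (E b p))"
      by (rule ricci_from_frame[OF W(1) eW EW W(2) X H \<phi>],
        rule ricci_in_parallel_spin_frame[OF module W(1) eW W(2) assms(3) \<phi> \<psi> \<psi>0])
        (erule killing dilatino)+
    ultimately show ?thesis unfolding inner_form2_def by simp
  qed
  show "ricci A g nabla E X Y p = - 2 * hessian nabla \<phi> X Y p
      + (1/2) * inner_form2 (\<lambda>a. E a p) (H p (X p)) (H p (Y p))"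
    if "X \<in> vector_fields A U" "Y \<in> vector_fields A U" for X Y
    using that by (rule ricci)
  show "scalar_curvature A g nabla E p = 2 * laplacian nabla E \<phi> p + (3/2) * sqnorm_form3 (\<lambda>a. E a p) (H p)"
  proof -
    have Ep: "E a p \<in> tangent_space A p" for a by (rule frame_tangent[OF E p])
    have swap: "H p (E b p) (E a p) (E d p) = - H p (E a p) (E b p) (E d p)"
      "H p (E a p) (E d p) (E b p) = - H p (E a p) (E b p) (E d p)" for a b d
      by (rule anti[OF Ep Ep Ep])+
    have inner: "inner_form2 (\<lambda>a. E a p) (H p (E a p)) (H p (E a p))
        = (1/2) * (\<Sum>b\<in>UNIV. \<Sum>d\<in>UNIV. (H p (E a p) (E b p) (E d p))\<^sup>2)" for a
    proof -
      have "(\<Sum>b\<in>UNIV. \<Sum>d\<in>UNIV. (H p (E a p) (E b p) (E d p))\<^sup>2)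
          = 2 *\<^sub>R (\<Sum>(b, d)\<in>{(b, d). b < d}. (H p (E a p) (E b p) (E d p))\<^sup>2)"
      proof (rule sum_symmetric_pairs)
        show "(H p (E a p) (E d p) (E b p))\<^sup>2 = (H p (E a p) (E b p) (E d p))\<^sup>2" for b d
          using swap(2)[of a d b] by simp
        show "(H p (E a p) (E b p) (E b p))\<^sup>2 = 0" for b
          using swap(2)[of a b b] by simp
      qed
      then show ?thesis by (simp add: inner_form2_def power2_eq_square)
    qed
    \<comment> \<open>The trace of the inner products is half of this full sum, hence 3 times the
      squared norm; the 1/2 in the Ricci formula makes it 3/2.\<close>
    have sq: "(\<Sum>a\<in>UNIV. \<Sum>b\<in>UNIV. \<Sum>d\<in>UNIV. (H p (E a p) (E b p) (E d p))\<^sup>2)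
        = 6 *\<^sub>R sqnorm_form3 (\<lambda>a. E a p) (H p)"
      unfolding sqnorm_form3_def
    proof (rule sum_symmetric_triples)
      show "(H p (E b p) (E a p) (E d p))\<^sup>2 = (H p (E a p) (E b p) (E d p))\<^sup>2"
        "(H p (E a p) (E d p) (E b p))\<^sup>2 = (H p (E a p) (E b p) (E d p))\<^sup>2" for a b d
        using swap(1)[of b a d] swap(2)[of a d b] by simp_all
      show "(H p (E a p) (E a p) (E b p))\<^sup>2 = 0" for a b
        using swap(1)[of a a b] by simp
    qed
    show ?thesis
      using sq unfolding scalar_curvature_def laplacian_def ricci[OF frame_field[OF E] frame_field[OF E]] inner
      by (simp add: sum_subtractf flip: sum_distrib_left sum_divide_distrib)
  qed
qed

end
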